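(* Let $r,n,m,d$ be positive integers, let $\underline{T}=(T_1, \ldots, T_r)$, $\underline{Y}=(Y_1, \ldots, Y_n)$ be tuples of variables, and let $F_1, \ldots, F_m$ be irreducible polynomials in $\mathbb{Q}[\underline{T}, \underline{Y}]$ of degree at most $d$ such that $\deg_{\underline{Y}}(F_i) \ge 1$ for each $i$. Then there exists a polynomial $G$ of degree at most $30$ in $m+1$ variables, whose coefficients depend only on $r,n,m,d$, such that the following holds for every $s \ge 1$. If $X \subset \mathbb{A}^r_{\mathbb{Q}}$ is a (possibly reducible) hypersurface of degree at most $s$, then there is a tuple of integers $\underline{t} \in \mathbb{Z}_{\ge 0}^{r}$ not contained in $X(\mathbb{Q})$ of height at most $$C\cdot G(\log \lVert F_1\rVert, \ldots, \log \lVert F_m\rVert,s),$$ where $C=C(n,r)$ is a constant depending only on $n$ and $r$, such that for each $1 \le i \le m$ the polynomial $F_i(\underline{t},\underline{Y})$ is irreducible over $\mathbb{Q}$.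
   Context: $\|F\|$ denotes the height of the tuple of coefficients of $F$ viewed as a point in projective space over $\mathbb{Q}$ (i.e. after scaling the coefficients to be integers with greatest common divisor $1$, the maximum of their absolute values). The height of an integer tuple $\underline{t}=(t_1,\ldots,t_r)$ is $\max(1,|t_1|,\ldots,|t_r|)$. *)

theory Defs
  imports Complex_Main "HOL-Library.Poly_Mapping" "HOL-Computational_Algebra.Factorial_Ring"
begin

text \<open>
  The polynomial ring over \<open>'a\<close> in the variables of the type \<open>'v\<close>: finitely supported
  functions from monomials (exponent vectors) to coefficients, with convolution as product.
  For finite \<open>'v\<close> this is the polynomial ring in \<open>CARD('v)\<close> variables; in particular
  \<open>('r + 'n, rat) mpoly\<close> is \<open>\<rat>[T, Y]\<close>, where \<open>Inl j\<close> is the variable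
  \<open>T\<^sub>j\<close> and \<open>Inr k\<close> is the variable \<open>Y\<^sub>k\<close>.
\<close>

type_synonym ('v, 'a) mpoly = "('v \<Rightarrow>\<^sub>0 nat) \<Rightarrow>\<^sub>0 'a"

definition mpoly_vars :: "('v, 'a::zero) mpoly \<Rightarrow> 'v set" where
  "mpoly_vars p = (\<Union>e \<in> Poly_Mapping.keys p. Poly_Mapping.keys e)"

text \<open>The degree jointly in the variables of \<open>V\<close>; the zero polynomial gets degree 0.\<close>

definition degree_in :: "'v set \<Rightarrow> ('v, 'a::zero) mpoly \<Rightarrow> nat" where
  "degree_in V p =
     Max (insert 0 ((\<lambda>e. \<Sum>v \<in> Poly_Mapping.keys e \<inter> V. Poly_Mapping.lookup e v)
                      ` Poly_Mapping.keys p))"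

definition total_degree :: "('v, 'a::zero) mpoly \<Rightarrow> nat" where
  "total_degree p = degree_in UNIV p"

definition eval_mpoly :: "('v \<Rightarrow> 'a) \<Rightarrow> ('v, 'a::comm_semiring_1) mpoly \<Rightarrow> 'a" where
  "eval_mpoly x p =
     (\<Sum>e \<in> Poly_Mapping.keys p. Poly_Mapping.lookup p e *
        (\<Prod>v \<in> Poly_Mapping.keys e. x v ^ Poly_Mapping.lookup e v))"

text \<open>
  The polynomial \<open>F(t, Y)\<close> in \<open>Y\<close> obtained by substituting \<open>t\<close> for \<open>T\<close>:
  \<open>Poly_Mapping.map_key Inr e\<close> is the \<open>Y\<close>-part of the monomial \<open>e\<close>.
\<close>

definition specialize :: "('r::finite \<Rightarrow> 'a) \<Rightarrow> ('r + 'n, 'a::comm_semiring_1) mpoly \<Rightarrow> ('n, 'a) mpoly" where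
  "specialize t p =
     (\<Sum>e \<in> Poly_Mapping.keys p.
        Poly_Mapping.single (Poly_Mapping.map_key Inr e)
          (Poly_Mapping.lookup p e * (\<Prod>j \<in> UNIV. t j ^ Poly_Mapping.lookup e (Inl j))))"

definition primitive_multiple :: "('k \<Rightarrow>\<^sub>0 rat) \<Rightarrow> ('k \<Rightarrow>\<^sub>0 int) \<Rightarrow> bool" where
  "primitive_multiple p q \<longleftrightarrow>
     (\<exists>c::rat. c \<noteq> 0 \<and> (\<forall>k. of_int (Poly_Mapping.lookup q k) = c * Poly_Mapping.lookup p k)) \<and>
     Gcd (Poly_Mapping.lookup q ` Poly_Mapping.keys q) = 1"

definition coeff_height :: "('k \<Rightarrow>\<^sub>0 rat) \<Rightarrow> int" where
  "coeff_height p =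
     (THE h. \<exists>q. primitive_multiple p q \<and>
        h = Max ((\<lambda>k. \<bar>Poly_Mapping.lookup q k\<bar>) ` Poly_Mapping.keys q))"

definition height_tuple :: "('r::finite \<Rightarrow> int) \<Rightarrow> int" where
  "height_tuple t = Max (insert 1 (range (\<lambda>j. \<bar>t j\<bar>)))"

definition rational_zeros :: "('r, rat) mpoly \<Rightarrow> ('r \<Rightarrow> rat) set" where
  "rational_zeros P = {x. eval_mpoly x P = 0}"

text \<open>The description in the definition of \<^const>\<open>coeff_height\<close> is proper.\<close>

lemma primitive_multiple_exists:
  fixes p :: "'k \<Rightarrow>\<^sub>0 rat"
  assumes "p \<noteq> 0"
  shows "\<exists>q. primitive_multiple p q"
proof -
  define K where "K = Poly_Mapping.keys p"
  have K: "finite K" "K \<noteq> {}" using assms by (auto simp: K_def)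
  define den where "den k = snd (quotient_of (Poly_Mapping.lookup p k))" for k
  define D where "D = (\<Prod>k\<in>K. den k)"
  have den: "den k > 0" for k
    unfolding den_def by (simp add: quotient_of_denom_pos')
  have D: "D > 0" unfolding D_def using den by (simp add: prod_pos)
  have "\<exists>z::int. of_int z = of_int D * Poly_Mapping.lookup p k" for k
  proof (cases "k \<in> K")
    case True
    then have "den k dvd D" unfolding D_def using K by (simp add: dvd_prodI)
    then obtain w where w: "D = den k * w" by (auto elim: dvdE)
    have "Poly_Mapping.lookup p k = of_int (fst (quotient_of (Poly_Mapping.lookup p k))) / of_int (den k)"
      unfolding den_def by (metis prod.collapse quotient_of_div)
    then have "of_int (fst (quotient_of (Poly_Mapping.lookup p k)) * w) = of_int D * Poly_Mapping.lookup p k"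
      using den[of k] unfolding w by (simp add: field_simps)
    then show ?thesis by blast
  next
    case False
    then show ?thesis by (intro exI[of _ 0]) (simp add: K_def in_keys_iff)
  qed
  then obtain z :: "'k \<Rightarrow> int" where z: "\<And>k. of_int (z k) = of_int D * Poly_Mapping.lookup p k"
    by metis
  have z0: "z k \<noteq> 0 \<longleftrightarrow> k \<in> K" for k
  proof -
    have "z k \<noteq> 0 \<longleftrightarrow> (of_int (z k) :: rat) \<noteq> 0" by simp
    also have "\<dots> \<longleftrightarrow> k \<in> K" unfolding z using D by (simp add: K_def in_keys_iff)
    finally show ?thesis .
  qed
  define g where "g = Gcd (z ` K)"
  have g0: "g \<noteq> 0" using K z0 by (auto simp: g_def)
  have gz: "g dvd z k" for k
    using z0[of k] by (cases "k \<in> K") (auto simp: g_def)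
  define y where "y k = z k div g" for k
  have yz: "z k = g * y k" for k using gz by (simp add: y_def)
  have y0: "y k \<noteq> 0 \<longleftrightarrow> k \<in> K" for k using z0[of k] yz[of k] g0 by auto
  define q where "q = Abs_poly_mapping y"
  have "finite {k. y k \<noteq> 0}" using K y0 by simp
  then have lq: "Poly_Mapping.lookup q = y" by (simp add: q_def)
  have kq: "Poly_Mapping.keys q = K" by (rule set_eqI) (simp only: in_keys_iff lq y0)
  have "z ` K = (*) g ` (y ` K)" unfolding image_image by (rule image_cong[OF refl]) (rule yz)
  then have "Gcd (z ` K) = Gcd ((*) g ` (y ` K))" by simp
  also have "\<dots> = normalize (g * Gcd (y ` K))" by (rule Gcd_mult)
  finally have "g = \<bar>g\<bar> * Gcd (y ` K)"
    unfolding g_def[symmetric] by (simp add: abs_mult)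
  moreover have "\<bar>g\<bar> = g" by (simp add: g_def)
  ultimately have "Gcd (y ` K) = 1" using g0 by simp
  moreover have "of_int (y k) = (of_int D / of_int g) * Poly_Mapping.lookup p k" for k
  proof -
    have "of_int g * of_int (y k) = of_int D * Poly_Mapping.lookup p k"
      using z[of k] unfolding yz[of k] by simp
    then show ?thesis using g0 by (simp add: field_simps)
  qed
  ultimately show ?thesis
    unfolding primitive_multiple_def
    by (intro exI[of _ q] conjI exI[of _ "of_int D / of_int g"]) (use D g0 in \<open>auto simp: lq kq\<close>)
qed

lemma primitive_multiple_unique:
  assumes "primitive_multiple p q" "primitive_multiple p q'"
  shows "Poly_Mapping.keys q' = Poly_Mapping.keys q"
    and "\<bar>Poly_Mapping.lookup q' k\<bar> = \<bar>Poly_Mapping.lookup q k\<bar>"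
proof -
  obtain c where c: "c \<noteq> 0" "\<And>k. of_int (Poly_Mapping.lookup q k) = c * Poly_Mapping.lookup p k"
    and G: "Gcd (Poly_Mapping.lookup q ` Poly_Mapping.keys q) = 1"
    using assms(1) by (auto simp: primitive_multiple_def)
  obtain c' where c': "c' \<noteq> 0" "\<And>k. of_int (Poly_Mapping.lookup q' k) = c' * Poly_Mapping.lookup p k"
    and G': "Gcd (Poly_Mapping.lookup q' ` Poly_Mapping.keys q') = 1"
    using assms(2) by (auto simp: primitive_multiple_def)
  have kp: "Poly_Mapping.keys q = Poly_Mapping.keys p"
    using c by (metis (no_types, opaque_lifting) in_keys_iff mult_eq_0_iff of_int_eq_0_iff subsetI subset_antisym)
  have kp': "Poly_Mapping.keys q' = Poly_Mapping.keys p"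
    using c' by (metis (no_types, opaque_lifting) in_keys_iff mult_eq_0_iff of_int_eq_0_iff subsetI subset_antisym)
  show kk: "Poly_Mapping.keys q' = Poly_Mapping.keys q" using kp kp' by simp
  define K where "K = Poly_Mapping.keys q"
  obtain a b where ab: "quotient_of (c' / c) = (a, b)" by (cases "quotient_of (c' / c)")
  have b: "b > 0" using ab by (rule quotient_of_denom_pos)
  have cc: "c' / c = of_int a / of_int b" using ab by (rule quotient_of_div)
  have eq: "b * Poly_Mapping.lookup q' k = a * Poly_Mapping.lookup q k" for k
  proof -
    have "(of_int (b * Poly_Mapping.lookup q' k) :: rat) = of_int (a * Poly_Mapping.lookup q k)"
      using c c' cc b by (simp add: field_simps)
    then show ?thesis by (simp only: of_int_eq_iff)
  qed
  have "normalize (b * Gcd (Poly_Mapping.lookup q' ` K)) = Gcd ((*) b ` (Poly_Mapping.lookup q' ` K))"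
    by (rule Gcd_mult[symmetric])
  also have "(*) b ` (Poly_Mapping.lookup q' ` K) = (*) a ` (Poly_Mapping.lookup q ` K)"
    by (simp add: image_image eq)
  also have "Gcd \<dots> = normalize (a * Gcd (Poly_Mapping.lookup q ` K))" by (rule Gcd_mult)
  finally have "\<bar>b\<bar> = \<bar>a\<bar>" using G G' kk by (simp add: K_def)
  then have "\<bar>b\<bar> * \<bar>Poly_Mapping.lookup q' k\<bar> = \<bar>b\<bar> * \<bar>Poly_Mapping.lookup q k\<bar>"
    using eq[of k] by (metis abs_mult)
  then show "\<bar>Poly_Mapping.lookup q' k\<bar> = \<bar>Poly_Mapping.lookup q k\<bar>" using b by simp
qed

lemma coeff_height_eq:
  assumes "primitive_multiple p q"
  shows "coeff_height p = Max ((\<lambda>k. \<bar>Poly_Mapping.lookup q k\<bar>) ` Poly_Mapping.keys q)"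
  unfolding coeff_height_def
proof (rule the_equality, goal_cases)
  case 1
  show ?case using assms by blast
next
  case (2 h)
  then obtain q' where q': "primitive_multiple p q'"
    and h: "h = Max ((\<lambda>k. \<bar>Poly_Mapping.lookup q' k\<bar>) ` Poly_Mapping.keys q')"
    by blast
  show ?case
    unfolding h primitive_multiple_unique(1)[OF assms q'] primitive_multiple_unique(2)[OF assms q'] ..
qed

end

(*
  Fix an irreducible F in Z[x,Z]. If F(t,Z) = g_t(Z) h_t(Z) for all t in a set of integers lying in one
  residue class modulo a prime p, with the factors g_t, h_t congruent modulo p and coprime there, then a
  Bezout identity and the Leibniz rule show by induction that the divided differences of t |-> g_t are
  p-integral. So an interpolation determinant of size M in the functions t^i, t^i c(t), where c(t) is a
  coefficient of g_t, is divisible by p^(M(M-1)/2). For t < b^4 and p between 4 b^2 and b^3 it is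
  smaller than that, hence it vanishes, and every coefficient of g_t satisfies a relation
  p(t) + q(t) c(t) = 0 on the class. Clearing denominators gives a polynomial coprime to F, and the
  resultant with F bounds the number of such t. Summing over the residue classes and the factorisations
  modulo p leaves O((log H + log b)^2 b^3) integers t < b^4 for which F(t,Z) is reducible.

  A Kronecker substitution reduces several variables to this case, and the T-variables are
  specialised one at a time, with b of size (1 + sum of log ||F_i|| + s)^3; the height b^4 then
  is of degree 12 in these parameters.
*)

theory Submission
  imports Defs "HOL-Number_Theory.Prime_Powers" "HOL-Real_Asymp.Real_Asymp"
    "Berlekamp_Zassenhaus.Factor_Bound" "Berlekamp_Zassenhaus.Poly_Mod"
    "Jordan_Normal_Form.Determinant" "Subresultants.Subresultant_Gcd"
begin

text \<open>The factors g_t are chosen for each t separately and need not depend polynomially on t;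
  congruence and coprimality modulo p are what make them p-adically smooth. Both ends of the window
  for p matter: p >= 4 b^2 gives p^2 >= 16 b^4, which beats the powers of t <= b^4 and, through the
  factor 16, the factorial and the size of g_t; p <= b^3 keeps the number of residue classes below
  the b^4 available values. No single prime suits every t, since the leading coefficient and the
  discriminant at t must be units modulo p. A set of O(log H + log b) primes suffices, because its
  product exceeds these numbers; the determinant size is of the same order, and together they give
  the squared logarithm. The Kronecker image of an irreducible polynomial may be reducible. So the
  count is applied to each irreducible factor of the image, and a factorisation found after the
  substitution is lifted back by comparing supports. A substitution multiplies the coefficient bound
  by (d + 1) b^(4 d), which adds only O(1 + log b) to its logarithm.\<close>

hide_const (open) Module.smult up_ring.coeff up_ring.monom

section \<open>Primes between \<open>4b\<^sup>2\<close> and \<open>b\<^sup>3\<close>\<close>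

text \<open>Chebyshev's form of Legendre's formula: \<open>ln n\<close> is the sum of
  \<open>mangoldt\<close> over the divisors of n, and d has \<open>N div d\<close> multiples up to
  N. The larger range M adds only zero terms; it lets the logarithms of \<open>fact n\<close> and
  \<open>fact (2*n)\<close> be summed over the same d.\<close>

lemma ln_fact_eq_sum_mangoldt:
  assumes "N \<le> M"
  shows "ln (fact N) = (\<Sum>d=1..M. mangoldt d * real (N div d))"
proof -
  have "ln (fact N :: real) = (\<Sum>n=1..N. ln (real n))"
    by (induction N) (auto simp: ln_mult)
  also have "\<dots> = (\<Sum>n=1..N. \<Sum>d | d dvd n. mangoldt d)"
    by (intro sum.cong refl) (simp add: mangoldt_sum)
  also have "\<dots> = (\<Sum>n=1..N. \<Sum>d=1..M. if d dvd n then mangoldt d else 0)"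
  proof (rule sum.cong[OF refl])
    fix n assume n: "n \<in> {1..N}"
    have "d \<le> M" if "d dvd n" for d
      using dvd_imp_le[OF that] n assms by auto
    then have "{d. d dvd n} = {d\<in>{1..M}. d dvd n}"
      using n by (auto intro!: Nat.gr0I simp: Suc_le_eq)
    show "(\<Sum>d | d dvd n. mangoldt d) = (\<Sum>d=1..M. if d dvd n then mangoldt d else (0::real))"
      unfolding \<open>{d. d dvd n} = _\<close> by (rule sum.inter_filter) simp
  qed
  also have "\<dots> = (\<Sum>d=1..M. \<Sum>n=1..N. if d dvd n then mangoldt d else 0)"
    by (rule sum.swap)
  also have "\<dots> = (\<Sum>d=1..M. mangoldt d * real (N div d))"
  proof (intro sum.cong refl)
    fix d assume d: "d \<in> {1..M}"
    have "{n\<in>{1..N}. d dvd n} = (\<lambda>k. d * k) ` {1..N div d}"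
    proof (intro equalityI subsetI)
      fix x assume "x \<in> {n \<in> {1..N}. d dvd n}"
      then obtain k where k: "x = d * k" "x \<ge> 1" "x \<le> N" by (auto elim: dvdE)
      then have "k \<ge> 1" by (cases k) auto
      moreover have "k \<le> N div d" using k d by (simp add: less_eq_div_iff_mult_less_eq mult.commute)
      ultimately show "x \<in> (\<lambda>k. d * k) ` {1..N div d}" using k by auto
    next
      fix x assume "x \<in> (\<lambda>k. d * k) ` {1..N div d}"
      then obtain k where "k \<in> {1..N div d}" "x = d * k" by blast
      then show "x \<in> {n \<in> {1..N}. d dvd n}"
        using d by (auto simp: less_eq_div_iff_mult_less_eq mult.commute)
    qed
    moreover have "inj_on (\<lambda>k. d * k) {1..N div d}" using d by (auto intro: inj_onI)
    ultimately have "card {n\<in>{1..N}. d dvd n} = N div d" by (simp add: card_image)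
    then show "(\<Sum>n=1..N. if d dvd n then mangoldt d else (0::real)) = mangoldt d * real (N div d)"
      by (simp add: sum.inter_filter[symmetric] mult.commute)
  qed
  finally show ?thesis .
qed

text \<open>In \<open>ln (fact (2*n)) - 2 * ln (fact n)\<close> the weight of
  \<open>mangoldt d\<close> is \<open>(2*n) div d - 2 * (n div d)\<close>, which is at most
  1.\<close>

lemma ln_central_binomial_le:
  assumes "n > 0"
  shows "ln (real ((2*n) choose n)) \<le> (\<Sum>d=1..2*n. mangoldt d)"
proof -
  have "real ((2*n) choose n) = fact (2*n) / (fact n * fact n)"
    by (subst binomial_fact) auto
  then have "ln (real ((2*n) choose n)) = ln (fact (2*n)) - 2 * ln (fact n)"
    by (simp add: ln_div ln_mult)
  also have "\<dots> = (\<Sum>d=1..2*n. mangoldt d * (real ((2*n) div d) - 2 * real (n div d)))"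
    by (subst ln_fact_eq_sum_mangoldt[of "2*n" "2*n"], simp, subst ln_fact_eq_sum_mangoldt[of n "2*n"], simp)
       (simp add: sum_subtractf[symmetric] sum_distrib_left algebra_simps)
  also have "\<dots> \<le> (\<Sum>d=1..2*n. mangoldt d * 1)"
  proof (intro sum_mono mult_left_mono mangoldt_nonneg)
    fix d assume d: "d \<in> {1..2*n}"
    have "2 * n < d * (2 * (n div d) + 2)"
    proof -
      have "n < d * (n div d + 1)" using d
        by (metis One_nat_def Suc_eq_plus1 Suc_le_eq atLeastAtMost_iff dividend_less_times_div mult_Suc_right add.commute)
      then show ?thesis by (simp add: algebra_simps)
    qed
    then have "(2*n) div d < 2 * (n div d) + 2" using d
      by (simp add: less_mult_imp_div_less mult.commute)
    then show "real ((2*n) div d) - 2 * real (n div d) \<le> 1" by linarith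
  qed
  finally show ?thesis by simp
qed

text \<open>A prime p has at most \<open>ln N / ln p\<close> powers up to N, and each contributes
  \<open>ln p\<close>, so every prime accounts for at most \<open>ln N\<close>.\<close>

lemma sum_mangoldt_le:
  assumes "N \<ge> 1"
  shows "(\<Sum>d=1..N. mangoldt d) \<le> real (card {p. prime p \<and> p \<le> N}) * ln (real N)"
proof -
  define P where "P = {p::nat. prime p \<and> p \<le> N}"
  have fP: "finite P" unfolding P_def by auto
  define J where "J p = {j::nat. 1 \<le> j \<and> p ^ j \<le> N}" for p
  have J: "real (card (J p)) * ln (real p) \<le> ln (real N)" "finite (J p)" if "p \<in> P" for p
  proof -
    have p: "p \<ge> 2" using that by (auto simp: P_def prime_ge_2_nat)
    define K where "K = nat \<lfloor>ln (real N) / ln (real p)\<rfloor>"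
    have sub: "J p \<subseteq> {1..K}"
    proof
      fix j assume j: "j \<in> J p"
      then have "real (p ^ j) \<le> real N" unfolding J_def of_nat_le_iff by simp
      then have "ln (real (p ^ j)) \<le> ln (real N)" using p assms by (subst ln_le_cancel_iff) auto
      then have "real j * ln (real p) \<le> ln (real N)" using p by (simp add: ln_realpow)
      then have "real j \<le> ln (real N) / ln (real p)" using p by (simp add: field_simps)
      then have "j \<le> K" unfolding K_def by linarith
      then show "j \<in> {1..K}" using j by (auto simp: J_def)
    qed
    then have "card (J p) \<le> K" using card_mono[OF _ sub] by simp
    moreover have "real K \<le> ln (real N) / ln (real p)" unfolding K_def using assms p by simp
    ultimately have "real (card (J p)) \<le> ln (real N) / ln (real p)" by linarith
    then show "real (card (J p)) * ln (real p) \<le> ln (real N)" using p by (simp add: field_simps)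
    show "finite (J p)" using sub finite_subset by blast
  qed
  have "(\<Sum>d=1..N. mangoldt d) = (\<Sum>d\<in>{d\<in>{1..N}. primepow d}. mangoldt d :: real)"
    by (rule sum.mono_neutral_right) (auto simp: mangoldt_def)
  also have "\<dots> \<le> (\<Sum>d\<in>(\<lambda>(p,j). p ^ j) ` Sigma P J. mangoldt d)"
  proof (rule sum_mono2)
    show "finite ((\<lambda>(p,j). p ^ j) ` Sigma P J)" using fP J by auto
    show "{d \<in> {1..N}. primepow d} \<subseteq> (\<lambda>(p, j). p ^ j) ` Sigma P J"
    proof
      fix d assume d: "d \<in> {d \<in> {1..N}. primepow d}"
      then obtain p k where k: "k > 0" "prime p" "d = p ^ k" by (auto simp: primepow_def)
      have "p \<le> p ^ k" using prime_ge_1_nat[OF k(2)] k by (intro self_le_power) auto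
      then show "d \<in> (\<lambda>(p, j). p ^ j) ` Sigma P J"
        using d k by (intro image_eqI[of _ _ "(p, k)"]) (auto simp: P_def J_def)
    qed
  qed (simp add: mangoldt_nonneg)
  also have "\<dots> \<le> sum (mangoldt \<circ> (\<lambda>(p,j). p ^ j)) (Sigma P J)"
    using fP J by (intro sum_image_le) (auto simp: mangoldt_nonneg)
  also have "\<dots> = (\<Sum>(p,j)\<in>Sigma P J. ln (real p))"
    by (intro sum.cong refl) (auto simp: P_def J_def)
  also have "\<dots> = (\<Sum>p\<in>P. \<Sum>j\<in>J p. ln (real p))"
    using fP J by (intro sum.Sigma[symmetric]) auto
  also have "\<dots> \<le> (\<Sum>p\<in>P. ln (real N))"
    using J by (intro sum_mono) simp
  finally show ?thesis by (simp add: P_def)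
qed

lemma card_primes_lower_bound:
  assumes "n \<ge> 1"
  shows "real n * ln 4 - ln (2 * real n) \<le> real (card {p. prime p \<and> p \<le> 2*n}) * ln (2 * real n)"
proof -
  have "real n * ln 4 - ln (2 * real n) = ln (4^n / (2 * real n))"
    using assms by (simp add: ln_div ln_realpow)
  also have "\<dots> \<le> ln (real ((2*n) choose n))"
    using central_binomial_lower_bound[of n] assms by (subst ln_le_cancel_iff) auto
  also have "\<dots> \<le> (\<Sum>d=1..2*n. mangoldt d)" using ln_central_binomial_le assms by simp
  also have "\<dots> \<le> real (card {p. prime p \<and> p \<le> 2*n}) * ln (real (2*n))"
    using sum_mangoldt_le[of "2*n"] assms by simp
  finally show ?thesis by simp
qed

text \<open>Chebyshev's bound yields on the order of \<open>b ^ 3 / ln b\<close> primes up to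
  \<open>b ^ 3\<close>, and fewer than \<open>4 * b\<^sup>2\<close> of them lie below the window.
  The \<open>b\<^sup>2\<close> primes guaranteed here exceed the logarithmic number needed later
  unless b is small.\<close>

lemma eventually_many_primes:
  "\<forall>\<^sub>F b in at_top. b\<^sup>2 \<le> card {p::nat. prime p \<and> 4 * b\<^sup>2 \<le> p \<and> p \<le> b ^ 3}"
proof -
  \<comment> \<open>Of the factor 5, four parts pay for the numbers below
    \<open>4 * b\<^sup>2\<close> and one for the primes to be found.\<close>
  have "\<forall>\<^sub>F b::nat in at_top. 5 * (real b)^2 * ln (real b ^ 3) + ln (real b ^ 3) < (real b ^ 3 / 2 - 1) * ln 4"
    by real_asymp
  then show ?thesis
    using eventually_ge_at_top[of 3]
  proof eventually_elim
    case (elim b)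
    define n where "n = b ^ 3 div 2"
    define Q where "Q = {p::nat. prime p \<and> 4 * b\<^sup>2 \<le> p \<and> p \<le> b ^ 3}"
    have b27: "b ^ 3 \<ge> 3 ^ 3" using elim(2) by (intro power_mono) auto
    then have n1: "n \<ge> 1" by (simp add: n_def)
    have "b ^ 3 \<le> 2 * n + 1" by (simp add: n_def)
    then have "real (b ^ 3) \<le> real (2 * n + 1)" unfolding of_nat_le_iff .
    then have n2: "2 * n \<le> b ^ 3" "real n \<ge> real b ^ 3 / 2 - 1"
      by (simp_all add: n_def)
    have fin: "finite Q" by (auto simp: Q_def)
    have sub: "{p. prime p \<and> p \<le> 2*n} \<subseteq> {1..<4 * b\<^sup>2} \<union> Q"
      using n2(1) by (auto simp: Q_def prime_ge_1_nat Suc_le_eq prime_gt_0_nat)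
    have "card {p. prime p \<and> p \<le> 2*n} \<le> card ({1..<4 * b\<^sup>2} \<union> Q)"
      using fin by (intro card_mono sub) auto
    also have "\<dots> \<le> 4 * b\<^sup>2 + card Q" using card_Un_le[of "{1..<4 * b\<^sup>2}" Q] by simp
    finally have "real (card {p. prime p \<and> p \<le> 2*n}) \<le> real (4 * b\<^sup>2 + card Q)"
      by (rule of_nat_mono)
    then have c: "real (card {p. prime p \<and> p \<le> 2*n}) \<le> 4 * (real b)\<^sup>2 + real (card Q)"
      by simp
    have l: "ln (2 * real n) \<le> ln (real b ^ 3)" "ln (real b ^ 3) > 0"
    proof -
      have "real (2 * n) \<le> real (b ^ 3)" using n2(1) unfolding of_nat_le_iff .
      then show "ln (2 * real n) \<le> ln (real b ^ 3)" using n1 elim(2) by (subst ln_le_cancel_iff) auto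
      have "1 < real b ^ 3" using elim(2) by (intro one_less_power) auto
      then show "ln (real b ^ 3) > 0" by (rule ln_gt_zero)
    qed
    have "(real b ^ 3 / 2 - 1) * ln 4 - ln (real b ^ 3) \<le> real n * ln 4 - ln (2 * real n)"
      using n2(2) l by (intro diff_mono mult_right_mono) auto
    also have "\<dots> \<le> real (card {p. prime p \<and> p \<le> 2*n}) * ln (2 * real n)"
      by (rule card_primes_lower_bound[OF n1])
    also have "\<dots> \<le> (4 * (real b)\<^sup>2 + real (card Q)) * ln (real b ^ 3)"
      using c l n1 by (intro mult_mono) auto
    finally have "5 * (real b)\<^sup>2 * ln (real b ^ 3) < (4 * (real b)\<^sup>2 + real (card Q)) * ln (real b ^ 3)"
      using elim(1) by linarith
    then have "5 * (real b)\<^sup>2 < 4 * (real b)\<^sup>2 + real (card Q)" using l by simp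
    then have "real (b\<^sup>2) < real (card Q)" by simp
    then have "b\<^sup>2 < card Q" unfolding of_nat_less_iff .
    then show ?case by (simp add: Q_def)
  qed
qed

section \<open>Monic divisors modulo a prime\<close>

context poly_mod_prime
begin

lemma Mp_uminus_diff_eq_0_iff: "Mp (f - g) = 0 \<longleftrightarrow> Mp f = Mp g"
proof
  assume "Mp (f - g) = 0"
  then have "Mp ((f - g) + g) = Mp (0 + g)" by (metis plus_Mp(1))
  then show "Mp f = Mp g" by simp
next
  assume "Mp f = Mp g"
  then have "Mp (f - g) = Mp (g - g)" by (metis minus_Mp(1))
  then show "Mp (f - g) = 0" by simp
qed

lemma Mp_eq_0_iff: "Mp f = 0 \<longleftrightarrow> (\<exists>g. f = smult p g)"
proof
  assume "Mp f = 0"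
  then show "\<exists>g. f = smult p g" using Dp_Mp_eq[of f] by auto
qed auto

lemma inverse_mod_exists:
  assumes "\<not> p dvd a" shows "\<exists>b. M (b * a) = 1"
proof -
  have "algebraic_semidom_class.coprime p a" using prime_imp_coprime[OF prime assms] .
  then have "gcd a p = 1" by (simp add: gcd.commute coprime_iff_gcd_eq_1)
  then obtain u v where "u * a + v * p = 1" using bezout_int[of a p] by auto
  then have "(u * a) mod p = 1 mod p" by (metis mod_mult_self2 mult.commute)
  then have "M (u * a) = 1" using m1 by (simp add: M_def)
  then show ?thesis by blast
qed

lemma monic_associate:
  assumes "Mp f \<noteq> 0"
  obtains c g where "monic g" "Mp g = Mp (smult c f)" "degree g \<le> degree f" "\<not> p dvd c"
proof -
  define k where "k = degree (Mp f)"
  have "lead_coeff (Mp f) \<noteq> 0" using assms by simp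
  then have "\<not> p dvd coeff f k"
    by (metis Mp_coeff M_def dvd_imp_mod_0 k_def)
  then obtain c where c: "M (c * coeff f k) = 1" using inverse_mod_exists by blast
  define g where "g = Mp (smult c f)"
  have g1: "coeff g k = 1" using c by (simp add: g_def Mp_coeff)
  have "coeff g i = 0" if "i > k" for i
  proof -
    have "coeff (Mp f) i = 0" using that k_def by (simp add: coeff_eq_0)
    then have "p dvd coeff f i" by (simp add: Mp_coeff M_def dvd_eq_mod_eq_0)
    then show ?thesis by (simp add: g_def Mp_coeff M_def)
  qed
  then have "degree g = k" using g1 by (intro antisym degree_le le_degree) auto
  moreover have "\<not> p dvd c" using c by (auto simp: M_def dvd_def)
  moreover have "k \<le> degree f" unfolding k_def by (rule degree_m_le)
  ultimately show ?thesis using that[of g c] g1 by (simp add: g_def)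
qed

lemma monic_division:
  fixes d f :: "int poly"
  assumes "monic d" "degree d > 0"
  obtains q r where "f = d * q + r" "degree r < degree d"
proof -
  obtain q r where qr: "pseudo_divmod f d = (q, r)" by (cases "pseudo_divmod f d")
  have d: "d \<noteq> 0" using assms by auto
  have "f = d * q + r" "r = 0 \<or> degree r < degree d"
    using pseudo_divmod[OF d qr] assms by auto
  then show ?thesis using that[of q r] assms(2) by (cases "r = 0") auto
qed

lemma Mp_cancel_monic:
  assumes "monic q" "Mp (q * a) = Mp (q * b)"
  shows "Mp a = Mp b"
proof (rule ccontr)
  assume "Mp a \<noteq> Mp b"
  then have "Mp (a - b) \<noteq> 0" by (simp add: Mp_uminus_diff_eq_0_iff)
  then have l: "lead_coeff (Mp (a - b)) mod p \<noteq> 0"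
    by (metis Mp_Mp Mp_coeff leading_coeff_neq_0 M_def)
  have "Mp (q * (a - b)) = 0" using assms(2) by (simp add: algebra_simps Mp_uminus_diff_eq_0_iff)
  then have "Mp (q * Mp (a - b)) = 0" by simp
  moreover have "lead_coeff (q * Mp (a - b)) mod p \<noteq> 0"
    using l assms(1) by (simp add: lead_coeff_monic_mult)
  ultimately show False
    by (metis Mp_coeff M_def coeff_0)
qed

text \<open>The minimality assumption makes q irreducible modulo p. A monic d of least degree in the
  ideal generated by q and g divides both; it is 1, or it is associated to q.\<close>

lemma dvdm_or_coprime:
  assumes q: "monic q" "degree q > 0"
    and q_min: "\<And>d. monic d \<Longrightarrow> d dvdm q \<Longrightarrow> degree d > 0 \<Longrightarrow> degree q \<le> degree d"
  shows "q dvdm g \<or> (\<exists>u v. Mp (u * q + v * g) = 1)"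
proof -
  define I where "I d \<longleftrightarrow> monic d \<and> (\<exists>u v. Mp d = Mp (u * q + v * g))" for d
  have "I q" unfolding I_def using q by (intro conjI exI[of _ 1] exI[of _ 0]) auto
  define d where "d = (ARG_MIN degree d. I d)"
  have d: "I d" "\<And>d'. I d' \<Longrightarrow> degree d \<le> degree d'"
    unfolding d_def using arg_min_nat_lemma[of I q degree] \<open>I q\<close> by auto
  obtain u v where uv: "Mp d = Mp (u * q + v * g)" using d(1) by (auto simp: I_def)
  have monic: "monic d" using d(1) by (simp add: I_def)
  show ?thesis
  proof (cases "degree d = 0")
    case True
    then have "d = 1" using monic by (metis degree_0_id lead_coeff_pCons(1) one_pCons degree_pCons_eq_if le_zero_eq monic_degree_0)
    then have "Mp (u * q + v * g) = 1" using uv by simp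
    then show ?thesis by blast
  next
    case False
    \<comment> \<open>Division by d leaves a remainder in the ideal; were it nonzero modulo p, its
      monic associate would contradict the choice of d.\<close>
    have dvd: "d dvdm f" if f: "\<exists>a b. f = a * q + b * g" for f
    proof -
      obtain a b where ab: "f = a * q + b * g" using f by blast
      obtain w r where wr: "f = d * w + r" "degree r < degree d"
        using monic_division[OF monic] False by blast
      have "Mp r = Mp (f - d * w)" using wr(1) by simp
      also have "\<dots> = Mp (f - Mp d * w)" by (metis minus_Mp(2) mult_Mp(1))
      also have "\<dots> = Mp (f - (u * q + v * g) * w)" unfolding uv by (metis minus_Mp(2) mult_Mp(1))
      also have "f - (u * q + v * g) * w = (a - u * w) * q + (b - v * w) * g"
        using ab by (simp add: algebra_simps)
      finally have r: "Mp r = Mp ((a - u * w) * q + (b - v * w) * g)" .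
      have "Mp r = 0"
      proof (rule ccontr)
        assume "Mp r \<noteq> 0"
        then obtain c e where e: "monic e" "Mp e = Mp (smult c r)" "degree e \<le> degree r"
          using monic_associate by metis
        have "Mp (smult c r) = Mp (smult c ((a - u * w) * q + (b - v * w) * g))"
          using r by (metis Mp_smult(2))
        also have "smult c ((a - u * w) * q + (b - v * w) * g) =
            smult c (a - u * w) * q + smult c (b - v * w) * g" by (simp add: smult_add_right)
        finally have "I e" unfolding I_def using e(1,2) by metis
        then show False using d(2)[of e] e(3) wr(2) by simp
      qed
      then have "Mp f = Mp (d * w)" using wr(1) by (metis add.right_neutral plus_Mp(2))
      then show ?thesis unfolding dvdm_def by blast
    qed
    have dq: "d dvdm q" by (rule dvd) (rule exI[of _ 1], rule exI[of _ 0], simp)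
    have dg: "d dvdm g" by (rule dvd) (rule exI[of _ 0], rule exI[of _ 1], simp)
    \<comment> \<open>Minimality of q forces the cofactor of d in q to be a constant, so q and d
      differ by a unit modulo p and q divides g as well.\<close>
    have deg: "degree q \<le> degree d" using q_min[OF monic dq] False by simp
    from dq obtain w where w: "Mp q = Mp (d * Mp w)" unfolding dvdm_def by auto
    have w0: "Mp w \<noteq> 0"
    proof
      assume "Mp w = 0"
      then have "Mp q = 0" using w by simp
      then have "M (lead_coeff q) = 0" by (metis Mp_coeff coeff_0)
      then show False using q m1 by (simp add: M_def)
    qed
    have "lead_coeff (Mp w) mod p \<noteq> 0" using w0
      by (metis Mp_Mp Mp_coeff leading_coeff_neq_0 M_def)
    then have "degree (Mp q) = degree d + degree (Mp w)"
      unfolding w using monic m1 by (intro poly_mod.degree_m_mult_eq) auto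
    then have "degree (Mp w) = 0" using deg degree_m_le[of q] by simp
    then obtain c where c: "Mp w = [:c:]" using degree_eq_zeroE by blast
    have "M c \<noteq> 0" using w0 c by (metis M_M Mp_coeff Mp_Mp coeff_pCons_0 pCons_0_0)
    then have "\<not> p dvd c" by (auto simp: M_def)
    then obtain b where b: "M (b * c) = 1" using inverse_mod_exists by blast
    have "Mp (smult b q) = Mp (smult b (d * [:c:]))" using w c by (metis Mp_smult(2))
    also have "smult b (d * [:c:]) = smult (b * c) d" by simp
    also have "Mp \<dots> = Mp (smult (M (b * c)) d)" by simp
    also have "\<dots> = Mp d" using b by simp
    finally have qd: "Mp (q * [:b:]) = Mp d" by simp
    from dg obtain h where h: "Mp g = Mp (d * h)" unfolding dvdm_def by auto
    also have "\<dots> = Mp (q * [:b:] * h)" using qd by (metis mult_Mp(1))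
    finally have "q dvdm g" unfolding dvdm_def by (metis mult.assoc)
    then show ?thesis by blast
  qed
qed

text \<open>Let q be a monic divisor of least positive degree and f = q w modulo p. A monic divisor
  of f is either coprime to q, and then divides w, or it is q times a monic divisor of w. So the
  number at most doubles while the degree drops.\<close>

lemma card_monic_divisors:
  assumes "\<not> p dvd lead_coeff f"
  shows "finite {g. monic g \<and> Mp g = g \<and> g dvdm f} \<and> card {g. monic g \<and> Mp g = g \<and> g dvdm f} \<le> 2 ^ degree f"
  using assms
proof (induction "degree f" arbitrary: f rule: less_induct)
  case less
  define Dv where "Dv f = {g. monic g \<and> Mp g = g \<and> g dvdm f}" for f
  have Mpf: "Mp f \<noteq> 0" using less.prems by (metis M_def Mp_coeff coeff_0 dvd_eq_mod_eq_0)
  show ?case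
  proof (cases "\<exists>q. monic q \<and> q dvdm f \<and> degree q > 0")
    case False
    have "Dv f \<subseteq> {1}"
    proof
      fix g assume g: "g \<in> Dv f"
      then have "degree g = 0" using False by (auto simp: Dv_def)
      then show "g \<in> {1}" using g monic_degree_0[of g] by (auto simp: Dv_def)
    qed
    then have "finite (Dv f)" "card (Dv f) \<le> 1" using finite_subset card_mono[of "{1}" "Dv f"] by auto
    moreover have "(1::nat) \<le> 2 ^ degree f" by simp
    ultimately show ?thesis unfolding Dv_def by linarith
  next
    case True
    then obtain q0 where q0: "monic q0 \<and> q0 dvdm f \<and> degree q0 > 0" by blast
    define q where "q = (ARG_MIN degree q. monic q \<and> q dvdm f \<and> degree q > 0)"
    have q: "monic q" "q dvdm f" "degree q > 0"
      and min: "\<And>q'. monic q' \<Longrightarrow> q' dvdm f \<Longrightarrow> degree q' > 0 \<Longrightarrow> degree q \<le> degree q'"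
      unfolding q_def using arg_min_nat_lemma[of "\<lambda>q. monic q \<and> q dvdm f \<and> degree q > 0" q0 degree] q0 by auto
    obtain w where w: "Mp f = Mp (q * w)" "Mp w = w" using q(2) by (metis dvdmE)
    have w0: "w \<noteq> 0" using w Mpf by auto
    then have lw: "lead_coeff w mod p \<noteq> 0" using w(2) by (metis Mp_coeff leading_coeff_neq_0 M_def)
    then have ndw: "\<not> p dvd lead_coeff w" by (simp add: dvd_eq_mod_eq_0)
    have "degree (Mp f) = degree q + degree w" unfolding w(1) using q lw m1 by (intro poly_mod.degree_m_mult_eq) auto
    then have degw: "degree w < degree f" "degree w + 1 \<le> degree f" using q(3) degree_m_le[of f] by auto
    have trans: "d dvdm f" if "d dvdm q" for d
      using that w(1) q(2) unfolding dvdm_def by (metis mult.assoc mult_Mp(1))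
    have IH: "finite (Dv w)" "card (Dv w) \<le> 2 ^ degree w" using less.hyps[OF degw(1) ndw] by (auto simp: Dv_def)
    have "Dv f \<subseteq> Dv w \<union> (\<lambda>g. Mp (q * g)) ` Dv w"
    proof
      fix g assume "g \<in> Dv f"
      then have g: "monic g" "Mp g = g" "g dvdm f" by (auto simp: Dv_def)
      obtain h where h: "Mp f = Mp (g * h)" using g(3) unfolding dvdm_def by auto
      consider "q dvdm g" | u v where "Mp (u * q + v * g) = 1"
        using dvdm_or_coprime[OF q(1,3), of g] min trans by metis
      then show "g \<in> Dv w \<union> (\<lambda>g. Mp (q * g)) ` Dv w"
      proof cases
        case 1
        then obtain g' where g': "Mp g = Mp (q * g')" "Mp g' = g'" by (metis dvdmE)
        have "g' \<noteq> 0" using g' g m1 by auto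
        then have lg': "lead_coeff g' mod p \<noteq> 0" using g'(2) by (metis Mp_coeff leading_coeff_neq_0 M_def)
        have "degree (Mp g) = degree q + degree g'" unfolding g'(1) using q lg' m1 by (intro poly_mod.degree_m_mult_eq) auto
        moreover have "q \<noteq> 0" using q by auto
        ultimately have "degree (q * g') = degree g"
          using g(2) \<open>g' \<noteq> 0\<close> by (simp add: degree_mult_eq)
        then have "coeff g (degree (q * g')) = 1" using g(1) by simp
        then have "M (coeff (q * g') (degree (q * g'))) = 1" using g' g(2) by (metis Mp_coeff)
        then have "M (lead_coeff g') = 1" using q(1) by (simp add: lead_coeff_monic_mult)
        then have mg': "monic g'" using g'(2) by (metis Mp_coeff)
        have "Mp (q * w) = Mp (Mp g * h)" using w(1) h by simp
        also have "\<dots> = Mp (q * (g' * h))" unfolding g'(1) by (simp add: mult.assoc)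
        finally have "Mp w = Mp (g' * h)" using Mp_cancel_monic[OF q(1)] by blast
        then have "g' \<in> Dv w" using mg' g'(2) by (auto simp: Dv_def dvdm_def)
        then show ?thesis using g g'(1) by auto
      next
        case 2
        have "Mp w = Mp (1 * w)" by simp
        also have "\<dots> = Mp ((u * q + v * g) * w)" using 2 by (metis mult_Mp(1))
        also have "(u * q + v * g) * w = u * (q * w) + g * (v * w)" by (simp add: algebra_simps)
        also have "Mp \<dots> = Mp (u * Mp (q * w) + g * (v * w))" by (metis mult_Mp(2) plus_Mp(1))
        also have "\<dots> = Mp (u * Mp (g * h) + g * (v * w))" using w h by simp
        also have "\<dots> = Mp (u * (g * h) + g * (v * w))" by (metis mult_Mp(2) plus_Mp(1))
        also have "u * (g * h) + g * (v * w) = g * (u * h + v * w)" by (simp add: algebra_simps)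
        finally have "g dvdm w" unfolding dvdm_def by blast
        then show ?thesis using g by (auto simp: Dv_def)
      qed
    qed
    then have sub: "finite (Dv f)" "card (Dv f) \<le> card (Dv w \<union> (\<lambda>g. Mp (q * g)) ` Dv w)"
      using IH(1) by (auto intro: finite_subset card_mono)
    have "card (Dv w \<union> (\<lambda>g. Mp (q * g)) ` Dv w) \<le> card (Dv w) + card (Dv w)"
      using card_Un_le[of "Dv w" "(\<lambda>g. Mp (q * g)) ` Dv w"] card_image_le[OF IH(1), of "\<lambda>g. Mp (q * g)"] by linarith
    also have "\<dots> \<le> 2 ^ (degree w + 1)" using IH(2) by simp
    also have "\<dots> \<le> 2 ^ degree f" using degw(2) by (intro power_increasing) auto
    finally show ?thesis using sub unfolding Dv_def by linarith
  qed
qed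

end

section \<open>Divided differences of factors\<close>

text \<open>Polynomials over the integers localized at p, with one common denominator for all
  coefficients.\<close>

definition pint :: "int \<Rightarrow> rat poly \<Rightarrow> bool" where
  "pint p f \<longleftrightarrow> (\<exists>b g. \<not> p dvd b \<and> smult (of_int b) f = of_int_poly g)"

lemma pint_of_int_poly: "prime p \<Longrightarrow> pint p (of_int_poly g)"
  unfolding pint_def by (intro exI[of _ 1] exI[of _ g]) (auto simp: not_prime_unit)

lemma of_int_poly_const: "of_int_poly [:a:] = ([:of_int a:] :: 'a :: comm_ring_1 poly)"
  by (rule poly_eqI) (auto simp: coeff_map_poly coeff_pCons split: nat.split)

lemma pint_0: "prime p \<Longrightarrow> pint p 0"
  using pint_of_int_poly[of p 0] by simp

lemma pint_add:
  assumes p: "prime p" and "pint p f" "pint p g" shows "pint p (f + g)"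
proof -
  from assms obtain a f' b g' where *: "\<not> p dvd a" "smult (of_int a) f = of_int_poly f'"
    "\<not> p dvd b" "smult (of_int b) g = of_int_poly g'" by (auto simp: pint_def)
  have "smult (of_int (a * b)) (f + g) = smult (of_int b) (smult (of_int a) f) + smult (of_int a) (smult (of_int b) g)"
    by (simp add: smult_add_right mult.commute)
  also have "\<dots> = of_int_poly (smult b f' + smult a g')" unfolding * by (simp add: hom_distribs)
  finally show ?thesis using * p unfolding pint_def by (metis prime_dvd_mult_iff)
qed

lemma pint_mult:
  assumes p: "prime p" and "pint p f" "pint p g" shows "pint p (f * g)"
proof -
  from assms obtain a f' b g' where *: "\<not> p dvd a" "smult (of_int a) f = of_int_poly f'"
    "\<not> p dvd b" "smult (of_int b) g = of_int_poly g'" by (auto simp: pint_def)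
  have "smult (of_int (a * b)) (f * g) = smult (of_int a) f * smult (of_int b) g"
    by (simp add: mult.commute)
  also have "\<dots> = of_int_poly (f' * g')" unfolding * by (simp add: hom_distribs)
  finally show ?thesis using * p unfolding pint_def by (metis prime_dvd_mult_iff)
qed

lemma pint_smult:
  assumes "prime p" "pint p f" shows "pint p (smult (of_int a) f)"
proof -
  from assms obtain b g where bg: "\<not> p dvd b" "smult (of_int b) f = of_int_poly g" by (auto simp: pint_def)
  have "smult (of_int b) (smult (of_int a) f) = smult (of_int a) (smult (of_int b) f)"
    by (simp add: mult.commute)
  also have "\<dots> = of_int_poly (smult a g)" unfolding bg by (simp add: hom_distribs)
  finally show ?thesis using bg(1) unfolding pint_def by blast
qed

lemma pint_diff: "prime p \<Longrightarrow> pint p f \<Longrightarrow> pint p g \<Longrightarrow> pint p (f - g)"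
  using pint_add[of p f "smult (of_int (-1)) g"] pint_smult[of p g "-1"] by simp

lemma pint_sum: "prime p \<Longrightarrow> (\<And>i. i \<in> I \<Longrightarrow> pint p (f i)) \<Longrightarrow> pint p (sum f I)"
  by (induction I rule: infinite_finite_induct) (auto simp: pint_0 intro: pint_add)

lemma pint_smult_cancel:
  assumes "prime p" "\<not> p dvd a" "pint p (smult (of_int a) f)" shows "pint p f"
proof -
  from assms obtain b g where "\<not> p dvd b" "smult (of_int b) (smult (of_int a) f) = of_int_poly g"
    by (auto simp: pint_def)
  then have "\<not> p dvd b * a" "smult (of_int (b * a)) f = of_int_poly g"
    using assms by (auto simp: prime_dvd_mult_iff)
  then show ?thesis unfolding pint_def by blast
qed

text \<open>Starting point of the descent in \<open>pint_bezout\<close>: a common denominator is a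
  power of p times a number prime to p.\<close>

lemma pint_power_multiple:
  assumes "prime p" obtains N where "pint p (smult (of_int (p ^ N)) f)"
proof -
  have *: "\<exists>a g. a \<noteq> 0 \<and> smult (of_int a) f = of_int_poly g"
  proof (induction f)
    case 0
    show ?case by (rule exI[of _ 1], rule exI[of _ 0]) simp
  next
    case (pCons c f)
    then obtain a g where ag: "a \<noteq> 0" "smult (of_int a) f = of_int_poly g" by blast
    obtain u v where uv: "quotient_of c = (u, v)" by force
    have v: "v > 0" "c = of_int u / of_int v" using uv quotient_of_denom_pos quotient_of_div by auto
    have "smult (of_int (a * v)) (pCons c f) = pCons (of_int (a * u)) (smult (of_int v) (smult (of_int a) f))"
      using v by (simp add: mult.commute)
    also have "\<dots> = of_int_poly (pCons (a * u) (smult v g))" unfolding ag by (simp add: hom_distribs)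
    finally show ?case using ag v by (intro exI[of _ "a * v"]) auto
  qed
  then obtain a g where ag: "a \<noteq> 0" "smult (of_int a) f = of_int_poly g" by blast
  have "\<not> is_unit p" using assms not_prime_unit by metis
  then obtain a' where a': "a = p ^ multiplicity p a * a'" "\<not> p dvd a'"
    using multiplicity_decompose'[of a p] ag(1) by blast
  have "smult (of_int a') (smult (of_int (p ^ multiplicity p a)) f) = of_int_poly g"
    using ag(2) a'(1) by (metis mult.commute of_int_mult smult_smult)
  then have "pint p (smult (of_int (p ^ multiplicity p a)) f)" using a'(2) unfolding pint_def by blast
  then show ?thesis by (rule that)
qed

text \<open>The leading coefficient is invertible at p, so the powers of it that pseudo-division
  brings in are harmless denominators.\<close>

lemma pint_division:
  assumes p: "prime p" and w: "pint p w" and g: "\<not> p dvd lead_coeff g"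
  obtains q r where "pint p q" "pint p r" "w = of_int_poly g * q + r" "r = 0 \<or> degree r < degree g"
proof -
  from w obtain b w' where b: "\<not> p dvd b" "smult (of_int b) w = of_int_poly w'" by (auto simp: pint_def)
  have g0: "g \<noteq> 0" using g by auto
  obtain q r where qr: "pseudo_divmod w' g = (q, r)" by force
  from pseudo_divmod[OF g0 qr] obtain e where e: "smult (lead_coeff g ^ e) w' = g * q + r"
    "r = 0 \<or> degree r < degree g" by blast
  define B where "B = b * lead_coeff g ^ e"
  have B: "\<not> p dvd B" using p b g by (auto simp: B_def prime_dvd_mult_iff dest: prime_dvd_power)
  then have B0: "B \<noteq> 0" by auto
  have "smult (of_int B) w = of_int_poly (smult (lead_coeff g ^ e) w')"
    using b(2) by (simp add: B_def hom_distribs) (metis mult.commute smult_smult)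
  also have "\<dots> = of_int_poly g * of_int_poly q + of_int_poly r" unfolding e by (simp add: hom_distribs)
  finally have eq: "smult (of_int B) w = of_int_poly g * of_int_poly q + of_int_poly r" .
  define c where "c = inverse (of_int B :: rat)"
  have "smult c (smult (of_int B) w) = of_int_poly g * smult c (of_int_poly q) + smult c (of_int_poly r)"
    unfolding eq by (simp add: smult_add_right)
  then have "w = of_int_poly g * smult c (of_int_poly q) + smult c (of_int_poly r)"
    using B0 by (simp add: c_def)
  moreover have "pint p (smult c (of_int_poly h))" for h
    unfolding pint_def using B B0 by (intro exI[of _ B] exI[of _ h]) (simp add: c_def)
  moreover have "smult c (of_int_poly r) = 0 \<or> degree (smult c (of_int_poly r)) < degree g"
    using e(2) by auto
  ultimately show ?thesis using that by blast
qed

lemma small_multiple_eq_0: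
  fixes g :: "int poly" and z r :: "rat poly"
  assumes "of_int_poly g * z = r" "r = 0 \<or> degree r < degree g"
  shows "r = 0"
proof (rule ccontr)
  assume r: "r \<noteq> 0"
  then have "z \<noteq> 0" "g \<noteq> 0" using assms(1) by auto
  then have "degree r = degree g + degree z" using assms(1) by (subst assms(1)[symmetric], subst degree_mult_eq) auto
  then show False using assms(2) r by simp
qed

text \<open>Let w be the given combination. Multiplying it by v shows that D x is congruent to v w -
  p E x modulo g. If p^(N+1) x is p-integral, then so is p^N (v w - p E x), and hence its remainder
  modulo g; since x has smaller degree than g, that remainder equals D p^N x. Thus the powers of p
  in the denominator of x are removed one at a time. Exact division of w - x h by g then gives
  y.\<close>

lemma pint_bezout:
  fixes g h u v E :: "int poly"
  assumes p: "prime p" and g: "\<not> p dvd lead_coeff g" and D: "\<not> p dvd D"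
    and bez: "u * g + v * h = [:D:] + smult p E"
    and deg: "degree x < degree g"
    and w: "pint p (x * of_int_poly h + y * of_int_poly g)"
  shows "pint p x" "pint p y"
proof -
  let ?o = "of_int_poly :: int poly \<Rightarrow> rat poly"
  define w where "w = x * ?o h + y * ?o g"
  have pw: "pint p w" using w by (simp add: w_def)
  have vh: "?o v * ?o h = [:of_int D:] + smult (of_int p) (?o E) - ?o u * ?o g"
  proof -
    have "v * h = [:D:] + smult p E - u * g" using bez by (simp add: algebra_simps)
    then have "?o (v * h) = ?o ([:D:] + smult p E - u * g)" by simp
    then show ?thesis by (simp add: hom_distribs)
  qed
  have key: "smult (of_int D) x = ?o v * w - smult (of_int p) (?o E * x) + ?o g * (?o u * x - ?o v * y)"
  proof -
    have "?o v * w = x * (?o v * ?o h) + ?o v * y * ?o g" by (simp add: w_def algebra_simps)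
    also have "\<dots> = smult (of_int D) x + smult (of_int p) (?o E * x) - ?o u * ?o g * x + ?o v * y * ?o g"
      unfolding vh by (simp add: algebra_simps)
    finally show ?thesis by (simp add: algebra_simps)
  qed
  have step: "pint p (smult (of_int (p ^ N)) x)" if N: "pint p (smult (of_int (p ^ Suc N)) x)" for N
  proof -
    define c where "c = (of_int (p ^ N) :: rat)"
    define X where "X = smult c x"
    define z where "z = ?o u * x - ?o v * y"
    define s where "s = smult c (?o v * w) - ?o E * smult (of_int (p ^ Suc N)) x"
    have "smult (of_int D) X = smult c (smult (of_int D) x)" by (simp add: X_def mult.commute)
    also have "\<dots> = s + ?o g * smult c z"
      unfolding key z_def[symmetric] by (simp add: s_def smult_add_right smult_diff_right c_def mult.commute)
    finally have eq: "smult (of_int D) X = s + ?o g * smult c z" .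
    have "pint p s" unfolding s_def c_def
      by (intro pint_diff pint_smult pint_mult p pint_of_int_poly pw N)
    then obtain q r where qr: "pint p r" "s = ?o g * q + r" "r = 0 \<or> degree r < degree g"
      using pint_division[OF p _ g] by metis
    have "?o g * (q + smult c z) = smult (of_int D) X - r"
      unfolding eq qr(2) by (simp add: algebra_simps)
    moreover have "degree (smult (of_int D) X - r) < degree g"
      using deg qr(3) by (intro degree_diff_less) (auto simp: X_def intro: le_less_trans[OF degree_smult_le])
    ultimately have "smult (of_int D) X - r = 0" using small_multiple_eq_0 by blast
    then have "pint p (smult (of_int D) X)" using qr(1) by simp
    then show ?thesis using pint_smult_cancel[OF p D] by (simp add: X_def c_def)
  qed
  obtain N where "pint p (smult (of_int (p ^ N)) x)" using pint_power_multiple[OF p] by blast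
  then show x: "pint p x"
  proof (induction N)
    case (Suc N)
    then show ?case using step[of N] by blast
  qed auto
  have "pint p (w - x * ?o h)" by (intro pint_diff pint_mult p pint_of_int_poly pw x)
  then obtain q r where qr: "pint p q" "w - x * ?o h = ?o g * q + r" "r = 0 \<or> degree r < degree g"
    using pint_division[OF p _ g] by metis
  have eq: "?o g * (y - q) = r" using qr(2) by (simp add: w_def algebra_simps)
  then have "r = 0" using small_multiple_eq_0 qr(3) by blast
  moreover have "?o g \<noteq> 0" using g by auto
  ultimately have "y = q" using eq by simp
  then show "pint p y" using qr(1) by simp
qed

text \<open>\<open>ddiff \<tau> \<phi> i k\<close> is the divided difference of \<open>\<phi>\<close> over the nodes
  \<open>\<tau> i, \<dots>, \<tau> (i + k)\<close>.\<close>

fun ddiff :: "(nat \<Rightarrow> int) \<Rightarrow> (nat \<Rightarrow> rat poly) \<Rightarrow> nat \<Rightarrow> nat \<Rightarrow> rat poly" where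
  "ddiff \<tau> \<phi> i 0 = \<phi> i"
| "ddiff \<tau> \<phi> i (Suc k) =
     smult (1 / of_int (\<tau> (i + Suc k) - \<tau> i)) (ddiff \<tau> \<phi> (Suc i) k - ddiff \<tau> \<phi> i k)"

lemma ddiff_add: "ddiff \<tau> (\<lambda>l. \<phi> l + \<psi> l) i k = ddiff \<tau> \<phi> i k + ddiff \<tau> \<psi> i k"
  by (induction k arbitrary: i) (auto simp: smult_add_right[symmetric] algebra_simps)

lemma ddiff_const: "k > 0 \<Longrightarrow> ddiff \<tau> (\<lambda>_. c) i k = 0"
proof (induction k arbitrary: i)
  case (Suc k)
  then show ?case
  proof (cases "k = 0")
    case False
    then show ?thesis by (subst ddiff.simps(2)) (simp add: Suc.IH)
  qed simp
qed auto

lemma degree_ddiff_less: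
  assumes "\<And>j. i \<le> j \<Longrightarrow> j \<le> i + k \<Longrightarrow> degree (\<phi> j) < n"
  shows "degree (ddiff \<tau> \<phi> i k) < n"
  using assms
proof (induction k arbitrary: i)
  case (Suc k)
  have "degree (ddiff \<tau> \<phi> (Suc i) k - ddiff \<tau> \<phi> i k) < n"
    using Suc by (intro degree_diff_less) auto
  then show ?case by (auto intro: le_less_trans[OF degree_smult_le])
qed auto

lemma ddiff_Suc_node:
  assumes "\<tau> (i + Suc k) \<noteq> \<tau> i"
  shows "ddiff \<tau> \<phi> (Suc i) k = ddiff \<tau> \<phi> i k + smult (of_int (\<tau> (i + Suc k) - \<tau> i)) (ddiff \<tau> \<phi> i (Suc k))"
  using assms by simp

text \<open>Newton's formula with base node i. The induction takes the formula based at
  \<open>Suc i\<close> and moves every difference to base i by \<open>ddiff_Suc_node\<close>; the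
  result telescopes.\<close>

lemma newton_interpolation:
  assumes "inj_on \<tau> {..<M}" "i + l < M"
  shows "\<phi> (i + l) = (\<Sum>j\<le>l. smult (\<Prod>u<j. of_int (\<tau> (i + l) - \<tau> (i + u))) (ddiff \<tau> \<phi> i j))"
  using assms(2)
proof (induction l arbitrary: i)
  case (Suc l)
  define x where "x = \<tau> (i + Suc l)"
  define Q where "Q j = (\<Prod>u<j. of_int (x - \<tau> (Suc i + u)) :: rat)" for j
  have QS: "Q (Suc j) = Q j * of_int (x - \<tau> (i + Suc j))" for j by (simp add: Q_def)
  \<comment> \<open>The interpolated node itself occurs among the factors, which removes the surplus
    top term.\<close>
  have Ql: "Q (Suc l) = 0" by (simp add: QS x_def)
  let ?f = "ddiff \<tau> \<phi> i"
  have "\<phi> (i + Suc l) = (\<Sum>j\<le>l. smult (Q j) (ddiff \<tau> \<phi> (Suc i) j))"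
    using Suc.IH[of "Suc i"] Suc.prems by (simp add: Q_def x_def)
  also have "\<dots> = (\<Sum>j\<le>l. smult (Q j) (?f j) + smult (Q j * of_int (\<tau> (i + Suc j) - \<tau> i)) (?f (Suc j)))"
  proof (intro sum.cong refl)
    fix j assume "j \<in> {..l}"
    then have "\<tau> (i + Suc j) \<noteq> \<tau> i" using Suc.prems assms(1) by (auto dest!: inj_onD)
    then show "smult (Q j) (ddiff \<tau> \<phi> (Suc i) j) = smult (Q j) (?f j) + smult (Q j * of_int (\<tau> (i + Suc j) - \<tau> i)) (?f (Suc j))"
      by (subst ddiff_Suc_node) (auto simp: smult_add_right simp del: ddiff.simps)
  qed
  also have "\<dots> = (\<Sum>j\<le>l. smult (Q j) (?f j)) - (\<Sum>j\<le>l. smult (Q (Suc j)) (?f (Suc j)))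
       + (\<Sum>j\<le>l. smult (of_int (x - \<tau> i) * Q j) (?f (Suc j)))"
    by (simp only: sum_subtractf[symmetric] sum.distrib[symmetric] QS)
       (intro sum.cong refl, simp add: smult_diff_left[symmetric] smult_add_left[symmetric] algebra_simps del: ddiff.simps)
  also have "(\<Sum>j\<le>l. smult (Q (Suc j)) (?f (Suc j))) = (\<Sum>j\<le>Suc l. smult (Q j) (?f j)) - smult (Q 0) (?f 0)"
    by (subst sum.atMost_Suc_shift) simp
  also have "(\<Sum>j\<le>Suc l. smult (Q j) (?f j)) = (\<Sum>j\<le>l. smult (Q j) (?f j))" by (simp add: Ql)
  also have "(\<Sum>j\<le>l. smult (of_int (x - \<tau> i) * Q j) (?f (Suc j))) =
      (\<Sum>j\<le>l. smult (\<Prod>u<Suc j. of_int (x - \<tau> (i + u))) (?f (Suc j)))"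
    by (simp only: Q_def prod.lessThan_Suc_shift) simp
  finally have "\<phi> (i + Suc l) = ?f 0 + (\<Sum>j\<le>l. smult (\<Prod>u<Suc j. of_int (x - \<tau> (i + u))) (?f (Suc j)))"
    by (simp add: Q_def)
  also have "\<dots> = (\<Sum>j\<le>Suc l. smult (\<Prod>u<j. of_int (x - \<tau> (i + u))) (?f j))"
    by (subst sum.atMost_Suc_shift) simp
  finally show ?case by (simp only: x_def)
qed auto

text \<open>The Leibniz rule: differences of the first factor start at node i, those of the second
  end at node i + k.\<close>

lemma ddiff_mult:
  assumes "inj_on \<tau> {..<M}" "i + k < M"
  shows "ddiff \<tau> (\<lambda>l. \<phi> l * \<psi> l) i k = (\<Sum>j\<le>k. ddiff \<tau> \<phi> i j * ddiff \<tau> \<psi> (i + j) (k - j))"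
  using assms(2)
proof (induction k arbitrary: i)
  case (Suc k)
  let ?f = "ddiff \<tau> \<phi>" and ?g = "ddiff \<tau> \<psi>"
  define d where "d a b = (of_int (\<tau> a - \<tau> b) :: rat)" for a b
  have ne: "\<tau> a \<noteq> \<tau> b" if "a < M" "b < M" "a \<noteq> b" for a b
    using assms(1) that by (auto dest: inj_onD)
  have 1: "ddiff \<tau> (\<lambda>l. \<phi> l * \<psi> l) (Suc i) k =
      (\<Sum>j\<le>k. ?f i j * ?g (Suc (i + j)) (k - j)) +
      (\<Sum>j\<le>k. smult (d (i + Suc j) i) (?f i (Suc j) * ?g (i + Suc j) (k - j)))"
  proof -
    have "ddiff \<tau> (\<lambda>l. \<phi> l * \<psi> l) (Suc i) k = (\<Sum>j\<le>k. ?f (Suc i) j * ?g (Suc i + j) (k - j))"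
      using Suc by simp
    also have "\<dots> = (\<Sum>j\<le>k. (?f i j + smult (d (i + Suc j) i) (?f i (Suc j))) * ?g (Suc (i + j)) (k - j))"
    proof (intro sum.cong refl)
      fix j assume "j \<in> {..k}"
      then have "\<tau> (i + Suc j) \<noteq> \<tau> i" using Suc.prems by (intro ne) auto
      then show "?f (Suc i) j * ?g (Suc i + j) (k - j) =
          (?f i j + smult (d (i + Suc j) i) (?f i (Suc j))) * ?g (Suc (i + j)) (k - j)"
        by (subst ddiff_Suc_node) (auto simp: d_def)
    qed
    finally show ?thesis by (simp add: algebra_simps sum.distrib del: ddiff.simps)
  qed
  have 2: "ddiff \<tau> (\<lambda>l. \<phi> l * \<psi> l) i k =
      (\<Sum>j\<le>k. ?f i j * ?g (Suc (i + j)) (k - j)) -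
      (\<Sum>j\<le>k. smult (d (i + Suc k) (i + j)) (?f i j * ?g (i + j) (Suc k - j)))"
  proof -
    have "ddiff \<tau> (\<lambda>l. \<phi> l * \<psi> l) i k = (\<Sum>j\<le>k. ?f i j * ?g (i + j) (k - j))"
      using Suc by simp
    also have "\<dots> = (\<Sum>j\<le>k. ?f i j * (?g (Suc (i + j)) (k - j) - smult (d (i + Suc k) (i + j)) (?g (i + j) (Suc k - j))))"
    proof (intro sum.cong refl)
      fix j assume j: "j \<in> {..k}"
      then have "\<tau> (i + j + Suc (k - j)) \<noteq> \<tau> (i + j)" using Suc.prems by (intro ne) auto
      from ddiff_Suc_node[OF this, of \<psi>] j
      have "?g (i + j) (k - j) = ?g (Suc (i + j)) (k - j) - smult (d (i + Suc k) (i + j)) (?g (i + j) (Suc k - j))"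
        by (simp add: d_def Suc_diff_le del: ddiff.simps)
      then show "?f i j * ?g (i + j) (k - j) =
          ?f i j * (?g (Suc (i + j)) (k - j) - smult (d (i + Suc k) (i + j)) (?g (i + j) (Suc k - j)))"
        by simp
    qed
    finally show ?thesis by (simp add: algebra_simps sum_subtractf del: ddiff.simps)
  qed
  \<comment> \<open>The sum common to facts 1 and 2 cancels. The remaining weights
    \<open>\<tau> (i + j) - \<tau> i\<close> and \<open>\<tau> (i + Suc k) - \<tau> (i + j)\<close>
    of S j add up to \<open>\<tau> (i + Suc k) - \<tau> i\<close>, which no longer depends on
    j.\<close>
  define S where "S j = ?f i j * ?g (i + j) (Suc k - j)" for j
  have "ddiff \<tau> (\<lambda>l. \<phi> l * \<psi> l) (Suc i) k - ddiff \<tau> (\<lambda>l. \<phi> l * \<psi> l) i k =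
      (\<Sum>j\<le>k. smult (d (i + Suc j) i) (S (Suc j))) + (\<Sum>j\<le>k. smult (d (i + Suc k) (i + j)) (S j))"
    unfolding 1 2 by (simp add: S_def del: ddiff.simps)
  also have "(\<Sum>j\<le>k. smult (d (i + Suc j) i) (S (Suc j))) = (\<Sum>j\<le>Suc k. smult (d (i + j) i) (S j))"
    by (subst sum.atMost_Suc_shift) (simp add: d_def)
  also have "(\<Sum>j\<le>k. smult (d (i + Suc k) (i + j)) (S j)) = (\<Sum>j\<le>Suc k. smult (d (i + Suc k) (i + j)) (S j))"
    by (simp add: d_def)
  also have "(\<Sum>j\<le>Suc k. smult (d (i + j) i) (S j)) + (\<Sum>j\<le>Suc k. smult (d (i + Suc k) (i + j)) (S j)) =
      (\<Sum>j\<le>Suc k. smult (d (i + Suc k) i) (S j))"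
    by (simp only: sum.distrib[symmetric] smult_add_left[symmetric]) (simp add: d_def)
  finally have "ddiff \<tau> (\<lambda>l. \<phi> l * \<psi> l) (Suc i) k - ddiff \<tau> (\<lambda>l. \<phi> l * \<psi> l) i k =
      smult (d (i + Suc k) i) (\<Sum>j\<le>Suc k. S j)" by (simp only: smult_sum2)
  moreover have "d (i + Suc k) i \<noteq> 0" using ne[of "i + Suc k" i] Suc.prems by (simp add: d_def)
  moreover have "1 / of_int (\<tau> (i + Suc k) - \<tau> i) = 1 / d (i + Suc k) i" by (simp add: d_def)
  ultimately have "ddiff \<tau> (\<lambda>l. \<phi> l * \<psi> l) i (Suc k) = (\<Sum>j\<le>Suc k. S j)"
    unfolding ddiff.simps by (simp only:) (simp del: sum.atMost_Suc add_Suc_right)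
  then show ?case by (simp only: S_def)
qed auto

text \<open>A discrete substitute for p-adic smoothness. For distinct nodes these functions form a
  ring by the Leibniz rule, and it contains the integer polynomials in the node.\<close>

definition dd_integral :: "int \<Rightarrow> (nat \<Rightarrow> int) \<Rightarrow> nat \<Rightarrow> (nat \<Rightarrow> rat poly) \<Rightarrow> bool" where
  "dd_integral p \<tau> M \<phi> \<longleftrightarrow> (\<forall>i k. i + k < M \<longrightarrow> pint p (ddiff \<tau> \<phi> i k))"

lemma dd_integral_add:
  "prime p \<Longrightarrow> dd_integral p \<tau> M \<phi> \<Longrightarrow> dd_integral p \<tau> M \<psi> \<Longrightarrow> dd_integral p \<tau> M (\<lambda>l. \<phi> l + \<psi> l)"
  by (auto simp: dd_integral_def ddiff_add intro!: pint_add)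

lemma dd_integral_mult:
  assumes "prime p" "inj_on \<tau> {..<M}" "dd_integral p \<tau> M \<phi>" "dd_integral p \<tau> M \<psi>"
  shows "dd_integral p \<tau> M (\<lambda>l. \<phi> l * \<psi> l)"
  using assms unfolding dd_integral_def
  by (auto simp: ddiff_mult[OF assms(2)] intro!: pint_sum pint_mult)

lemma dd_integral_const:
  assumes "prime p" shows "dd_integral p \<tau> M (\<lambda>_. of_int_poly c)"
  unfolding dd_integral_def
proof (intro allI impI)
  fix i k show "pint p (ddiff \<tau> (\<lambda>_. of_int_poly c) i k)"
    using assms by (cases "k = 0") (auto simp: pint_of_int_poly pint_0 ddiff_const)
qed

lemma dd_integral_node:
  assumes "prime p" "inj_on \<tau> {..<M}" shows "dd_integral p \<tau> M (\<lambda>l. [:of_int (\<tau> l):])"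
proof -
  define f where "f l = [:of_int (\<tau> l) :: rat:]" for l
  have step: "ddiff \<tau> f i (Suc k) = (if k = 0 then 1 else 0)" if "i + Suc k < M" for i k
    using that
  proof (induction k arbitrary: i)
    case 0
    then have "\<tau> (Suc i) \<noteq> \<tau> i" using inj_onD[OF assms(2), of "Suc i" i] by auto
    then show ?case by (simp add: f_def)
  next
    case (Suc k)
    have "ddiff \<tau> f (Suc i) (Suc k) = ddiff \<tau> f i (Suc k)"
      using Suc.IH[of i] Suc.IH[of "Suc i"] Suc.prems by (simp del: ddiff.simps)
    then show ?case by (subst ddiff.simps(2)) (simp del: ddiff.simps)
  qed
  have "pint p (ddiff \<tau> f i k)" if "i + k < M" for i k
  proof (cases k)
    case 0
    then show ?thesis using pint_of_int_poly[OF assms(1), of "[:\<tau> i:]"]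
      by (simp add: f_def of_int_poly_const)
  next
    case (Suc k')
    then show ?thesis using step[of i k'] that pint_of_int_poly[OF assms(1), of 1] pint_0[OF assms(1)]
      by (simp del: ddiff.simps)
  qed
  then show ?thesis unfolding dd_integral_def f_def by blast
qed

lemma dd_integral_sum:
  "prime p \<Longrightarrow> (\<And>i. i \<in> I \<Longrightarrow> dd_integral p \<tau> M (\<phi> i)) \<Longrightarrow> dd_integral p \<tau> M (\<lambda>l. \<Sum>i\<in>I. \<phi> i l)"
proof (induction I rule: infinite_finite_induct)
  case (insert x F)
  then show ?case using dd_integral_add[of p \<tau> M "\<phi> x" "\<lambda>l. \<Sum>i\<in>F. \<phi> i l"] by simp
qed (use dd_integral_const[of p \<tau> M 0] in auto)

lemma dd_integral_poly:
  assumes "prime p" "inj_on \<tau> {..<M}" shows "dd_integral p \<tau> M (\<lambda>l. [:of_int (poly q (\<tau> l)):])"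
proof (induction q)
  case 0 show ?case using dd_integral_const[OF assms(1), of \<tau> M 0] by simp
next
  case (pCons a q)
  have "dd_integral p \<tau> M (\<lambda>l. of_int_poly [:a:] + [:of_int (\<tau> l):] * [:of_int (poly q (\<tau> l)):])"
    by (intro dd_integral_add dd_integral_mult dd_integral_const dd_integral_node assms pCons.IH)
  then show ?case by (simp add: algebra_simps of_int_poly_const)
qed

lemma dd_integral_map_poly:
  assumes "prime p" "inj_on \<tau> {..<M}"
  shows "dd_integral p \<tau> M (\<lambda>l. of_int_poly (map_poly (\<lambda>q. poly q (\<tau> l)) R))"
proof -
  have eq: "of_int_poly (map_poly (\<lambda>q. poly q (\<tau> l)) R) =
      (\<Sum>i\<le>degree R. [:of_int (poly (coeff R i) (\<tau> l)):] * of_int_poly (monom 1 i) :: rat poly)" for l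
  proof (rule poly_eqI)
    fix n
    have "coeff (\<Sum>i\<le>degree R. [:of_int (poly (coeff R i) (\<tau> l)):] * of_int_poly (monom 1 i) :: rat poly) n =
        of_int (poly (coeff R n) (\<tau> l))"
      by (cases "n \<le> degree R")
        (auto simp: coeff_sum coeff_map_poly coeff_eq_0 if_distrib[of "\<lambda>x. _ * x"] cong: if_cong)
    then show "coeff (of_int_poly (map_poly (\<lambda>q. poly q (\<tau> l)) R)) n =
        coeff (\<Sum>i\<le>degree R. [:of_int (poly (coeff R i) (\<tau> l)):] * of_int_poly (monom 1 i) :: rat poly) n"
      by (simp add: coeff_map_poly)
  qed
  show ?thesis unfolding eq
    by (intro dd_integral_sum dd_integral_mult dd_integral_poly dd_integral_const assms)
qed

text \<open>Induction on the order k. In the Leibniz rule for g h only the two extreme terms contain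
  differences of order k; once the leading term of g is split off, they form the combination treated
  by \<open>pint_bezout\<close>, and everything else is p-integral already. The differences of g and
  h of order k are obtained together.\<close>

lemma dd_integral_factor:
  fixes g h :: "nat \<Rightarrow> int poly" and lc :: "nat \<Rightarrow> int"
  assumes p: "prime p" and inj: "inj_on \<tau> {..<M}"
    and prod: "dd_integral p \<tau> M (\<lambda>l. of_int_poly (g l * h l))"
    and lc: "dd_integral p \<tau> M (\<lambda>l. [:of_int (lc l):])"
    and g: "\<And>l. l < M \<Longrightarrow> degree (g l) = n \<and> lead_coeff (g l) = lc l \<and> \<not> p dvd lc l" and n: "n > 0"
    and h_cong: "\<And>i j. i < M \<Longrightarrow> j < M \<Longrightarrow> \<exists>E. h j = h i + smult p E"
    and bez: "\<And>i. i < M \<Longrightarrow> \<exists>u v D. u * g i + v * h i = [:D:] \<and> \<not> p dvd D"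
  shows "dd_integral p \<tau> M (\<lambda>l. of_int_poly (g l))"
proof -
  let ?o = "of_int_poly :: int poly \<Rightarrow> rat poly"
  \<comment> \<open>The leading term is known to be smooth; removing it leaves degree below n, as
    \<open>pint_bezout\<close> demands of x.\<close>
  define g' where "g' l = ?o (g l) - [:of_int (lc l):] * ?o (monom 1 n)" for l
  have g'_deg: "degree (g' l) < n" if "l < M" for l
  proof -
    have 1: "degree (g' l) \<le> n" unfolding g'_def
      using g[OF that] by (intro degree_diff_le) (auto intro: degree_monom_le order_trans[OF degree_smult_le])
    have "coeff (g' l) n = 0" using g[OF that] by (auto simp: g'_def)
    then show ?thesis using 1 n
      by (metis coeff_0_degree_minus_1 degree_0 le_degree leading_coeff_0_iff le_neq_implies_less)
  qed
  have g_eq: "(\<lambda>l. ?o (g l)) = (\<lambda>l. [:of_int (lc l):] * ?o (monom 1 n) + g' l)"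
    by (simp add: g'_def)
  have lcm: "dd_integral p \<tau> M (\<lambda>l. [:of_int (lc l):] * ?o (monom 1 n))"
    by (intro dd_integral_mult dd_integral_const lc p inj)
  have "\<forall>i. i + k < M \<longrightarrow> pint p (ddiff \<tau> (\<lambda>l. ?o (g l)) i k) \<and> pint p (ddiff \<tau> (\<lambda>l. ?o (h l)) i k)" for k
  proof (induction k rule: less_induct)
    case (less k)
    show ?case
    proof (intro allI impI)
      fix i assume ik: "i + k < M"
      show "pint p (ddiff \<tau> (\<lambda>l. ?o (g l)) i k) \<and> pint p (ddiff \<tau> (\<lambda>l. ?o (h l)) i k)"
      proof (cases "k = 0")
        case True then show ?thesis using pint_of_int_poly[OF p] by simp
      next
        case False
        then obtain k' where k': "k = Suc k'" by (cases k) auto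
        define G where "G = ddiff \<tau> (\<lambda>l. ?o (g l))"
        define H where "H = ddiff \<tau> (\<lambda>l. ?o (h l))"
        define x where "x = ddiff \<tau> g' i k"
        define L where "L = ddiff \<tau> (\<lambda>l. [:of_int (lc l):] * ?o (monom 1 n)) i k"
        have pL: "pint p L" using lcm ik by (simp add: L_def dd_integral_def)
        have Gx: "G i k = L + x" unfolding G_def g_eq x_def L_def by (rule ddiff_add)
        have "ddiff \<tau> (\<lambda>l. ?o (g l) * ?o (h l)) i k = (\<Sum>j\<le>k. G i j * H (i + j) (k - j))"
          unfolding G_def H_def by (rule ddiff_mult[OF inj ik])
        also have "{..k} = insert 0 (insert k {1..k'})" using k' by auto
        also have "(\<Sum>j\<in>insert 0 (insert k {1..k'}). G i j * H (i + j) (k - j)) =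
            G i 0 * H i k + (G i k * H (i + k) 0 + (\<Sum>j=1..k'. G i j * H (i + j) (k - j)))"
          using k' by simp
        also have "\<dots> = ?o (g i) * H i k + (G i k * ?o (h (i + k)) + (\<Sum>j=1..k'. G i j * H (i + j) (k - j)))"
          by (simp only: G_def H_def ddiff.simps(1))
        finally have "x * ?o (h (i + k)) + H i k * ?o (g i) =
            ddiff \<tau> (\<lambda>l. ?o (g l) * ?o (h l)) i k - (\<Sum>j=1..k'. G i j * H (i + j) (k - j)) - L * ?o (h (i + k))"
          unfolding Gx by (simp add: algebra_simps)
        moreover have "pint p \<dots>"
        proof (intro pint_diff pint_sum pint_mult p pL pint_of_int_poly)
          show "pint p (ddiff \<tau> (\<lambda>l. ?o (g l) * ?o (h l)) i k)"
            using prod ik by (simp add: dd_integral_def hom_distribs)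
          fix j assume j: "j \<in> {1..k'}"
          show "pint p (G i j)" using less[of j] j k' ik by (auto simp: G_def)
          show "pint p (H (i + j) (k - j))" using less[of "k - j"] j k' ik by (auto simp: H_def)
        qed
        ultimately have w: "pint p (x * ?o (h (i + k)) + H i k * ?o (g i))" by simp
        \<comment> \<open>The Bezout relation is available at node i, while the Leibniz rule
          involves h at node i + k. The difference is a multiple of p and goes into E.\<close>
        obtain u v D where uv: "u * g i + v * h i = [:D:]" "\<not> p dvd D" using bez[of i] ik by auto
        obtain E where E: "h (i + k) = h i + smult p E" using h_cong[of i "i + k"] ik by auto
        have b: "u * g i + v * h (i + k) = [:D:] + smult p (v * E)"
          unfolding E using uv(1) by (simp add: algebra_simps)
        have "degree x < degree (g i)" using g[of i] ik unfolding x_def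
          by (auto intro!: degree_ddiff_less g'_deg)
        moreover have "\<not> p dvd lead_coeff (g i)" using g[of i] ik by auto
        ultimately have "pint p x" "pint p (H i k)" using pint_bezout[OF p _ uv(2) b _ w] by auto
        then show ?thesis using pint_add[OF p pL, of x] Gx by (simp add: G_def H_def)
      qed
    qed
  qed
  then show ?thesis by (simp add: dd_integral_def)
qed

section \<open>Interpolation determinants\<close>

text \<open>If every maximal minor vanishes, the functions are linearly dependent; the coefficients of the
  relation are cofactors of a nonvanishing minor of largest size.\<close>

lemma all_minors_zero_imp_dependent:
  fixes f :: "nat \<Rightarrow> 'a \<Rightarrow> int"
  assumes "\<And>x. (\<forall>l<M. x l \<in> X) \<Longrightarrow> det (mat M M (\<lambda>(l,k). f k (x l))) = 0"
  shows "\<exists>c. (\<exists>k<M. c k \<noteq> 0) \<and> (\<forall>y\<in>X. (\<Sum>k<M. c k * f k y) = 0)"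
  using assms
proof (induction M)
  case 0
  have "det (mat 0 0 (\<lambda>(l,k). f k (undefined l))) = (1::int)" by (intro det_dim_zero) auto
  then show ?case using 0[of undefined] by simp
next
  case (Suc M)
  show ?case
  proof (cases "\<exists>x. (\<forall>l<M. x l \<in> X) \<and> det (mat M M (\<lambda>(l,k). f k (x l))) \<noteq> 0")
    case False
    then obtain c where c: "\<exists>k<M. c k \<noteq> 0" "\<forall>y\<in>X. (\<Sum>k<M. c k * f k y) = 0"
      using Suc.IH by blast
    define c' where "c' k = (if k < M then c k else 0)" for k
    have "(\<Sum>k<Suc M. c' k * f k y) = (\<Sum>k<M. c k * f k y)" for y by (simp add: c'_def)
    then have "\<forall>y\<in>X. (\<Sum>k<Suc M. c' k * f k y) = 0" using c(2) by simp
    moreover have "\<exists>k<Suc M. c' k \<noteq> 0" using c(1) by (auto simp: c'_def intro: less_SucI)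
    ultimately show ?thesis by blast
  next
    case True
    then obtain x where x: "\<forall>l<M. x l \<in> X" "det (mat M M (\<lambda>(l,k). f k (x l))) \<noteq> 0" by blast
    define A where "A y = mat (Suc M) (Suc M) (\<lambda>(l,k). f k (if l < M then x l else y))" for y
    have Ac: "A y \<in> carrier_mat (Suc M) (Suc M)" for y by (simp add: A_def)
    define c where "c k = cofactor (A undefined) M k" for k
    have cof: "cofactor (A y) M k = c k" for y k
    proof -
      have "mat_delete (A y) M k = mat_delete (A undefined) M k"
        by (rule eq_matI) (auto simp: A_def mat_delete_def)
      then show ?thesis by (simp add: c_def cofactor_def)
    qed
    have "(\<Sum>k<Suc M. c k * f k y) = 0" if y: "y \<in> X" for y
    proof -
      have "det (A y) = (\<Sum>k<Suc M. A y $$ (M, k) * cofactor (A y) M k)"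
        by (rule laplace_expansion_row[OF Ac]) simp
      also have "\<dots> = (\<Sum>k<Suc M. c k * f k y)"
      proof (intro sum.cong refl)
        fix k assume "k \<in> {..<Suc M}"
        then have "A y $$ (M, k) = f k y" by (simp add: A_def)
        then show "A y $$ (M, k) * cofactor (A y) M k = c k * f k y" by (simp add: cof)
      qed
      finally have "det (A y) = (\<Sum>k<Suc M. c k * f k y)" .
      moreover have "det (A y) = 0"
        using Suc.prems[of "\<lambda>l. if l < M then x l else y"] x(1) y by (simp add: A_def)
      ultimately show ?thesis by simp
    qed
    moreover have "c M \<noteq> 0"
    proof -
      have "mat_delete (A undefined) M M = mat M M (\<lambda>(l,k). f k (x l))"
        by (rule eq_matI) (auto simp: A_def mat_delete_def)
      then show ?thesis using x(2) by (simp add: c_def cofactor_def)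
    qed
    ultimately show ?thesis by blast
  qed
qed

lemma det_eq_0_if_repeated:
  fixes f :: "nat \<Rightarrow> 'a \<Rightarrow> int"
  assumes "i < M" "j < M" "i \<noteq> j" "x i = x j"
  shows "det (mat M M (\<lambda>(l,k). f k (x l))) = 0"
  by (rule det_identical_rows[OF _ assms(3,1,2)]) (auto simp: assms intro!: eq_vecI)

text \<open>The bound is taken column by column because a column of an interpolation determinant
  holds the values of one function.\<close>

lemma abs_det_le:
  fixes A :: "int mat"
  assumes "A \<in> carrier_mat n n" "\<And>i j. i < n \<Longrightarrow> j < n \<Longrightarrow> \<bar>A $$ (i,j)\<bar> \<le> c j"
  shows "\<bar>det A\<bar> \<le> fact n * (\<Prod>j<n. c j)"
proof -
  have c: "j < n \<Longrightarrow> 0 \<le> c j" for j using assms(2)[of j j] by (meson abs_ge_zero order_trans)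
  have "det A = det (transpose_mat A)" using det_transpose[OF assms(1)] by simp
  also have "\<dots> = (\<Sum>\<pi>\<in>{\<pi>. \<pi> permutes {0..<n}}. signof \<pi> * (\<Prod>j=0..<n. A $$ (\<pi> j, j)))"
  proof -
    have "transpose_mat A \<in> carrier_mat n n" using assms(1) by simp
    from det_def'[OF this] have "det (transpose_mat A) =
       (\<Sum>\<pi>\<in>{\<pi>. \<pi> permutes {0..<n}}. signof \<pi> * (\<Prod>j=0..<n. transpose_mat A $$ (j, \<pi> j)))" .
    also have "\<dots> = (\<Sum>\<pi>\<in>{\<pi>. \<pi> permutes {0..<n}}. signof \<pi> * (\<Prod>j=0..<n. A $$ (\<pi> j, j)))"
      using assms(1) by (intro sum.cong refl arg_cong2[of _ _ _ _ "(*)"] prod.cong refl)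
        (auto simp: permutes_in_image intro!: index_transpose_mat(1))
    finally show ?thesis .
  qed
  finally have "\<bar>det A\<bar> \<le> (\<Sum>\<pi>\<in>{\<pi>. \<pi> permutes {0..<n}}. \<bar>signof \<pi> * (\<Prod>j=0..<n. A $$ (\<pi> j, j))\<bar>)"
    by simp
  also have "\<dots> \<le> (\<Sum>\<pi>\<in>{\<pi>. \<pi> permutes {0..<n}}. (\<Prod>j<n. c j))"
  proof (rule sum_mono)
    fix \<pi> assume \<pi>: "\<pi> \<in> {\<pi>. \<pi> permutes {0..<n}}"
    have "\<bar>signof \<pi> * (\<Prod>j=0..<n. A $$ (\<pi> j, j))\<bar> = (\<Prod>j=0..<n. \<bar>A $$ (\<pi> j, j)\<bar>)"
      by (simp add: abs_mult abs_prod sign_def)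
    also have "\<dots> \<le> (\<Prod>j=0..<n. c j)"
      using \<pi> by (intro prod_mono) (auto intro!: assms(2) simp: permutes_in_image)
    finally show "\<bar>signof \<pi> * (\<Prod>j=0..<n. A $$ (\<pi> j, j))\<bar> \<le> (\<Prod>j<n. c j)"
      by (simp add: atLeast0LessThan)
  qed
  also have "\<dots> = fact n * (\<Prod>j<n. c j)"
    by (simp add: card_permutations)
  finally show ?thesis .
qed

lemma pint_const_sum_prod:
  assumes "prime p" "\<And>\<pi> j. \<pi> \<in> S \<Longrightarrow> j \<in> J \<Longrightarrow> pint p [:a \<pi> j:]"
  shows "pint p [:\<Sum>\<pi>\<in>S. of_int (s \<pi>) * (\<Prod>j\<in>J. a \<pi> j):]"
proof -
  have prod: "pint p [:\<Prod>j\<in>J. a \<pi> j:]" if "\<pi> \<in> S" for \<pi>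
    using assms(2)[OF that]
  proof (induction J rule: infinite_finite_induct)
    case (insert x F)
    then show ?case using pint_mult[OF assms(1), of "[:a \<pi> x:]" "[:\<Prod>j\<in>F. a \<pi> j:]"] by (simp add: mult.commute)
  qed (use pint_of_int_poly[OF assms(1), of 1] in simp_all)
  have "[:\<Sum>\<pi>\<in>S. of_int (s \<pi>) * (\<Prod>j\<in>J. a \<pi> j):] = (\<Sum>\<pi>\<in>S. smult (of_int (s \<pi>)) [:\<Prod>j\<in>J. a \<pi> j:])"
    by (rule poly_eqI) (auto simp: coeff_sum coeff_pCons split: nat.split)
  then show ?thesis by (simp only:) (intro pint_sum pint_smult assms(1) prod)
qed

lemma pint_const_coeff: "pint p f \<Longrightarrow> pint p [:coeff f s:]"
proof -
  assume "pint p f"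
  then obtain b g where bg: "\<not> p dvd b" "smult (of_int b) f = of_int_poly g" by (auto simp: pint_def)
  have "of_int b * coeff f s = of_int (coeff g s)" using arg_cong[OF bg(2), of "\<lambda>f. coeff f s"] by simp
  then have "smult (of_int b) [:coeff f s:] = of_int_poly [:coeff g s:]" by (simp add: of_int_poly_const)
  then show ?thesis using bg(1) unfolding pint_def by blast
qed

text \<open>By Newton interpolation the matrix is a triangular matrix, with the products
  \<open>\<Prod>u<l. (\<tau> l - \<tau> u)\<close> on the diagonal, times a \<open>p\<close>-integral matrix.\<close>

lemma power_dvd_interpolation_det:
  fixes F :: "nat \<Rightarrow> nat \<Rightarrow> int"
  assumes p: "prime p" and inj: "inj_on \<tau> {..<M}"
    and cong: "\<And>i j. i < M \<Longrightarrow> j < M \<Longrightarrow> p dvd \<tau> i - \<tau> j"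
    and int: "\<And>k. k < M \<Longrightarrow> dd_integral p \<tau> M (\<phi> k)"
    and F: "\<And>l k. l < M \<Longrightarrow> k < M \<Longrightarrow> of_int (F k l) = coeff (\<phi> k l) (s k)"
  shows "p ^ (\<Sum>l<M. l) dvd det (mat M M (\<lambda>(l,k). F k l))"
proof -
  define T :: "rat mat" where "T = mat M M (\<lambda>(l,j). if j \<le> l then \<Prod>u<j. of_int (\<tau> l - \<tau> u) else 0)"
  define D :: "rat mat" where "D = mat M M (\<lambda>(j,k). coeff (ddiff \<tau> (\<phi> k) 0 j) (s k))"
  have carr: "T \<in> carrier_mat M M" "D \<in> carrier_mat M M" by (simp_all add: T_def D_def)
  have TD: "mat M M (\<lambda>(l,k). of_int (F k l)) = T * D"
  proof (rule eq_matI)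
    fix l k assume "l < dim_row (T * D)" "k < dim_col (T * D)"
    then have lk: "l < M" "k < M" using carr by auto
    have "(T * D) $$ (l, k) = (\<Sum>j<M. T $$ (l, j) * D $$ (j, k))"
      using lk carr by (simp add: scalar_prod_def atLeast0LessThan)
    also have "\<dots> = (\<Sum>j<M. if j \<le> l then (\<Prod>u<j. of_int (\<tau> l - \<tau> u)) * coeff (ddiff \<tau> (\<phi> k) 0 j) (s k) else 0)"
      using lk by (intro sum.cong refl) (auto simp: T_def D_def)
    also have "\<dots> = (\<Sum>j\<le>l. (\<Prod>u<j. of_int (\<tau> l - \<tau> u)) * coeff (ddiff \<tau> (\<phi> k) 0 j) (s k))"
    proof -
      have "{..l} = {j\<in>{..<M}. j \<le> l}" using lk by auto
      then show ?thesis by (simp only: sum.inter_filter finite_lessThan)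
    qed
    also have "\<dots> = coeff (\<phi> k (0 + l)) (s k)"
      by (subst newton_interpolation[OF inj, of 0 l]) (use lk in \<open>auto simp: coeff_sum\<close>)
    finally show "mat M M (\<lambda>(l,k). of_int (F k l)) $$ (l, k) = (T * D) $$ (l, k)"
      using lk F by simp
  qed (use carr in auto)
  have "of_int (det (mat M M (\<lambda>(l,k). F k l))) = (det (mat M M (\<lambda>(l,k). of_int (F k l))) :: rat)"
    unfolding of_int_hom.hom_det[symmetric] by (rule arg_cong[of _ _ det], rule eq_matI) auto
  also have "\<dots> = det T * det D" unfolding TD using carr by (rule det_mult)
  also have "det T = (\<Prod>l<M. \<Prod>u<l. of_int (\<tau> l - \<tau> u))"
  proof -
    have "det T = prod_list (diag_mat T)"
      by (rule det_lower_triangular[OF _ carr(1)]) (auto simp: T_def)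
    also have "diag_mat T = map (\<lambda>l. \<Prod>u<l. of_int (\<tau> l - \<tau> u)) [0..<M]"
      by (auto simp: diag_mat_def T_def)
    finally show ?thesis by (simp add: prod.distinct_set_conv_list[symmetric] atLeast0LessThan)
  qed
  also have "\<dots> = of_int (\<Prod>l<M. \<Prod>u<l. \<tau> l - \<tau> u)" by simp
  finally have det_eq: "of_int (det (mat M M (\<lambda>(l,k). F k l))) = of_int (\<Prod>l<M. \<Prod>u<l. \<tau> l - \<tau> u) * det D" .
  \<comment> \<open>The entries of D are p-integral, hence so is its determinant; a denominator b
    prime to p does not affect divisibility by a power of p.\<close>
  have "pint p [:det D:]"
  proof -
    have "det D = (\<Sum>\<pi>\<in>{\<pi>. \<pi> permutes {0..<M}}. of_int (sign \<pi>) * (\<Prod>j=0..<M. D $$ (j, \<pi> j)))"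
      unfolding det_def'[OF carr(2)] by (rule refl)
    moreover have "pint p [:D $$ (j, \<pi> j):]" if "\<pi> \<in> {\<pi>. \<pi> permutes {0..<M}}" "j \<in> {0..<M}" for \<pi> j
    proof -
      have "\<pi> j < M" using that permutes_in_image[of \<pi> "{0..<M}" j] by simp
      then show ?thesis using that int[of "\<pi> j"] unfolding dd_integral_def
        by (auto simp: D_def intro!: pint_const_coeff)
    qed
    ultimately show ?thesis by (simp only:) (rule pint_const_sum_prod[OF p])
  qed
  then obtain b g where b: "\<not> p dvd b" "smult (of_int b) [:det D:] = of_int_poly g" by (auto simp: pint_def)
  have "of_int (coeff g 0) = coeff (of_int_poly g :: rat poly) 0"
    by (simp only: of_int_hom.coeff_map_poly_hom)
  also have "\<dots> = of_int b * det D" unfolding b(2)[symmetric] by simp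
  finally have bD: "of_int b * det D = of_int (coeff g 0)" by simp
  have "of_int (b * det (mat M M (\<lambda>(l,k). F k l))) = (of_int ((\<Prod>l<M. \<Prod>u<l. \<tau> l - \<tau> u) * coeff g 0) :: rat)"
    using det_eq bD by (simp add: algebra_simps)
  then have eq: "b * det (mat M M (\<lambda>(l,k). F k l)) = (\<Prod>l<M. \<Prod>u<l. \<tau> l - \<tau> u) * coeff g 0"
    unfolding of_int_eq_iff .
  \<comment> \<open>Row l contributes l differences of nodes, each divisible by p.\<close>
  have "(\<Prod>l<M. p ^ l) dvd (\<Prod>l<M. \<Prod>u<l. \<tau> l - \<tau> u)"
  proof (rule prod_dvd_prod)
    fix l assume l: "l \<in> {..<M}"
    have "(\<Prod>u<l. p) dvd (\<Prod>u<l. \<tau> l - \<tau> u)" using cong l by (intro prod_dvd_prod) auto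
    then show "p ^ l dvd (\<Prod>u<l. \<tau> l - \<tau> u)" by simp
  qed
  then have "p ^ (\<Sum>l<M. l) dvd b * det (mat M M (\<lambda>(l,k). F k l))"
    unfolding eq by (simp add: power_sum dvd_mult2)
  moreover have "Rings.coprime (p ^ (\<Sum>l<M. l)) b"
    using prime_imp_coprime[OF p b(1)] by (simp add: coprime_power_left_iff)
  ultimately show ?thesis by (simp add: coprime_dvd_mult_right_iff)
qed

section \<open>Counting specializations in a residue class\<close>

abbreviation eval_at :: "int \<Rightarrow> int poly poly \<Rightarrow> int poly" where
  "eval_at t \<equiv> map_poly (\<lambda>q. poly q t)"

lemma eval_at_mult: "eval_at t (f * g) = eval_at t f * eval_at t g"
  by (rule poly_eqI) (simp add: coeff_map_poly coeff_mult poly_sum)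

lemma eval_at_add: "eval_at t (f + g) = eval_at t f + eval_at t g"
  by (rule poly_eqI) (simp add: coeff_map_poly)

lemma eval_at_const: "eval_at t [:c:] = [:poly c t:]"
  by (rule poly_eqI) (auto simp: coeff_map_poly coeff_pCons split: nat.split)

lemma eval_at_pderiv: "eval_at t (pderiv f) = pderiv (eval_at t f)"
  by (rule poly_eqI) (simp add: coeff_map_poly coeff_pderiv)

text \<open>The rows of the Sylvester matrix are the coefficient vectors, in descending order, of f
  and g multiplied by powers of the variable. The last row of the adjugate combines them into the
  determinant times the last unit vector, that is, into a constant.\<close>

lemma resultant_bezout:
  fixes f g :: "'a :: comm_ring_1 poly"
  assumes "degree f + degree g > 0"
  shows "\<exists>u v. u * f + v * g = [:resultant f g:]"
proof -
  define m where "m = degree f"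
  define n where "n = degree g"
  define N where "N = m + n"
  define S where "S = sylvester_mat f g"
  define A where "A = adj_mat S"
  \<comment> \<open>The index of the last column, which holds the constant terms.\<close>
  define r where "r = N - 1"
  define w where "w i = (if i < n then monom 1 (n - 1 - i) * f else monom 1 (N - 1 - i) * g)" for i
  have Sc: "S \<in> carrier_mat N N" unfolding S_def N_def m_def n_def by (rule sylvester_carrier_mat)
  have Ac: "A \<in> carrier_mat N N" "A * S = det S \<cdot>\<^sub>m 1\<^sub>m N"
    unfolding A_def by (rule adj_mat[OF Sc])+
  have N: "N > 0" using assms by (simp add: N_def m_def n_def)
  have w: "w i = (\<Sum>j<N. monom (S $$ (i,j)) (N - 1 - j))" if i: "i < N" for i
  proof (rule poly_eqI)
    fix e
    have "coeff (\<Sum>j<N. monom (S $$ (i,j)) (N - 1 - j)) e = (\<Sum>j<N. if N - 1 - j = e then S $$ (i,j) else 0)"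
      by (simp add: coeff_sum)
    also have "\<dots> = coeff (w i) e"
    proof (cases "e < N")
      case True
      have "(\<Sum>j<N. if N - 1 - j = e then S $$ (i,j) else 0) = (\<Sum>j<N. if j = N - 1 - e then S $$ (i,j) else 0)"
        using True by (intro sum.cong refl) auto
      also have "\<dots> = S $$ (i, N - 1 - e)" using True by simp
      also have "\<dots> = coeff (w i) e"
      proof -
        have j: "N - 1 - e < degree f + degree g" "i < degree f + degree g" using i True by (auto simp: N_def m_def n_def)
        have "S $$ (i, N - 1 - e) = (if i < n then
            if i \<le> N - 1 - e \<and> N - 1 - e - i \<le> m then coeff f (m + i - (N - 1 - e)) else 0
          else if i - n \<le> N - 1 - e \<and> N - 1 - e \<le> i then coeff g (i - (N - 1 - e)) else 0)"
          unfolding S_def m_def n_def by (rule sylvester_index_mat[OF j(2,1)])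
        also have "\<dots> = coeff (w i) e"
        proof (cases "i < n")
          case True
          then have "m + i - (N - 1 - e) = e - (n - 1 - i)" if "n - 1 - i \<le> e"
            using that \<open>e < N\<close> by (simp add: N_def)
          moreover have "coeff f (e - (n - 1 - i)) = 0" if "\<not> i \<le> N - 1 - e"
            using that True \<open>e < N\<close> by (intro coeff_eq_0) (auto simp: N_def m_def)
          ultimately show ?thesis using True \<open>e < N\<close>
            by (auto simp: w_def coeff_monom_mult N_def)
        next
          case False
          then have "i - (N - 1 - e) = e - (N - 1 - i)" if "N - 1 - i \<le> e"
            using that \<open>e < N\<close> i by simp
          moreover have "coeff g (e - (N - 1 - i)) = 0" if "\<not> i - n \<le> N - 1 - e"
            using that False \<open>e < N\<close> i by (intro coeff_eq_0) (auto simp: n_def)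
          ultimately show ?thesis using False \<open>e < N\<close> i
            by (auto simp: w_def coeff_monom_mult)
        qed
        finally show ?thesis .
      qed
      finally show ?thesis .
    next
      case False
      have "degree (w i) \<le> N - 1"
      proof (cases "i < n")
        case True
        then have "degree (w i) \<le> (n - 1 - i) + m" unfolding w_def m_def
          using degree_mult_le[of "monom 1 (n - 1 - i)" f] degree_monom_le[of "1::'a" "n - 1 - i"] by simp
        then show ?thesis using True by (simp add: N_def)
      next
        case False
        then have "degree (w i) \<le> (N - 1 - i) + n" unfolding w_def n_def
          using degree_mult_le[of "monom 1 (N - 1 - i)" g] degree_monom_le[of "1::'a" "N - 1 - i"] by simp
        then show ?thesis using False i by (simp add: N_def)
      qed
      then show ?thesis using False N by (subst coeff_eq_0) (auto intro!: sum.neutral)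
    qed
    finally show "coeff (w i) e = coeff (\<Sum>j<N. monom (S $$ (i,j)) (N - 1 - j)) e" by simp
  qed
  have AS: "(\<Sum>i<N. A $$ (r, i) * S $$ (i, j)) = (if j = r then det S else 0)" if j: "j < N" for j
  proof -
    have "(\<Sum>i<N. A $$ (r, i) * S $$ (i, j)) = (A * S) $$ (r, j)"
      using Ac(1) Sc j N by (simp add: scalar_prod_def r_def atLeast0LessThan)
    then show ?thesis using Ac(2) j N by (auto simp: r_def)
  qed
  have "(\<Sum>i<N. [:A $$ (r,i):] * w i) = (\<Sum>i<N. \<Sum>j<N. monom (A $$ (r, i) * S $$ (i, j)) (N - 1 - j))"
    by (intro sum.cong refl) (simp add: w sum_distrib_left smult_sum2 smult_monom)
  also have "\<dots> = (\<Sum>j<N. monom (\<Sum>i<N. A $$ (r, i) * S $$ (i, j)) (N - 1 - j))"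
    by (subst sum.swap) (simp add: monom_hom.hom_sum)
  also have "\<dots> = (\<Sum>j<N. if j = r then monom (det S) 0 else 0)"
    by (intro sum.cong refl) (simp add: AS, simp add: r_def)
  also have "\<dots> = [:resultant f g:]"
    using N by (simp add: r_def resultant_def S_def monom_0)
  finally have "[:resultant f g:] = (\<Sum>i<N. [:A $$ (r,i):] * w i)" by simp
  also have "\<dots> = (\<Sum>i<n. [:A $$ (r,i):] * w i) + (\<Sum>i=n..<N. [:A $$ (r,i):] * w i)"
    unfolding lessThan_atLeast0 by (rule sum.atLeastLessThan_concat[symmetric]) (auto simp: N_def)
  also have "(\<Sum>i<n. [:A $$ (r,i):] * w i) = (\<Sum>i<n. [:A $$ (r,i):] * monom 1 (n - 1 - i)) * f"
    unfolding sum_distrib_right by (intro sum.cong refl) (auto simp: w_def)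
  also have "(\<Sum>i=n..<N. [:A $$ (r,i):] * w i) = (\<Sum>i=n..<N. [:A $$ (r,i):] * monom 1 (N - 1 - i)) * g"
    unfolding sum_distrib_right by (intro sum.cong refl) (auto simp: w_def)
  finally show ?thesis by (intro exI) (rule sym)
qed

lemma degree_resultant_le:
  fixes f g :: "int poly poly"
  assumes "\<And>i. degree (coeff f i) \<le> d" "\<And>i. degree (coeff g i) \<le> d"
  shows "degree (resultant f g) \<le> d * (degree f + degree g)"
  unfolding resultant_def
  by (rule degree_det_le[OF _ sylvester_carrier_mat]) (auto simp: sylvester_index_mat assms)

lemma card_roots_le: "q \<noteq> 0 \<Longrightarrow> finite {t::int. poly q t = 0} \<and> card {t. poly q t = 0} \<le> degree q"
  using poly_roots_finite poly_roots_degree by blast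

text \<open>A common divisor of positive degree would be associated to R and could not divide a
  nonzero polynomial of smaller degree.\<close>

lemma resultant_irreducible_neq_0:
  fixes R G :: "int poly poly"
  assumes "irreducible R" "degree G < degree R" "G \<noteq> 0"
  shows "resultant R G \<noteq> 0"
proof
  assume "resultant R G = 0"
  then have d: "degree (gcd R G) \<noteq> 0" by (simp add: resultant_0_gcd)
  have "gcd R G dvd R" by simp
  then have "is_unit (gcd R G) \<or> R dvd gcd R G" using irreducibleD'[OF assms(1)] by blast
  moreover have "\<not> is_unit (gcd R G)" using d by (auto simp: is_unit_poly_iff)
  ultimately have "R dvd G" by (meson dvd_trans gcd_dvd2)
  then have "degree R \<le> degree G" using assms(3) dvd_imp_degree_le by blast
  then show False using assms(2) by simp
qed

lemma sum_lessThan_double: "(\<Sum>l<2*a. l) = a * (2 * a - 1 :: nat)"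
  by (induction a) (auto simp: algebra_simps)

text \<open>With 2 a nodes the determinant is divisible by p to the power 0 + 1 + ... + (2 a - 1) =
  a (2 a - 1). By \<open>size\<close> the column bounds give a smaller absolute value, so it is 0.
  If two nodes coincide, two rows do.\<close>

lemma interpolation_det_eq_0:
  fixes g h :: "int \<Rightarrow> int poly" and f :: "int poly poly"
  assumes p: "prime p" and x: "\<And>l. l < 2 * a \<Longrightarrow> x l \<in> X"
    and prod: "\<And>t. t \<in> X \<Longrightarrow> g t * h t = eval_at t f"
    and g: "\<And>t. t \<in> X \<Longrightarrow> degree (g t) = k \<and> lead_coeff (g t) = poly lc t \<and> \<not> p dvd poly lc t" and k: "k > 0"
    and cong: "\<And>t t'. t \<in> X \<Longrightarrow> t' \<in> X \<Longrightarrow> p dvd t - t'"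
    and h_cong: "\<And>t t'. t \<in> X \<Longrightarrow> t' \<in> X \<Longrightarrow> \<exists>E. h t' = h t + smult p E"
    and bez: "\<And>t. t \<in> X \<Longrightarrow> \<exists>u v D. u * g t + v * h t = [:D:] \<and> \<not> p dvd D"
    and B: "\<And>t. t \<in> X \<Longrightarrow> 0 \<le> t \<and> t \<le> B" and Y: "\<And>t s. t \<in> X \<Longrightarrow> \<bar>coeff (g t) s\<bar> \<le> Y"
    and size: "fact (2 * a) * (B ^ (a * (a - 1)) * Y ^ a) < p ^ (a * (2 * a - 1))"
  shows "det (mat (2*a) (2*a) (\<lambda>(l,j). if j < a then x l ^ j else x l ^ (j - a) * coeff (g (x l)) s)) = 0"
    (is "det ?A = 0")
proof (cases "inj_on x {..<2*a}")
  case False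
  then obtain i j where ij: "i < 2*a" "j < 2*a" "i \<noteq> j" "x i = x j" by (auto simp: inj_on_def)
  show ?thesis using det_eq_0_if_repeated[OF ij(1,2,3), of x "\<lambda>j t. if j < a then t ^ j else t ^ (j - a) * coeff (g t) s"] ij(4)
    by simp
next
  case inj: True
  define M where "M = 2 * a"
  have X: "x l \<in> X" if "l < M" for l using x that by (simp add: M_def)
  have inj: "inj_on x {..<M}" using inj by (simp add: M_def)
  have dg: "dd_integral p x M (\<lambda>l. of_int_poly (g (x l)))"
  proof (rule dd_integral_factor[where h = "\<lambda>l. h (x l)" and lc = "\<lambda>l. poly lc (x l)" and n = k, OF p inj])
    have "dd_integral p x M (\<lambda>l. of_int_poly (eval_at (x l) f))"
      by (rule dd_integral_map_poly[OF p inj])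
    moreover have "pint p (ddiff x (\<lambda>l. of_int_poly (g (x l) * h (x l))) i n) \<longleftrightarrow>
      pint p (ddiff x (\<lambda>l. of_int_poly (eval_at (x l) f)) i n)" if "i + n < M" for i n
    proof -
      have "ddiff x (\<lambda>l. of_int_poly (g (x l) * h (x l))) i n = ddiff x (\<lambda>l. of_int_poly (eval_at (x l) f)) i n"
        using that
      proof (induction n arbitrary: i)
        case 0
        then show ?case using prod[OF X[of i]] by (simp del: of_int_poly_hom.hom_mult)
      qed simp
      then show ?thesis by simp
    qed
    ultimately show "dd_integral p x M (\<lambda>l. of_int_poly (g (x l) * h (x l)))"
      by (simp add: dd_integral_def)
    show "dd_integral p x M (\<lambda>l. [:of_int (poly lc (x l)):])" by (rule dd_integral_poly[OF p inj])
  qed (use X g k h_cong bez in auto)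
  define \<phi> :: "nat \<Rightarrow> nat \<Rightarrow> rat poly" where "\<phi> j l = (if j < a then [:of_int (poly (monom 1 j) (x l)):] * of_int_poly (monom 1 s)
      else [:of_int (poly (monom 1 (j - a)) (x l)):] * of_int_poly (g (x l)))" for j l
  have "p ^ (\<Sum>l<M. l) dvd det (mat M M (\<lambda>(l,j). if j < a then x l ^ j else x l ^ (j - a) * coeff (g (x l)) s))"
  proof (rule power_dvd_interpolation_det[OF p inj, where \<phi> = \<phi> and s = "\<lambda>_. s"])
    show "dd_integral p x M (\<phi> j)" for j
    proof (cases "j < a")
      case True
      then have "\<phi> j = (\<lambda>l. [:of_int (poly (monom 1 j) (x l)):] * of_int_poly (monom 1 s))"
        by (simp add: \<phi>_def fun_eq_iff)
      then show ?thesis by (simp only:) (intro dd_integral_mult dd_integral_poly dd_integral_const p inj)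
    next
      case False
      then have "\<phi> j = (\<lambda>l. [:of_int (poly (monom 1 (j - a)) (x l)):] * of_int_poly (g (x l)))"
        by (simp add: \<phi>_def fun_eq_iff)
      then show ?thesis by (simp only:) (intro dd_integral_mult dd_integral_poly dg p inj)
    qed
  qed (use cong X in \<open>auto simp: \<phi>_def poly_monom\<close>)
  then have dvd: "p ^ (a * (2 * a - 1)) dvd det ?A" by (simp add: M_def sum_lessThan_double)
  have "\<bar>det ?A\<bar> \<le> fact (2*a) * (\<Prod>j<2*a. if j < a then B ^ j else B ^ (j - a) * Y)"
  proof (rule abs_det_le)
    fix l j assume lj: "l < 2*a" "j < 2*a"
    have xl: "0 \<le> x l" "x l \<le> B" using B[OF x[OF lj(1)]] by auto
    then show "\<bar>?A $$ (l, j)\<bar> \<le> (if j < a then B ^ j else B ^ (j - a) * Y)"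
      using lj Y[OF x[OF lj(1)], of s] by (auto simp: abs_mult power_mono intro!: mult_mono)
  qed simp
  also have "(\<Prod>j<2*a. if j < a then B ^ j else B ^ (j - a) * Y) = B ^ (a * (a - 1)) * Y ^ a"
  proof -
    have "(\<Prod>j<a + b. if j < a then B ^ j else B ^ (j - a) * Y) = (\<Prod>j<a. B ^ j) * (\<Prod>j<b. B ^ j * Y)" for b
      by (induction b) auto
    from this[of a] have "(\<Prod>j<2*a. if j < a then B ^ j else B ^ (j - a) * Y) = (\<Prod>j<a. B ^ j) * (\<Prod>j<a. B ^ j * Y)"
      by (simp add: mult_2)
    also have "\<dots> = B ^ (2 * (\<Sum>j<a. j)) * Y ^ a"
      by (simp add: prod.distrib power_sum[symmetric] power_add mult_2)
    also have "2 * (\<Sum>j<a. j) = a * (a - 1)" by (induction a) (auto simp: algebra_simps)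
    finally show ?thesis .
  qed
  also have "fact (2*a) * (B ^ (a * (a - 1)) * Y ^ a) < p ^ (a * (2 * a - 1))" by (rule size)
  finally have "\<bar>det ?A\<bar> < p ^ (a * (2 * a - 1))" .
  then show ?thesis using dvd zdvd_imp_le[of "p ^ (a * (2 * a - 1))" "\<bar>det ?A\<bar>"] by fastforce
qed

text \<open>On X each lower coefficient of g is a quotient of two polynomials of degree below a.
  Clearing denominators gives one polynomial G, of smaller degree than R, whose value at t is a
  multiple of g. Then g divides the values at t of both lc R and G, hence the constant lc(t) r(t)
  with r the resultant of R and G. As g has positive degree, t is a root of r, and the degree of r
  is bounded.\<close>

lemma card_congruence_class_le:
  fixes R :: "int poly poly" and g h :: "int \<Rightarrow> int poly"
  defines "lc \<equiv> lead_coeff R"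
  assumes p: "prime p" and R: "irreducible R" and k: "0 < k" "k < degree R" and D: "\<And>i. degree (coeff R i) \<le> D"
    and fin: "finite X"
    and prod: "\<And>t. t \<in> X \<Longrightarrow> g t * h t = smult (poly lc t) (eval_at t R)"
    and g: "\<And>t. t \<in> X \<Longrightarrow> degree (g t) = k \<and> lead_coeff (g t) = poly lc t \<and> \<not> p dvd poly lc t"
    and cong: "\<And>t t'. t \<in> X \<Longrightarrow> t' \<in> X \<Longrightarrow> p dvd t - t'"
    and h_cong: "\<And>t t'. t \<in> X \<Longrightarrow> t' \<in> X \<Longrightarrow> \<exists>E. h t' = h t + smult p E"
    and bez: "\<And>t. t \<in> X \<Longrightarrow> \<exists>u v D. u * g t + v * h t = [:D:] \<and> \<not> p dvd D"
    and B: "\<And>t. t \<in> X \<Longrightarrow> 0 \<le> t \<and> t \<le> B" and Y: "\<And>t s. t \<in> X \<Longrightarrow> \<bar>coeff (g t) s\<bar> \<le> Y"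
    and a: "a \<ge> 1"
    and size: "fact (2 * a) * (B ^ (a * (a - 1)) * Y ^ a) < p ^ (a * (2 * a - 1))"
  shows "card X \<le> (D + degree R * a) * (2 * degree R) + degree R * a"
proof (cases "card X < a")
  case True
  have "1 * a \<le> degree R * a" using k by (intro mult_right_mono) auto
  then show ?thesis using True by linarith
next
  case False
  define n where "n = degree R"
  have rel: "\<exists>P Q. Q \<noteq> 0 \<and> degree P < a \<and> degree Q < a \<and> (\<forall>t\<in>X. poly P t + poly Q t * coeff (g t) s = 0)" for s
  proof -
    define f where "f j t = (if j < a then t ^ j else t ^ (j - a) * coeff (g t) s)" for j t
    have "\<exists>c. (\<exists>j<2*a. c j \<noteq> 0) \<and> (\<forall>t\<in>X. (\<Sum>j<2*a. c j * f j t) = 0)"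
    proof (rule all_minors_zero_imp_dependent)
      fix x assume x: "\<forall>l<2*a. x l \<in> X"
      show "det (mat (2*a) (2*a) (\<lambda>(l,j). f j (x l))) = 0" unfolding f_def
      proof (rule interpolation_det_eq_0[where f = "[:lc:] * R" and h = h, OF p])
        fix t assume "t \<in> X"
        then show "g t * h t = eval_at t ([:lc:] * R)"
          using prod[of t] unfolding eval_at_mult eval_at_const by simp
      qed (use x g k cong h_cong bez B Y size in auto)
    qed
    then obtain c where c: "\<exists>j<2*a. c j \<noteq> 0" "\<And>t. t \<in> X \<Longrightarrow> (\<Sum>j<2*a. c j * f j t) = 0" by blast
    define P where "P = (\<Sum>j<a. monom (c j) j)"
    define Q where "Q = (\<Sum>j<a. monom (c (a + j)) j)"
    have coeffs: "coeff P j = (if j < a then c j else 0)" "coeff Q j = (if j < a then c (a + j) else 0)" for j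
      by (auto simp: P_def Q_def coeff_sum)
    have deg: "degree P < a" "degree Q < a"
      using a by (auto simp: coeffs intro!: le_less_trans[OF degree_le[of "a - 1"]])
    have eval: "poly P t + poly Q t * coeff (g t) s = 0" if "t \<in> X" for t
    proof -
      have "(\<Sum>j<a + b. c j * f j t) = (\<Sum>j<a. c j * t ^ j) + (\<Sum>j<b. c (a + j) * t ^ j) * coeff (g t) s" for b
        by (induction b) (auto simp: f_def algebra_simps)
      from this[of a] have "(\<Sum>j<2*a. c j * f j t) = poly P t + poly Q t * coeff (g t) s"
        by (simp add: P_def Q_def poly_sum poly_monom mult_2)
      then show ?thesis using c(2)[OF that] by simp
    qed
    \<comment> \<open>Otherwise P, of degree below a, would vanish on all of X, which has at least a
      elements in this case.\<close>
    have "Q \<noteq> 0"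
    proof
      assume Q: "Q = 0"
      have "c (a + j) = 0" if "j < a" for j using coeffs(2)[of j] that Q by simp
      then have "c j = 0" if "a \<le> j" "j < 2 * a" for j using that
        by (metis add_diff_inverse_nat less_diff_conv2 mult_2 not_le)
      then obtain j where "j < a" "c j \<noteq> 0" using c(1) by (meson not_le)
      then have P: "P \<noteq> 0" using coeffs(1)[of j] by auto
      have "X \<subseteq> {t. poly P t = 0}" using eval Q by auto
      then have "card X \<le> degree P" using card_roots_le[OF P] card_mono order_trans by blast
      then show False using deg(1) False by simp
    qed
    then show ?thesis using deg eval by blast
  qed
  then obtain P Q where PQ: "\<And>s. Q s \<noteq> 0" "\<And>s. degree (P s) < a" "\<And>s. degree (Q s) < a"
    "\<And>s t. t \<in> X \<Longrightarrow> poly (P s) t + poly (Q s) t * coeff (g t) s = 0" by metis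
  define QQ where "QQ = (\<Prod>s<k. Q s)"
  \<comment> \<open>The leading coefficient of g is lc(t) itself, so only the k lower coefficients
    bring denominators, and G has degree exactly k.\<close>
  define G where "G = monom (lc * QQ) k - (\<Sum>s<k. monom (P s * (\<Prod>i\<in>{..<k}-{s}. Q i)) s)"
  have QQ: "QQ \<noteq> 0" using PQ(1) by (simp add: QQ_def)
  have lc0: "lc \<noteq> 0" using k by (auto simp: lc_def)
  have coeff_G: "coeff G s = (if s = k then lc * QQ else if s < k then - (P s * (\<Prod>i\<in>{..<k}-{s}. Q i)) else 0)" for s
    by (auto simp: G_def coeff_sum)
  have degG: "degree G = k"
    using QQ lc0 by (intro antisym degree_le le_degree) (auto simp: coeff_G)
  have dprod: "degree (\<Prod>i\<in>S. Q i) \<le> card S * a" if "finite S" for S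
    using degree_prod_sum_le[OF that, of Q] sum_bounded_above[of S "degree \<circ> Q" a] PQ(3)
    by (auto intro: order_trans less_imp_le simp: o_def)
  have dQQ: "degree QQ \<le> n * a"
    using dprod[of "{..<k}"] k unfolding QQ_def n_def by (auto intro: order_trans mult_right_mono)
  have dG: "degree (coeff G s) \<le> D + n * a" for s
  proof -
    have "degree (lc * QQ) \<le> D + n * a"
      using D[of "degree R"] dQQ by (auto simp: lc_def intro!: order_trans[OF degree_mult_le])
    moreover have "degree (P s * (\<Prod>i\<in>{..<k}-{s}. Q i)) \<le> D + n * a" if "s < k"
    proof -
      have "degree (P s * (\<Prod>i\<in>{..<k}-{s}. Q i)) \<le> a + (k - 1) * a"
        using PQ(2)[of s] dprod[of "{..<k}-{s}"] that by (intro order_trans[OF degree_mult_le]) (auto intro!: add_mono)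
      also have "\<dots> = k * a" using k by (cases k) auto
      also have "\<dots> \<le> n * a" using k by (auto simp: n_def)
      finally show ?thesis by simp
    qed
    ultimately show ?thesis by (auto simp: coeff_G)
  qed
  have ev_G: "eval_at t G = smult (poly QQ t) (g t)" if t: "t \<in> X" for t
  proof (rule poly_eqI)
    fix s
    show "coeff (eval_at t G) s = coeff (smult (poly QQ t) (g t)) s"
    proof (cases "s < k")
      case True
      have "QQ = Q s * (\<Prod>i\<in>{..<k}-{s}. Q i)" using True by (simp add: QQ_def prod.remove)
      moreover have "poly (P s) t = - (poly (Q s) t * coeff (g t) s)" using PQ(4)[OF t, of s] by simp
      ultimately show ?thesis using True by (simp add: coeff_map_poly coeff_G)
    next
      case False
      then show ?thesis using g[OF t] by (cases "s = k") (auto simp: coeff_map_poly coeff_G coeff_eq_0)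
    qed
  qed
  define r where "r = resultant R G"
  have "G \<noteq> 0" using degG k by auto
  then have r0: "r \<noteq> 0" unfolding r_def
    using resultant_irreducible_neq_0[OF R, of G] degG k by auto
  have "degree r \<le> (D + n * a) * (degree R + degree G)" unfolding r_def
    by (rule degree_resultant_le[OF trans_le_add1[OF D] dG])
  also have "\<dots> \<le> (D + n * a) * (2 * n)" using degG k by (intro mult_left_mono) (auto simp: n_def)
  finally have dr: "degree r \<le> (D + n * a) * (2 * n)" .
  obtain u v where uv: "u * R + v * G = [:r:]" using resultant_bezout[of R G] k by (auto simp: r_def)
  have "X \<subseteq> {t. poly r t = 0} \<union> {t. poly QQ t = 0}"
  proof
    fix t assume t: "t \<in> X"
    show "t \<in> {t. poly r t = 0} \<union> {t. poly QQ t = 0}"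
    proof -
      have "eval_at t u * eval_at t R + eval_at t v * eval_at t G = [:poly r t:]"
        using arg_cong[OF uv, of "eval_at t"] by (simp only: eval_at_add eval_at_mult eval_at_const)
      then have "smult (poly lc t) (eval_at t u * eval_at t R + eval_at t v * eval_at t G) = smult (poly lc t) [:poly r t:]"
        by simp
      then have "eval_at t u * (g t * h t) + smult (poly lc t * poly QQ t) (eval_at t v * g t) = [:poly lc t * poly r t:]"
        unfolding prod[OF t] ev_G[OF t] by (simp add: smult_add_right)
      then have eq: "g t * (eval_at t u * h t + smult (poly lc t * poly QQ t) (eval_at t v)) = [:poly lc t * poly r t:]"
        by (simp add: algebra_simps)
      define w where "w = eval_at t u * h t + smult (poly lc t * poly QQ t) (eval_at t v)"
      \<comment> \<open>A polynomial of positive degree divides a constant only if that constant is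
        0.\<close>
      have "w = 0"
      proof (rule ccontr)
        assume "w \<noteq> 0"
        moreover have "g t \<noteq> 0" using g[OF t] k by auto
        ultimately have "degree (g t * w) \<ge> k" using g[OF t] by (simp add: degree_mult_eq)
        then show False using eq k by (simp add: w_def)
      qed
      then have "poly lc t * poly r t = 0" using eq by (simp add: w_def)
      moreover have "poly lc t \<noteq> 0" using g[OF t] by auto
      ultimately show ?thesis by simp
    qed
  qed
  then have "card X \<le> card ({t. poly r t = 0} \<union> {t. poly QQ t = 0})"
    using card_roots_le[OF r0] card_roots_le[OF QQ] by (intro card_mono) auto
  also have "\<dots> \<le> degree r + degree QQ"
    using card_roots_le[OF r0] card_roots_le[OF QQ] card_Un_le[of "{t. poly r t = 0}" "{t. poly QQ t = 0}"] by linarith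
  finally show ?thesis using dr dQQ by (simp add: n_def)
qed

section \<open>Reducible specializations of bivariate polynomials\<close>

text \<open>After bounding the factorial by (2 a)^(2 a) and taking a-th roots, with a' = a - 1, it
  is enough that (2 a)^2 b^(4 a') Y < p (p^2)^a'. Now p^2 >= 16 b^4, and 16^a' splits into two
  factors 4^a': one covers (2 a)^2 <= 4 * 4^a', the other covers Y. The last 4 is at most p. This is
  the origin of the constant in \<open>4 * b\<^sup>2\<close>.\<close>

lemma interpolation_size:
  fixes p Y b :: int
  assumes p: "4 * b\<^sup>2 \<le> p" and b: "1 \<le> b" and a: "a \<ge> 1" and Y: "0 \<le> Y" "Y < 4 ^ (a - 1)"
  shows "fact (2 * a) * ((b ^ 4) ^ (a * (a - 1)) * Y ^ a) < p ^ (a * (2 * a - 1))"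
proof -
  obtain a' where a': "a = Suc a'" using a by (cases a) auto
  have p4: "4 \<le> p" using p b by (smt (verit) one_le_power)
  have "int a \<le> 2 ^ a'" unfolding a' by (induction a') auto
  then have "(int a)\<^sup>2 \<le> (2 ^ a')\<^sup>2" by (intro power_mono) auto
  also have "(2 ^ a')\<^sup>2 = (4::int) ^ a'" by (simp add: power2_eq_square power_mult_distrib[symmetric])
  finally have a2: "(2 * int a)\<^sup>2 \<le> 4 * 4 ^ a'" by (simp add: power_mult_distrib)
  have p2: "16 * b ^ 4 \<le> p\<^sup>2"
    using power_mono[OF p, of 2] by (simp add: power_mult_distrib flip: power_mult)
  have "(2 * int a)\<^sup>2 * (b ^ 4) ^ a' * Y \<le> (4 * 4 ^ a') * (b ^ 4) ^ a' * Y"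
    using a2 Y b by (intro mult_right_mono) auto
  also have "\<dots> < (4 * 4 ^ a') * (b ^ 4) ^ a' * 4 ^ a'"
    using Y b a' by (intro mult_strict_left_mono) auto
  also have "\<dots> = 4 * (16 * b ^ 4) ^ a'"
  proof -
    have "(16::int) ^ a' = 4 ^ a' * 4 ^ a'" by (simp add: power_mult_distrib[symmetric])
    then show ?thesis by (simp add: power_mult_distrib)
  qed
  also have "\<dots> \<le> p * (p\<^sup>2) ^ a'"
    using p4 p2 b by (intro mult_mono power_mono) auto
  also have "\<dots> = p ^ (2 * a - 1)" by (simp add: a' power_mult)
  finally have base: "(2 * int a)\<^sup>2 * (b ^ 4) ^ a' * Y < p ^ (2 * a - 1)" .
  have "(fact (2 * a) :: int) \<le> (2 * int a) ^ (2 * a)"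
    using fact_le_power[of "2 * a", where ?'a = int] by simp
  then have "fact (2 * a) * ((b ^ 4) ^ (a * (a - 1)) * Y ^ a) \<le> (2 * int a) ^ (2 * a) * ((b ^ 4) ^ (a * (a - 1)) * Y ^ a)"
    using Y b by (intro mult_right_mono) auto
  also have "\<dots> = ((2 * int a)\<^sup>2 * (b ^ 4) ^ a' * Y) ^ a"
  proof -
    have "(2 * int a) ^ (2 * a) = ((2 * int a)\<^sup>2) ^ a" by (rule power_mult)
    moreover have "(b ^ 4) ^ (a * (a - 1)) = ((b ^ 4) ^ a') ^ a"
      by (simp only: a' diff_Suc_1 mult.commute[of "Suc a'"] power_mult)
    ultimately show ?thesis by (simp only: power_mult_distrib mult.assoc)
  qed
  also have "\<dots> < (p ^ (2 * a - 1)) ^ a"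
    using base a Y b by (intro power_strict_mono) auto
  finally show ?thesis by (simp add: mult.commute flip: power_mult)
qed

lemma card_le_image_times_fibres:
  assumes "finite A" "card (f ` A) \<le> m" "\<And>y. y \<in> f ` A \<Longrightarrow> card {x\<in>A. f x = y} \<le> c"
  shows "card A \<le> m * c"
proof -
  have "A = (\<Union>y\<in>f ` A. {x\<in>A. f x = y})" by auto
  then have "card A \<le> (\<Sum>y\<in>f ` A. card {x\<in>A. f x = y})"
    using card_UN_le[of "f ` A" "\<lambda>y. {x\<in>A. f x = y}"] assms(1) by simp
  also have "\<dots> \<le> card (f ` A) * c" using sum_bounded_above[of "f ` A" _ c] assms(3) by auto
  finally show ?thesis using assms(2) by (meson le_trans mult_le_mono1)
qed

lemma diff_dvd_poly_diff: "t - t' dvd poly q t - poly q (t' :: 'a :: comm_ring_1)"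
proof (induction q)
  case (pCons a q)
  have "poly (pCons a q) t - poly (pCons a q) t' = t * (poly q t - poly q t') + (t - t') * poly q t'"
    by (simp add: algebra_simps)
  then show ?case using pCons.IH by (simp only:) (intro dvd_add dvd_mult dvd_triv_left)
qed simp

lemma eval_at_cong:
  assumes "p dvd t - t'" shows "\<exists>E. eval_at t R = eval_at t' R + smult p E"
proof -
  have "p dvd poly q t - poly q t'" for q
    using assms diff_dvd_poly_diff dvd_trans by blast
  then have *: "\<exists>e. poly q t - poly q t' = p * e" for q by (auto simp: dvd_def)
  then obtain e where e: "\<And>q. poly q t - poly q t' = p * e q" by metis
  have "eval_at t R = eval_at t' R + smult p (\<Sum>i\<le>degree R. monom (e (coeff R i)) i)"
  proof (rule poly_eqI)
    fix n
    show "coeff (eval_at t R) n = coeff (eval_at t' R + smult p (\<Sum>i\<le>degree R. monom (e (coeff R i)) i)) n"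
      using e[of "coeff R n"] by (auto simp: coeff_map_poly coeff_sum coeff_eq_0)
  qed
  then show ?thesis by blast
qed

text \<open>On one residue class R(t,.) and its leading coefficient are constant modulo p. Divided
  by that coefficient, h becomes a monic divisor of R(t0,.) modulo p, so
  \<open>card_monic_divisors\<close> applies.\<close>

lemma card_factors_mod_prime:
  fixes R :: "int poly poly" and g h :: "int \<Rightarrow> int poly"
  defines "lc \<equiv> lead_coeff R"
  assumes p: "prime p" and t0: "\<And>t. t \<in> X \<Longrightarrow> p dvd t - t0" "\<not> p dvd poly lc t0"
    and prod: "\<And>t. t \<in> X \<Longrightarrow> g t * h t = smult (poly lc t) (eval_at t R)"
    and h: "\<And>t. t \<in> X \<Longrightarrow> lead_coeff (h t) = poly lc t"
  shows "finite ((\<lambda>t. poly_mod.Mp p (h t)) ` X) \<and> card ((\<lambda>t. poly_mod.Mp p (h t)) ` X) \<le> 2 ^ degree R"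
proof -
  interpret poly_mod_prime p by standard (rule p)
  define f where "f = eval_at t0 R"
  have degf: "degree f \<le> degree R" unfolding f_def by (rule degree_map_poly_le)
  have "coeff f (degree R) = poly lc t0" by (simp add: f_def coeff_map_poly lc_def)
  moreover have "poly lc t0 \<noteq> 0" using t0(2) by auto
  ultimately have "degree f = degree R" using degf le_degree[of f "degree R"] by (intro antisym) auto
  then have lf: "\<not> p dvd lead_coeff f" using t0(2) by (simp add: f_def coeff_map_poly lc_def)
  obtain c where c: "M (c * poly lc t0) = 1" using inverse_mod_exists[OF t0(2)] by blast
  define Dv where "Dv = {g. monic g \<and> Mp g = g \<and> g dvdm f}"
  have Dv: "finite Dv" "card Dv \<le> 2 ^ degree f" using card_monic_divisors[OF lf] by (auto simp: Dv_def)
  have "(\<lambda>t. Mp (h t)) ` X \<subseteq> (\<lambda>m. Mp (smult (poly lc t0) m)) ` Dv"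
  proof
    fix y assume "y \<in> (\<lambda>t. Mp (h t)) ` X"
    then obtain t where t: "t \<in> X" "y = Mp (h t)" by blast
    have "M (poly lc t) = M (poly lc t0)"
    proof -
      have "p dvd poly lc t - poly lc t0" using t0(1)[OF t(1)] using diff_dvd_poly_diff dvd_trans by blast
      then show ?thesis by (simp add: M_def mod_eq_dvd_iff)
    qed
    then have ct: "M (c * poly lc t) = 1" using c by (metis M_times(2))
    define m where "m = Mp (smult c (h t))"
    have cm: "coeff m (degree (h t)) = 1" using ct h[OF t(1)] by (simp add: m_def Mp_coeff)
    have "degree m \<le> degree (h t)" unfolding m_def
      by (rule order_trans[OF degree_m_le degree_smult_le])
    then have "degree m = degree (h t)" using cm le_degree[of m "degree (h t)"] by (intro antisym) auto
    then have "monic m" using cm by simp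
    moreover have "m dvdm f"
    proof -
      obtain E where E: "eval_at t R = f + smult p E" using eval_at_cong[OF t0(1)[OF t(1)]] f_def by blast
      have "Mp f = Mp (f + smult p E)" by (metis Mp_smult_m_0 add.right_neutral plus_Mp(2))
      also have "\<dots> = Mp (smult (M (c * poly lc t)) (eval_at t R))" by (simp only: E ct smult_1_left)
      also have "\<dots> = Mp (smult c (smult (poly lc t) (eval_at t R)))" by simp
      also have "\<dots> = Mp (smult c (h t) * g t)" by (simp add: prod[OF t(1), symmetric] mult.commute)
      also have "\<dots> = Mp (m * g t)" by (simp add: m_def)
      finally show ?thesis unfolding dvdm_def by blast
    qed
    ultimately have "m \<in> Dv" by (auto simp: Dv_def m_def)
    moreover have "y = Mp (smult (poly lc t0) m)"
    proof -
      have "Mp (smult (poly lc t0) m) = Mp (smult (poly lc t0 * c) (h t))" by (simp add: m_def)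
      also have "\<dots> = Mp (smult (M (poly lc t0 * c)) (h t))" by simp
      finally show ?thesis using c t(2) by (simp add: mult.commute)
    qed
    ultimately show "y \<in> (\<lambda>m. Mp (smult (poly lc t0) m)) ` Dv" by blast
  qed
  note sub = this
  have *: "finite ((\<lambda>t. Mp (h t)) ` X)"
    by (rule finite_subset[OF sub finite_imageI[OF Dv(1)]])
  have "card ((\<lambda>t. Mp (h t)) ` X) \<le> card Dv"
    using card_mono[OF finite_imageI[OF Dv(1)] sub] card_image_le[OF Dv(1)] order_trans by blast
  with * show ?thesis using Dv(2) \<open>degree f = degree R\<close> by simp
qed

lemma card_good_prime_le:
  fixes R :: "int poly poly" and g h :: "int \<Rightarrow> int poly"
  defines "lc \<equiv> lead_coeff R" and "n \<equiv> degree R"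
  assumes p: "prime p" "4 * b\<^sup>2 \<le> p" "1 \<le> b" and R: "irreducible R" and D: "\<And>i. degree (coeff R i) \<le> D"
    and X: "X \<subseteq> {0..b ^ 4}"
    and prod: "\<And>t. t \<in> X \<Longrightarrow> g t * h t = smult (poly lc t) (eval_at t R)"
    and g: "\<And>t. t \<in> X \<Longrightarrow> 0 < degree (g t) \<and> degree (g t) < n \<and> lead_coeff (g t) = poly lc t"
    and h: "\<And>t. t \<in> X \<Longrightarrow> lead_coeff (h t) = poly lc t"
    and lc: "\<And>t. t \<in> X \<Longrightarrow> \<not> p dvd poly lc t"
    and bez: "\<And>t. t \<in> X \<Longrightarrow> \<exists>u v D. u * g t + v * h t = [:D:] \<and> \<not> p dvd D"
    and Y: "\<And>t s. t \<in> X \<Longrightarrow> \<bar>coeff (g t) s\<bar> \<le> Y" "0 \<le> Y" "Y < 4 ^ (a - 1)" and a: "a \<ge> 1"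
  shows "card X \<le> (nat p * (n * 2 ^ n)) * ((D + n * a) * (2 * n) + n * a)"
proof -
  interpret poly_mod_prime p by standard (rule p)
  have fin: "finite X" using X by (rule finite_subset) auto
  \<comment> \<open>The fibres of f are the sets to which \<open>card_congruence_class_le\<close>
    applies: there are p residues, fewer than n degrees and, in each residue class, at most 2^n
    reductions of h.\<close>
  define f where "f t = (t mod p, degree (g t), Mp (h t))" for t
  define H where "H r = (\<lambda>t. Mp (h t)) ` {t\<in>X. t mod p = r}" for r
  have H: "finite (H r)" "card (H r) \<le> 2 ^ n" for r
  proof -
    have "finite (H r) \<and> card (H r) \<le> 2 ^ n"
    proof (cases "\<exists>t0\<in>X. t0 mod p = r")
      case True
      then obtain t0 where t0: "t0 \<in> X" "t0 mod p = r" by blast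
      show ?thesis unfolding H_def n_def
      proof (rule card_factors_mod_prime[OF p(1), where ?t0.0 = t0 and g = g])
        show "p dvd t - t0" if "t \<in> {t\<in>X. t mod p = r}" for t
          using that t0 by (auto simp: mod_eq_dvd_iff)
      qed (use lc[OF t0(1)] prod h in \<open>auto simp: lc_def\<close>)
    next
      case False
      then have "H r = {}" by (auto simp: H_def)
      then show ?thesis by simp
    qed
    then show "finite (H r)" "card (H r) \<le> 2 ^ n" by auto
  qed
  have p0: "p > 0" using m1 by simp
  show ?thesis
  proof (rule card_le_image_times_fibres[OF fin, of f])
    have sub: "f ` X \<subseteq> Sigma {0..<p} (\<lambda>r. {..<n} \<times> H r)"
      using g p0 by (auto simp: f_def H_def)
    have "card (f ` X) \<le> card (Sigma {0..<p} (\<lambda>r. {..<n} \<times> H r))"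
      using H by (intro card_mono sub) auto
    also have "\<dots> = (\<Sum>r\<in>{0..<p}. n * card (H r))"
      using H by (subst card_SigmaI) (auto simp: card_cartesian_product)
    also have "\<dots> \<le> (\<Sum>r\<in>{0..<p}. n * 2 ^ n)" using H by (intro sum_mono mult_left_mono) auto
    finally show "card (f ` X) \<le> nat p * (n * 2 ^ n)" by simp
  next
    fix y assume "y \<in> f ` X"
    then obtain t0 where t0: "t0 \<in> X" "y = f t0" by blast
    define Z where "Z = {x\<in>X. f x = y}"
    show "card {x\<in>X. f x = y} \<le> (D + n * a) * (2 * n) + n * a"
      unfolding Z_def[symmetric] n_def
    proof (rule card_congruence_class_le[OF p(1) R, where k = "degree (g t0)" and g = g and h = h and B = "b ^ 4" and Y = Y])
      show "0 < degree (g t0)" "degree (g t0) < degree R" using g[OF t0(1)] by (auto simp: n_def)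
      show "finite Z" using fin by (simp add: Z_def)
      show "fact (2 * a) * ((b ^ 4) ^ (a * (a - 1)) * Y ^ a) < p ^ (a * (2 * a - 1))"
        by (rule interpolation_size[OF p(2,3) a Y(2,3)])
      fix t assume t: "t \<in> Z"
      then have tX: "t \<in> X" "f t = f t0" using t0 by (auto simp: Z_def)
      show "degree (g t) = degree (g t0) \<and> lead_coeff (g t) = poly (lead_coeff R) t \<and> \<not> p dvd poly (lead_coeff R) t"
        using g[OF tX(1)] lc[OF tX(1)] tX(2) by (auto simp: f_def lc_def)
      show "0 \<le> t \<and> t \<le> b ^ 4" using tX X by auto
      fix t' assume t': "t' \<in> Z"
      then have t'X: "t' \<in> X" "f t' = f t0" using t0 by (auto simp: Z_def)
      have "t mod p = t' mod p" using tX(2) t'X(2) by (simp add: f_def)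
      then show "p dvd t - t'" by (simp add: mod_eq_dvd_iff)
      have "Mp (h t' - h t) = 0" using tX(2) t'X(2) by (simp add: f_def Mp_uminus_diff_eq_0_iff)
      then obtain E where "h t' - h t = smult p E" using Mp_eq_0_iff by blast
      then show "\<exists>E. h t' = h t + smult p E" by (intro exI[of _ E]) (simp add: algebra_simps)
    qed (use D prod bez Y(1) a in \<open>auto simp: Z_def lc_def\<close>)
  qed
qed

lemma one_le_mult: "1 \<le> x \<Longrightarrow> 1 \<le> y \<Longrightarrow> 1 \<le> x * (y :: 'a :: linordered_idom)"
  using mult_mono[of 1 x 1 y] by simp

text \<open>Mignotte's bound. The Mahler measure of a divisor is at most that of f, and by Landau's
  inequality this is at most the Euclidean norm of f, estimated crudely by (n + 1) e.\<close>

lemma factor_coeff_bound: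
  fixes f g :: "int poly"
  assumes f: "f \<noteq> 0" and g: "g dvd f" and n: "degree f \<le> n" and e: "\<And>s. \<bar>coeff f s\<bar> \<le> e"
  shows "\<bar>coeff g s\<bar> \<le> 2 ^ n * (int n + 1) * e"
proof -
  have e0: "0 \<le> e" using e[of 0] by linarith
  have gn: "degree g \<le> n" using dvd_imp_degree_le[OF g f] n by simp
  have "(\<Sum>a\<leftarrow>xs. a * a) \<le> int (length xs) * (e * e)" if "\<And>a. a \<in> set xs \<Longrightarrow> \<bar>a\<bar> \<le> e" for xs
    using that
  proof (induction xs)
    case (Cons a xs)
    have "\<bar>a\<bar> * \<bar>a\<bar> \<le> e * e" using Cons.prems[of a] e0 by (intro mult_mono) auto
    then have "a * a \<le> e * e" by simp
    then show ?case using Cons by (simp add: algebra_simps)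
  qed simp
  moreover have "\<bar>a\<bar> \<le> e" if "a \<in> set (coeffs f)" for a
  proof -
    have "a \<in> range (coeff f)" using that range_coeff[of f] by simp
    then show ?thesis using e by auto
  qed
  ultimately have "(\<Sum>a\<leftarrow>coeffs f. a * a) \<le> int (length (coeffs f)) * (e * e)" by blast
  also have "\<dots> \<le> (int n + 1) * (e * e)"
    using n f e0 by (intro mult_right_mono) (auto simp: length_coeffs)
  also have "\<dots> \<le> ((int n + 1) * e)\<^sup>2"
    using mult_right_mono[of 1 "int n + 1" "(int n + 1) * (e * e)"] e0 by (simp add: power2_eq_square mult_ac)
  finally have "real_of_int (\<Sum>a\<leftarrow>coeffs f. a * a) \<le> (real_of_int ((int n + 1) * e))\<^sup>2"
    by (metis of_int_le_iff of_int_power)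
  then have "sqrt (real_of_int (\<Sum>a\<leftarrow>coeffs f. a * a)) \<le> real_of_int ((int n + 1) * e)"
    using e0 by (intro real_le_lsqrt) auto
  then have "mahler_measure g \<le> real_of_int ((int n + 1) * e)"
    using mahler_measure_dvd[OF f g] Landau_inequality_mahler_measure[of f] by linarith
  moreover have "real (degree g choose s) \<le> 2 ^ n"
  proof -
    have "degree g choose s \<le> 2 ^ degree g" by (rule binomial_le_pow2)
    also have "\<dots> \<le> 2 ^ n" using gn by (intro power_increasing) auto
    finally have "real (degree g choose s) \<le> real (2 ^ n)" unfolding of_nat_le_iff .
    then show ?thesis by simp
  qed
  ultimately have "real (degree g choose s) * mahler_measure g \<le> 2 ^ n * real_of_int ((int n + 1) * e)"
    using mahler_measure_ge_0[of g] by (intro mult_mono) auto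
  then have "real_of_int \<bar>coeff g s\<bar> \<le> real_of_int (2 ^ n * (int n + 1) * e)"
    using Mignotte_bound[of g s] by (simp add: mult.assoc)
  then show ?thesis unfolding of_int_le_iff .
qed

lemma abs_resultant_pderiv_le:
  fixes f :: "int poly"
  assumes e: "\<And>s. \<bar>coeff f s\<bar> \<le> e" "1 \<le> e" and n: "degree f = n" "1 \<le> n"
  shows "\<bar>resultant f (pderiv f)\<bar> \<le> fact (2 * n) * (int n * e) ^ (2 * n)"
proof -
  define m where "m = degree f + degree (pderiv f)"
  have m: "m \<le> 2 * n" using n by (simp add: m_def degree_pderiv)
  have ne: "1 \<le> int n * e" using n e(2) by (intro one_le_mult) auto
  have pd: "\<bar>coeff (pderiv f) s\<bar> \<le> int n * e" for s
  proof (cases "Suc s \<le> n")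
    case True
    then show ?thesis using e(1)[of "Suc s"]
      by (auto simp: coeff_pderiv abs_mult simp del: of_nat_Suc intro!: mult_mono)
  next
    case False
    then have "coeff f (Suc s) = 0" using n by (intro coeff_eq_0) auto
    then show ?thesis using ne by (simp add: coeff_pderiv)
  qed
  have fe: "\<bar>coeff f s\<bar> \<le> int n * e" for s
    using e(1)[of s] mult_right_mono[of 1 "int n" e] e(2) n by linarith
  have "\<bar>resultant f (pderiv f)\<bar> \<le> fact m * (\<Prod>j<m. int n * e)"
    unfolding resultant_def m_def
    by (rule abs_det_le[OF sylvester_carrier_mat])
      (use pd fe ne in \<open>auto simp: sylvester_index_mat intro: order_trans[of 0 1]\<close>)
  also have "\<dots> = fact m * (int n * e) ^ m" by simp
  also have "\<dots> \<le> fact (2 * n) * (int n * e) ^ (2 * n)"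
    using m ne by (intro mult_mono fact_mono power_increasing) auto
  finally show ?thesis .
qed

text \<open>Away from the roots of lc and of the discriminant \<Delta>, some prime of P does not
  divide lc(t) \<Delta>(t): this nonzero number is smaller than \<open>2 ^ card P\<close>, hence
  than the product of P. The main term is the sum over P of the bounds of
  \<open>card_good_prime_le\<close>.\<close>

lemma card_reducible_specializations_aux:
  fixes R :: "int poly poly" and e :: int
  defines "n \<equiv> degree R"
  assumes R: "irreducible R" "1 \<le> degree R" and D: "\<And>i. degree (coeff R i) \<le> D"
    and e: "1 \<le> e" and b: "1 \<le> b"
    and X: "X \<subseteq> {0..int b ^ 4}"
    and X_bound: "\<And>t s. t \<in> X \<Longrightarrow> \<bar>coeff (eval_at t R) s\<bar> \<le> e"
    and X_red: "\<And>t. t \<in> X \<Longrightarrow> \<not> irreducible\<^sub>d (eval_at t R)"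
    and P: "finite P" "\<And>p. p \<in> P \<Longrightarrow> prime p \<and> 4 * b\<^sup>2 \<le> p \<and> p \<le> b ^ 3"
      "e * (fact (2 * n) * (int n * e) ^ (2 * n)) < 2 ^ card P"
    and a: "1 \<le> a" "2 ^ n * (int n + 1) * e\<^sup>2 < 4 ^ (a - 1)"
  shows "card X \<le> D + 2 * n * D + card P * (b ^ 3 * (n * 2 ^ n) * ((D + n * a) * (2 * n) + n * a))"
proof -
  define lc where "lc = lead_coeff R"
  define \<Delta> where "\<Delta> = resultant R (pderiv R)"
  have lc0: "lc \<noteq> 0" using R(2) by (auto simp: lc_def)
  have "pderiv R \<noteq> 0" using R(2) by (auto simp: pderiv_eq_0_iff)
  then have \<Delta>0: "\<Delta> \<noteq> 0" unfolding \<Delta>_def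
    using R by (intro resultant_irreducible_neq_0) (auto simp: degree_pderiv)
  have "degree (of_nat k * q :: int poly) \<le> degree q" for k q
    using degree_mult_le[of "of_nat k" q] by simp
  then have "degree (coeff (pderiv R) i) \<le> D" for i
    unfolding coeff_pderiv using D[of "Suc i"] order_trans by blast
  then have "degree \<Delta> \<le> D * (degree R + degree (pderiv R))"
    unfolding \<Delta>_def using D by (intro degree_resultant_le) auto
  also have "\<dots> \<le> D * (2 * n)" by (intro mult_left_mono) (auto simp: n_def degree_pderiv)
  finally have deg\<Delta>: "degree \<Delta> \<le> 2 * n * D" by (simp add: mult_ac)
  define X' where "X' = {t\<in>X. poly lc t \<noteq> 0 \<and> poly \<Delta> t \<noteq> 0}"
  have finX: "finite X" using X by (rule finite_subset) auto
  define good where "good t g h \<longleftrightarrow> g * h = smult (poly lc t) (eval_at t R) \<and> 0 < degree g \<and> degree g < n \<and> lead_coeff g = poly lc t \<and>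
     lead_coeff h = poly lc t \<and> (\<forall>s. \<bar>coeff g s\<bar> \<le> 2 ^ n * (int n + 1) * e\<^sup>2) \<and>
     (\<exists>u v. u * g + v * h = [:poly lc t * poly \<Delta> t:])" for t g h
  have ex: "\<exists>gh. good t (fst gh) (snd gh)" if t: "t \<in> X'" for t
  proof -
    have tX: "t \<in> X" "poly lc t \<noteq> 0" using t by (auto simp: X'_def)
    define f where "f = eval_at t R"
    have cf: "coeff f n = poly lc t" by (simp add: f_def coeff_map_poly lc_def n_def)
    have "degree f \<le> n" unfolding f_def n_def by (rule degree_map_poly_le)
    then have degf: "degree f = n" using cf tX(2) le_degree[of f n] by (intro antisym) auto
    then have f0: "f \<noteq> 0" using R(2) by (auto simp: n_def)
    obtain g0 h0 where gh: "f = g0 * h0" "degree g0 < n" "degree h0 < n"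
      using X_red[OF tX(1)] degf R(2) unfolding irreducible\<^sub>d_def f_def n_def by auto
    have gh0: "g0 \<noteq> 0" "h0 \<noteq> 0" using f0 gh by auto
    have dsum: "degree g0 + degree h0 = n" using degf gh gh0 by (simp add: degree_mult_eq)
    have lead: "lead_coeff g0 * lead_coeff h0 = poly lc t"
    proof -
      have "lead_coeff f = poly lc t" using cf degf by simp
      then show ?thesis unfolding gh(1) lead_coeff_mult .
    qed
    \<comment> \<open>The leading coefficients of g0 and h0 vary erratically with t. Scaled in this
      way both factors have the leading coefficient lc(t), a polynomial in t; the price is the
      factor lc(t) in their product.\<close>
    define g where "g = smult (lead_coeff h0) g0"
    define h where "h = smult (lead_coeff g0) h0"
    have ghf: "g * h = smult (poly lc t) f" using lead gh(1) by (simp add: g_def h_def mult.commute)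
    have lg: "lead_coeff g = poly lc t" "lead_coeff h = poly lc t" using lead gh0 by (simp_all add: g_def h_def mult.commute)
    have degg: "0 < degree g" "degree g < n" using gh0 gh dsum by (auto simp: g_def)
    have fe: "\<bar>coeff f s\<bar> \<le> e" for s using X_bound[OF tX(1)] by (simp add: f_def)
    have "\<bar>coeff g s\<bar> \<le> 2 ^ n * (int n + 1) * e\<^sup>2" for s
    proof -
      have "\<bar>lead_coeff h0\<bar> * 1 \<le> \<bar>lead_coeff h0\<bar> * \<bar>lead_coeff g0\<bar>"
        using gh0 by (intro mult_left_mono) (auto simp: Suc_leI int_one_le_iff_zero_less)
      also have "\<dots> = \<bar>poly lc t\<bar>" by (simp add: lead[symmetric] abs_mult mult.commute)
      also have "\<dots> \<le> e" using fe[of n] cf by simp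
      finally have 1: "\<bar>lead_coeff h0\<bar> \<le> e" by simp
      have 2: "\<bar>coeff g0 s\<bar> \<le> 2 ^ n * (int n + 1) * e"
        by (rule factor_coeff_bound[OF f0 _ _ fe]) (use gh degf in auto)
      have "\<bar>coeff g s\<bar> \<le> e * (2 ^ n * (int n + 1) * e)"
        unfolding g_def using 1 2 e by (auto simp: abs_mult intro!: mult_mono)
      then show ?thesis by (simp add: power2_eq_square mult_ac)
    qed
    moreover have "\<exists>u v. u * g + v * h = [:poly lc t * poly \<Delta> t:]"
    proof -
      \<comment> \<open>Specialized, this reads A f + B f' = \<Delta>(t). Multiplied by lc(t) and
        with the derivative of g h expanded, it becomes a combination of g and h, so the
        discriminant controls coprimality of every factorisation at once.\<close>
      obtain A B where "A * R + B * pderiv R = [:\<Delta>:]"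
        using resultant_bezout[of R "pderiv R"] R(2) unfolding \<Delta>_def by auto
      then have "eval_at t A * f + eval_at t B * pderiv f = [:poly \<Delta> t:]"
        unfolding f_def by (metis eval_at_add eval_at_mult eval_at_const eval_at_pderiv)
      then have "smult (poly lc t) (eval_at t A * f + eval_at t B * pderiv f) = smult (poly lc t) [:poly \<Delta> t:]" by simp
      then have "eval_at t A * smult (poly lc t) f + eval_at t B * pderiv (smult (poly lc t) f) = [:poly lc t * poly \<Delta> t:]"
        by (simp add: smult_add_right pderiv_smult)
      then have "(eval_at t A * h + eval_at t B * pderiv h) * g + (eval_at t B * pderiv g) * h = [:poly lc t * poly \<Delta> t:]"
        unfolding ghf[symmetric] pderiv_mult by (simp add: algebra_simps)
      then show ?thesis by blast
    qed
    ultimately have "good t g h" using ghf lg degg unfolding f_def good_def by blast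
    then show ?thesis by (intro exI[of _ "(g, h)"]) simp
  qed
  define g where "g t = fst (SOME gh. good t (fst gh) (snd gh))" for t
  define h where "h t = snd (SOME gh. good t (fst gh) (snd gh))" for t
  have good: "good t (g t) (h t)" if "t \<in> X'" for t
    using someI_ex[OF ex[OF that]] by (simp add: g_def h_def)
  have gh: "\<And>t. t \<in> X' \<Longrightarrow> g t * h t = smult (poly lc t) (eval_at t R)"
    "\<And>t. t \<in> X' \<Longrightarrow> 0 < degree (g t) \<and> degree (g t) < n \<and> lead_coeff (g t) = poly lc t"
    "\<And>t. t \<in> X' \<Longrightarrow> lead_coeff (h t) = poly lc t"
    "\<And>t s. t \<in> X' \<Longrightarrow> \<bar>coeff (g t) s\<bar> \<le> 2 ^ n * (int n + 1) * e\<^sup>2"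
    "\<And>t. t \<in> X' \<Longrightarrow> \<exists>u v. u * g t + v * h t = [:poly lc t * poly \<Delta> t:]"
    using good unfolding good_def by blast+
  define Xp where "Xp p = {t\<in>X'. \<not> int p dvd poly lc t * poly \<Delta> t}" for p :: nat
  have cover: "X' \<subseteq> (\<Union>p\<in>P. Xp p)"
  proof
    fix t assume t: "t \<in> X'"
    define w where "w = poly lc t * poly \<Delta> t"
    have w0: "w \<noteq> 0" using t by (simp add: w_def X'_def)
    have tX: "t \<in> X" "poly lc t \<noteq> 0" using t by (auto simp: X'_def)
    define f where "f = eval_at t R"
    have cf: "coeff f n = poly lc t" by (simp add: f_def coeff_map_poly lc_def n_def)
    have "degree f \<le> n" unfolding f_def n_def by (rule degree_map_poly_le)
    then have degf: "degree f = n" using cf tX(2) le_degree[of f n] by (intro antisym) auto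
    have fe: "\<bar>coeff f s\<bar> \<le> e" for s using X_bound[OF tX(1)] by (simp add: f_def)
    \<comment> \<open>Evaluation at t commutes with the resultant, as lc(t) is nonzero and both
      degrees are preserved.\<close>
    have "poly \<Delta> t = resultant f (pderiv f)"
    proof -
      have "degree (eval_at t (pderiv R)) = degree (pderiv R)"
        using degf by (simp add: eval_at_pderiv degree_pderiv f_def[symmetric] n_def)
      then have "resultant (eval_at t R) (eval_at t (pderiv R)) = poly (resultant R (pderiv R)) t"
        using degf by (intro poly_hom.resultant_map_poly) (auto simp: f_def n_def)
      then show ?thesis by (simp add: \<Delta>_def eval_at_pderiv f_def)
    qed
    then have "\<bar>poly \<Delta> t\<bar> \<le> fact (2 * n) * (int n * e) ^ (2 * n)"
      using abs_resultant_pderiv_le[OF fe e degf] R(2) by (simp add: n_def)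
    moreover have "\<bar>poly lc t\<bar> \<le> e" using fe[of n] cf by simp
    ultimately have "\<bar>w\<bar> \<le> e * (fact (2 * n) * (int n * e) ^ (2 * n))"
      unfolding w_def abs_mult using e by (intro mult_mono) auto
    then have small: "\<bar>w\<bar> < 2 ^ card P" using P(3) by linarith
    show "t \<in> (\<Union>p\<in>P. Xp p)"
    proof (rule ccontr)
      assume "t \<notin> (\<Union>p\<in>P. Xp p)"
      then have dv: "int p dvd w" if "p \<in> P" for p using that t by (auto simp: Xp_def w_def)
      have "(\<Prod>p\<in>P. int p) dvd w"
        using P(1,2) dv
      proof (induction P rule: finite_induct)
        case (insert q F)
        have "Rings.coprime (int q) (\<Prod>p\<in>F. int p)"
        proof (rule prod_coprime_right)
          fix p assume "p \<in> F"
          then have "prime p" "prime q" "p \<noteq> q" using insert by auto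
          then show "Rings.coprime (int q) (int p)" by (simp add: primes_coprime)
        qed
        then show ?case using insert by (simp add: divides_mult)
      qed simp
      then have "(\<Prod>p\<in>P. int p) \<le> \<bar>w\<bar>" using w0 by (intro zdvd_imp_le) auto
      moreover have "(\<Prod>p\<in>P. 2) \<le> (\<Prod>p\<in>P. int p)"
        using P(2) by (intro prod_mono) (auto dest: prime_ge_2_nat)
      ultimately show False using small by simp
    qed
  qed
  have card_Xp: "card (Xp p) \<le> b ^ 3 * (n * 2 ^ n) * ((D + n * a) * (2 * n) + n * a)" if p: "p \<in> P" for p
  proof -
    have "card (Xp p) \<le> (nat (int p) * (n * 2 ^ n)) * ((D + n * a) * (2 * n) + n * a)"
      unfolding n_def
    proof (rule card_good_prime_le[where g = g and h = h and Y = "2 ^ n * (int n + 1) * e\<^sup>2" and b = "int b"])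
      have "4 * b\<^sup>2 \<le> p" using P(2)[OF p] by blast
      then have "int (4 * b\<^sup>2) \<le> int p" unfolding of_nat_le_iff .
      then show "4 * (int b)\<^sup>2 \<le> int p" by simp
      show "prime (int p)" using P(2)[OF p] by simp
      show "1 \<le> int b" using b by simp
      show "Xp p \<subseteq> {0..int b ^ 4}" using X by (auto simp: Xp_def X'_def)
      show "\<not> int p dvd poly (lead_coeff R) t" if "t \<in> Xp p" for t
        using that by (auto simp: Xp_def lc_def[symmetric])
      show "\<exists>u v D. u * g t + v * h t = [:D:] \<and> \<not> int p dvd D" if "t \<in> Xp p" for t
        using that gh(5)[of t] unfolding Xp_def by blast
    qed (use R(1) D gh(1-4) a e in \<open>auto simp: Xp_def lc_def n_def\<close>)
    also have "\<dots> \<le> b ^ 3 * (n * 2 ^ n) * ((D + n * a) * (2 * n) + n * a)"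
      using P(2)[OF p] by (intro mult_right_mono) auto
    finally show ?thesis .
  qed
  have "X \<subseteq> {t. poly lc t = 0} \<union> {t. poly \<Delta> t = 0} \<union> X'" by (auto simp: X'_def)
  then have "card X \<le> card ({t. poly lc t = 0} \<union> {t. poly \<Delta> t = 0} \<union> X')"
    using card_roots_le[OF lc0] card_roots_le[OF \<Delta>0] finX by (intro card_mono) (auto simp: X'_def)
  also have "\<dots> \<le> card {t. poly lc t = 0} + card {t. poly \<Delta> t = 0} + card X'"
    by (meson card_Un_le add_le_mono order_refl order_trans)
  also have "\<dots> \<le> D + 2 * n * D + card X'"
    using card_roots_le[OF lc0] card_roots_le[OF \<Delta>0] deg\<Delta> D[of "degree R"] by (auto simp: lc_def)
  finally have 1: "card X \<le> D + 2 * n * D + card X'" .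
  have "card X' \<le> card (\<Union>p\<in>P. Xp p)"
    using P(1) finX by (intro card_mono cover) (auto simp: Xp_def X'_def)
  also have "\<dots> \<le> (\<Sum>p\<in>P. card (Xp p))" by (rule card_UN_le[OF P(1)])
  also have "\<dots> \<le> card P * (b ^ 3 * (n * 2 ^ n) * ((D + n * a) * (2 * n) + n * a))"
    using sum_bounded_above[of P "\<lambda>p. card (Xp p)"] card_Xp by auto
  finally show ?thesis using 1 by linarith
qed

text \<open>K is the logarithm of A e^k to base 2, rounded up with a margin. It serves twice: for
  the number of primes and for the size of the determinants.\<close>

lemma exists_power_of_2_greater:
  fixes A :: int
  assumes A: "1 \<le> A"
  shows "\<exists>c>0. \<forall>e::int. 1 \<le> e \<longrightarrow> (\<exists>K. A * e ^ k < 2 ^ K \<and> real K \<le> c * (1 + ln e))"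
proof -
  define c where "c = (ln (real_of_int A) + real k) / ln 2 + 2"
  have lA: "ln (real_of_int A) \<ge> 0" using A by simp
  have *: "(ln (real_of_int A) + real k) / ln 2 \<ge> 0" using lA by simp
  have "\<exists>K. A * e ^ k < 2 ^ K \<and> real K \<le> c * (1 + ln e)" if e: "1 \<le> e" for e :: int
  proof -
  define z where "z = real_of_int (A * e ^ k)"
  have z1: "z \<ge> 1" using A e unfolding z_def of_int_mult of_int_power
    by (intro one_le_mult one_le_power) auto
  define K where "K = nat \<lceil>log 2 z\<rceil> + 1"
  have l0: "log 2 z \<ge> 0" using z1 by simp
  have K: "log 2 z < real K" "real K \<le> log 2 z + 2" unfolding K_def using l0 by linarith+
  have "z < 2 powr real K" using K(1) z1 by (simp add: log_less_iff)
  then have "z < 2 ^ K" by (simp add: powr_realpow)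
  then have "real_of_int (A * e ^ k) < real_of_int (2 ^ K)" by (simp add: z_def)
  then have 1: "A * e ^ k < 2 ^ K" unfolding of_int_less_iff .
  have le: "ln (real_of_int e) \<ge> 0" using e by simp
  have "log 2 z = (ln (real_of_int A) + real k * ln (real_of_int e)) / ln 2"
    using A e by (simp add: z_def log_def ln_mult ln_realpow)
  also have "\<dots> \<le> ((ln (real_of_int A) + real k) * (1 + ln (real_of_int e))) / ln 2"
    using lA le by (intro divide_right_mono) (auto simp: algebra_simps)
  finally have "real K \<le> ((ln (real_of_int A) + real k) / ln 2) * (1 + ln (real_of_int e)) + 2 * 1"
    using K(2) by simp
  also have "\<dots> \<le> ((ln (real_of_int A) + real k) / ln 2) * (1 + ln (real_of_int e)) + 2 * (1 + ln (real_of_int e))"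
    using le by (intro add_left_mono mult_left_mono) auto
  also have "\<dots> = c * (1 + ln (real_of_int e))" by (simp add: c_def algebra_simps)
  finally show "\<exists>K. A * e ^ k < 2 ^ K \<and> real K \<le> c * (1 + ln e)" using 1 by blast
  qed
  moreover have "c > 0" using * unfolding c_def by linarith
  ultimately show ?thesis by blast
qed

text \<open>The number of primes and the determinant size a are both O(1 + ln e), whence the square.
  If b is too small for the window to hold enough primes, then b is itself O((1 + ln e)^2), and
  counting all of \<open>{0..int b ^ 4}\<close> is good enough.\<close>

theorem card_reducible_specializations:
  shows "\<exists>c>0. \<forall>(R::int poly poly) (e::int) (b::nat) X. irreducible R \<longrightarrow> 1 \<le> degree R \<longrightarrow> degree R \<le> n \<longrightarrow>
    (\<forall>i. degree (coeff R i) \<le> D) \<longrightarrow> 1 \<le> e \<longrightarrow> 1 \<le> b \<longrightarrow> X \<subseteq> {0..int b ^ 4} \<longrightarrow>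
    (\<forall>t\<in>X. (\<forall>s. \<bar>coeff (eval_at t R) s\<bar> \<le> e) \<and> \<not> irreducible\<^sub>d (eval_at t R)) \<longrightarrow>
    real (card X) \<le> c * (1 + ln (real_of_int e))\<^sup>2 * real b ^ 3"
proof -
  obtain b0 where b0: "\<And>b. b \<ge> b0 \<Longrightarrow> b\<^sup>2 \<le> card {p::nat. prime p \<and> 4 * b\<^sup>2 \<le> p \<and> p \<le> b ^ 3}"
    using eventually_many_primes unfolding eventually_at_top_linorder by blast
  have "1 \<le> fact (2 * n) * max 1 (int n) ^ (2 * n)" "1 \<le> 2 ^ n * (int n + 1)"
    by (intro one_le_mult one_le_power; simp add: fact_ge_1)+
  note A = this
  obtain c1 where c1: "c1 > 0" "\<And>e::int. 1 \<le> e \<Longrightarrow>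
      \<exists>K. (fact (2 * n) * max 1 (int n) ^ (2 * n)) * e ^ (2 * n + 1) < 2 ^ K \<and> real K \<le> c1 * (1 + ln e)"
    using exists_power_of_2_greater[OF A(1), of "2 * n + 1"] by blast
  obtain c2 where c2: "c2 > 0" "\<And>e::int. 1 \<le> e \<Longrightarrow>
      \<exists>K. (2 ^ n * (int n + 1)) * e ^ 2 < 2 ^ K \<and> real K \<le> c2 * (1 + ln e)"
    using exists_power_of_2_greater[OF A(2), of 2] by blast
  define C where "C = real (D + 2 * n * D) + c1 * ((real n * 2 ^ n) * (2 * real n * real D + (2 * real n ^ 2 + real n) * (c2 + 1)))"
  define c where "c = C + real b0 + 8 + 4 * c1"
  have C0: "C \<ge> 0" using c1(1) c2(1) by (auto simp: C_def intro!: add_nonneg_nonneg mult_nonneg_nonneg)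
  show ?thesis
  proof (intro exI[of _ c] conjI allI impI)
    show "c > 0" using C0 c1(1) unfolding c_def by linarith
    fix R :: "int poly poly" and e :: int and b :: nat and X :: "int set"
    assume R: "irreducible R" "1 \<le> degree R" "degree R \<le> n" and D: "\<forall>i. degree (coeff R i) \<le> D"
      and e: "1 \<le> e" and b: "1 \<le> b" and X: "X \<subseteq> {0..int b ^ 4}"
      and red: "\<forall>t\<in>X. (\<forall>s. \<bar>coeff (eval_at t R) s\<bar> \<le> e) \<and> \<not> irreducible\<^sub>d (eval_at t R)"
    define L where "L = 1 + ln (real_of_int e)"
    have L: "L \<ge> 1" using e by (simp add: L_def)
    have L2: "L \<le> L\<^sup>2" using L by (simp add: power2_eq_square)
    have bL: "real b ^ 3 \<ge> 0" by simp
    obtain K where K: "(fact (2 * n) * max 1 (int n) ^ (2 * n)) * e ^ (2 * n + 1) < 2 ^ K" "real K \<le> c1 * L"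
      using c1(2)[OF e] by (auto simp: L_def)
    have "card X \<le> card {0..int b ^ 4}" using X by (intro card_mono) auto
    also have "\<dots> = b ^ 4 + 1" by (simp add: nat_add_distrib nat_power_eq)
    finally have "real (card X) \<le> real (b ^ 4 + 1)" unfolding of_nat_le_iff .
    then have trivial: "real (card X) \<le> real b ^ 4 + 1" by simp
    show "real (card X) \<le> c * (1 + ln (real_of_int e))\<^sup>2 * real b ^ 3"
    proof (cases "b \<ge> b0 \<and> K \<le> b\<^sup>2")
      case False
      have "real b \<le> real b0 + c1 * L"
      proof (cases "b \<ge> b0")
        case True
        then have "b\<^sup>2 < K" using False by simp
        then have "real (b\<^sup>2) \<le> real K" by simp
        moreover have "real b \<le> real b ^ 2" using b by (simp add: power2_eq_square)
        ultimately show ?thesis using K(2) by simp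
      next
        case False
        moreover have "0 \<le> c1 * L" using c1(1) L by simp
        ultimately show ?thesis by linarith
      qed
      also have "\<dots> \<le> (real b0 + c1) * L\<^sup>2"
      proof -
        have "real b0 * 1 \<le> real b0 * L\<^sup>2" using L L2 by (intro mult_left_mono) auto
        moreover have "c1 * L \<le> c1 * L\<^sup>2" using L2 c1(1) by simp
        ultimately show ?thesis by (simp add: algebra_simps)
      qed
      finally have "real b * real b ^ 3 \<le> ((real b0 + c1) * L\<^sup>2) * real b ^ 3" by (intro mult_right_mono) auto
      then have "real b ^ 4 \<le> (real b0 + c1) * L\<^sup>2 * real b ^ 3" by (simp add: power_numeral_reduce)
      moreover have "1 \<le> L\<^sup>2 * real b ^ 3" using L b by (intro one_le_mult one_le_power) auto
      ultimately have "real (card X) \<le> (real b0 + c1 + 1) * (L\<^sup>2 * real b ^ 3)" using trivial by (simp add: algebra_simps)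
      also have "\<dots> \<le> c * (L\<^sup>2 * real b ^ 3)" using C0 c1(1) L b by (intro mult_right_mono) (auto simp: c_def)
      finally show ?thesis by (simp add: L_def mult.assoc)
    next
      case True
      define Q where "Q = {p::nat. prime p \<and> 4 * b\<^sup>2 \<le> p \<and> p \<le> b ^ 3}"
      have "K \<le> card Q" using True b0[of b] by (simp add: Q_def)
      then obtain P where P: "P \<subseteq> Q" "card P = K" "finite P" by (rule obtain_subset_with_card_n)
      obtain k2 where k2: "(2 ^ n * (int n + 1)) * e ^ 2 < 2 ^ k2" "real k2 \<le> c2 * L"
        using c2(2)[OF e] by (auto simp: L_def)
      \<comment> \<open>Then \<open>4 ^ (a - 1)\<close> is at least \<open>2 ^ k2\<close> and
        exceeds the bound for the coefficients of g, as \<open>interpolation_size\<close>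
        requires.\<close>
      define a where "a = k2 + 1"
      define m where "m = degree R"
      have m: "m \<le> n" using R by (simp add: m_def)
      have a_le: "real a \<le> (c2 + 1) * L" using k2(2) L by (simp add: a_def algebra_simps)
      have "card X \<le> D + 2 * m * D + card P * (b ^ 3 * (m * 2 ^ m) * ((D + m * a) * (2 * m) + m * a))"
        unfolding m_def
      proof (rule card_reducible_specializations_aux[OF R(1,2) _ e b X])
        have "e * (fact (2 * m) * (int m * e) ^ (2 * m)) \<le> e * (fact (2 * n) * (max 1 (int n) * e) ^ (2 * n))"
        proof -
          have "(int m * e) ^ (2 * m) \<le> (max 1 (int n) * e) ^ (2 * m)"
            using m e by (intro power_mono mult_right_mono) auto
          also have "\<dots> \<le> (max 1 (int n) * e) ^ (2 * n)"
            using m e by (intro power_increasing) (auto intro!: one_le_mult)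
          finally show ?thesis using e m by (intro mult_left_mono mult_mono fact_mono) auto
        qed
        also have "\<dots> = (fact (2 * n) * max 1 (int n) ^ (2 * n)) * e ^ (2 * n + 1)"
          by (simp add: power_mult_distrib)
        also have "\<dots> < 2 ^ card P" using K(1) P(2) by simp
        finally show "e * (fact (2 * degree R) * (int (degree R) * e) ^ (2 * degree R)) < 2 ^ card P" by (simp add: m_def)
        have "2 ^ m * (int m + 1) * e\<^sup>2 \<le> 2 ^ n * (int n + 1) * e\<^sup>2"
          using m e by (intro mult_mono power_increasing) auto
        also have "\<dots> < 2 ^ k2" using k2(1) by simp
        also have "(2::int) ^ k2 \<le> 4 ^ (a - 1)" by (simp add: a_def power_mono)
        finally show "2 ^ degree R * (int (degree R) + 1) * e\<^sup>2 < 4 ^ (a - 1)" by (simp add: m_def)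
      qed (use D red P in \<open>auto simp: Q_def a_def\<close>)
      also have "\<dots> \<le> D + 2 * n * D + K * (b ^ 3 * (n * 2 ^ n) * ((D + n * a) * (2 * n) + n * a))"
        using m P(2) b by (intro add_mono mult_mono power_increasing) auto
      finally have "real (card X) \<le> real (D + 2 * n * D + K * (b ^ 3 * (n * 2 ^ n) * ((D + n * a) * (2 * n) + n * a)))"
        unfolding of_nat_le_iff .
      also have "\<dots> = real (D + 2 * n * D) + real K * (real b ^ 3 * (real n * 2 ^ n) * (2 * real n * real D + (2 * real n ^ 2 + real n) * real a))"
        by (simp add: algebra_simps power2_eq_square)
      also have "\<dots> \<le> real (D + 2 * n * D) * (L\<^sup>2 * real b ^ 3) + (c1 * L) * (real b ^ 3 * (real n * 2 ^ n) * ((2 * real n * real D + (2 * real n ^ 2 + real n) * (c2 + 1)) * L))"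
      proof (intro add_mono mult_mono)
        have "1 \<le> L\<^sup>2 * real b ^ 3" using L b by (intro one_le_mult one_le_power) auto
        then have "real (D + 2 * n * D) * 1 \<le> real (D + 2 * n * D) * (L\<^sup>2 * real b ^ 3)" by (intro mult_left_mono) auto
        then show "real (D + 2 * n * D) \<le> real (D + 2 * n * D) * (L\<^sup>2 * real b ^ 3)" by simp
        have "2 * real n * real D * 1 \<le> 2 * real n * real D * L" using L by (intro mult_left_mono) auto
        moreover have "(2 * real n ^ 2 + real n) * real a \<le> (2 * real n ^ 2 + real n) * ((c2 + 1) * L)"
          using a_le by (intro mult_left_mono) auto
        ultimately show "2 * real n * real D + (2 * real n ^ 2 + real n) * real a \<le> (2 * real n * real D + (2 * real n ^ 2 + real n) * (c2 + 1)) * L"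
          by (simp add: algebra_simps)
      qed (use K(2) c1(1) L in auto)
      also have "\<dots> = C * L\<^sup>2 * real b ^ 3" by (simp add: C_def algebra_simps power2_eq_square)
      also have "\<dots> \<le> c * L\<^sup>2 * real b ^ 3" using c1(1) L by (intro mult_right_mono) (auto simp: c_def)
      finally show ?thesis by (simp add: L_def)
    qed
  qed
qed

section \<open>Kronecker substitution\<close>

definition monomial_value :: "('v \<Rightarrow> 'b) \<Rightarrow> ('v \<Rightarrow>\<^sub>0 nat) \<Rightarrow> 'b :: comm_semiring_1" where
  "monomial_value X e = (\<Prod>v\<in>Poly_Mapping.keys e. X v ^ Poly_Mapping.lookup e v)"

text \<open>Evaluation with a separate map for the coefficients. \<open>eval_mpoly\<close>,
  \<open>specialize\<close>, \<open>substitute\<close> and \<open>kron\<close> are all instances,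
  and \<open>mp_eval_hom\<close> reduces identities between composites to a check on constants and
  variables.\<close>

definition mp_eval :: "('a \<Rightarrow> 'b) \<Rightarrow> ('v \<Rightarrow> 'b) \<Rightarrow> ('v, 'a::zero) mpoly \<Rightarrow> 'b :: comm_semiring_1" where
  "mp_eval \<phi> X p = (\<Sum>e\<in>Poly_Mapping.keys p. \<phi> (Poly_Mapping.lookup p e) * monomial_value X e)"

lemma eval_mpoly_eq: "eval_mpoly = mp_eval (\<lambda>c. c)"
  by (simp add: fun_eq_iff eval_mpoly_def mp_eval_def monomial_value_def)

lemma monomial_value_superset:
  assumes "finite S" "Poly_Mapping.keys e \<subseteq> S"
  shows "monomial_value X e = (\<Prod>v\<in>S. X v ^ Poly_Mapping.lookup e v)"
  unfolding monomial_value_def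
  by (rule prod.mono_neutral_left) (use assms in \<open>auto simp: in_keys_iff\<close>)

lemma monomial_value_finite:
  "monomial_value X e = (\<Prod>v\<in>UNIV. X v ^ Poly_Mapping.lookup e v)" for e :: "'v::finite \<Rightarrow>\<^sub>0 nat"
  by (rule monomial_value_superset) auto

lemma monomial_value_0 [simp]: "monomial_value X 0 = 1"
  by (simp add: monomial_value_def)

lemma monomial_value_add: "monomial_value X (e + f) = monomial_value X e * monomial_value X f"
proof -
  define S where "S = Poly_Mapping.keys e \<union> Poly_Mapping.keys f"
  have "finite S" by (simp add: S_def)
  have *: "monomial_value X g = (\<Prod>v\<in>S. X v ^ Poly_Mapping.lookup g v)" if "Poly_Mapping.keys g \<subseteq> S" for g
    by (rule monomial_value_superset[OF \<open>finite S\<close> that])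
  have "Poly_Mapping.keys (e + f) \<subseteq> S" unfolding S_def by (rule Poly_Mapping.keys_add)
  then show ?thesis using *[of e] *[of f] *[of "e + f"]
    by (simp add: S_def lookup_add power_add prod.distrib)
qed

lemma mp_eval_superset:
  assumes "finite S" "Poly_Mapping.keys p \<subseteq> S" "\<phi> 0 = 0"
  shows "mp_eval \<phi> X p = (\<Sum>e\<in>S. \<phi> (Poly_Mapping.lookup p e) * monomial_value X e)"
  unfolding mp_eval_def
  by (rule sum.mono_neutral_left) (use assms in \<open>auto simp: in_keys_iff\<close>)

lemma mp_eval_single: "\<phi> 0 = 0 \<Longrightarrow> mp_eval \<phi> X (Poly_Mapping.single e c) = \<phi> c * monomial_value X e"
  by (subst mp_eval_superset[of "{e}"]) auto

lemma mpoly_sum_monomials: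
  "(\<Sum>e\<in>Poly_Mapping.keys p. Poly_Mapping.single e (Poly_Mapping.lookup p e)) = p"
  by (rule poly_mapping_eqI) (simp add: lookup_sum lookup_single when_def in_keys_iff)

context comm_semiring_hom
begin

lemma mp_eval_0 [simp]: "mp_eval hom X 0 = 0"
  by (simp add: mp_eval_def)

lemma mp_eval_add: "mp_eval hom X (p + q) = mp_eval hom X p + mp_eval hom X q"
proof -
  define S where "S = Poly_Mapping.keys p \<union> Poly_Mapping.keys q"
  have "Poly_Mapping.keys (p + q) \<subseteq> S" unfolding S_def by (rule Poly_Mapping.keys_add)
  then have "mp_eval hom X (p + q) = (\<Sum>e\<in>S. hom (Poly_Mapping.lookup (p + q) e) * monomial_value X e)"
    "mp_eval hom X p = (\<Sum>e\<in>S. hom (Poly_Mapping.lookup p e) * monomial_value X e)"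
    "mp_eval hom X q = (\<Sum>e\<in>S. hom (Poly_Mapping.lookup q e) * monomial_value X e)"
    by (intro mp_eval_superset; auto simp: S_def)+
  then show ?thesis by (simp add: lookup_add hom_add distrib_right sum.distrib)
qed

lemma mp_eval_sum: "mp_eval hom X (\<Sum>i\<in>I. p i) = (\<Sum>i\<in>I. mp_eval hom X (p i))"
  by (induction I rule: infinite_finite_induct) (auto simp: mp_eval_add)

lemma mp_eval_const: "mp_eval hom X (Poly_Mapping.single 0 c) = hom c"
  by (simp add: mp_eval_single)

lemma mp_eval_1 [simp]: "mp_eval hom X 1 = 1"
  using mp_eval_const[of X 1] by (simp add: single_one)

lemma mp_eval_mult: "mp_eval hom X (p * q) = mp_eval hom X p * mp_eval hom X q"
proof -
  let ?s = "\<lambda>p e. Poly_Mapping.single e (Poly_Mapping.lookup p e)"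
  have "p * q = (\<Sum>e\<in>Poly_Mapping.keys p. ?s p e) * (\<Sum>f\<in>Poly_Mapping.keys q. ?s q f)"
    by (simp add: mpoly_sum_monomials)
  also have "\<dots> = (\<Sum>e\<in>Poly_Mapping.keys p. \<Sum>f\<in>Poly_Mapping.keys q.
      Poly_Mapping.single (e + f) (Poly_Mapping.lookup p e * Poly_Mapping.lookup q f))"
    by (simp add: sum_product mult_single)
  finally show ?thesis
    by (simp add: mp_eval_sum mp_eval_single monomial_value_add hom_mult)
      (simp add: mp_eval_def sum_product mult_ac)
qed

lemma mp_eval_hom: "hom (mp_eval \<phi> X p) = mp_eval (\<lambda>c. hom (\<phi> c)) (\<lambda>v. hom (X v)) p"
  by (simp add: mp_eval_def hom_sum hom_mult hom_prod hom_power monomial_value_def)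

end

lemma mp_eval_cong:
  assumes "\<And>c. c \<in> range (Poly_Mapping.lookup p) \<Longrightarrow> \<phi> c = \<psi> c" "\<And>v. X v = Y v"
  shows "mp_eval \<phi> X p = mp_eval \<psi> Y p"
  using assms by (simp add: mp_eval_def monomial_value_def)

text \<open>Unlike \<open>monom\<close>, \<open>Poly_Mapping.single 0\<close> embeds the constants and
  \<open>var v\<close> is the variable \<open>v\<close>.\<close>

definition var :: "'v \<Rightarrow> ('v, 'a::comm_semiring_1) mpoly" where
  "var v = Poly_Mapping.single (Poly_Mapping.single v 1) 1"

abbreviation mconst :: "'a::zero \<Rightarrow> ('v, 'a) mpoly" where
  "mconst \<equiv> Poly_Mapping.single 0"

interpretation mconst_hom: comm_semiring_hom "mconst :: 'a::comm_semiring_1 \<Rightarrow> ('v, 'a) mpoly"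
  by standard (auto simp: single_add mult_single)

lemma var_power: "var v ^ n = Poly_Mapping.single (Poly_Mapping.single v n) 1"
  by (induction n) (auto simp: var_def mult_single single_add[symmetric] add.commute)

lemma prod_single:
  "finite S \<Longrightarrow> (\<Prod>v\<in>S. Poly_Mapping.single (f v) (1::'a::comm_semiring_1)) = Poly_Mapping.single (\<Sum>v\<in>S. f v) 1"
  by (induction S rule: finite_induct) (auto simp: mult_single)

lemma monomial_value_var: "monomial_value var e = Poly_Mapping.single e (1 :: 'a::comm_semiring_1)"
proof -
  have "(\<Sum>v\<in>Poly_Mapping.keys e. Poly_Mapping.single v (Poly_Mapping.lookup e v)) = e"
    by (rule poly_mapping_eqI) (simp add: lookup_sum lookup_single when_def in_keys_iff)
  then show ?thesis by (simp add: monomial_value_def var_power prod_single)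
qed

lemma mp_eval_var: "mp_eval mconst var p = p"
  unfolding mp_eval_def monomial_value_var by (simp add: mult_single mpoly_sum_monomials)

definition substitute :: "'v \<Rightarrow> 'a \<Rightarrow> ('v, 'a::comm_semiring_1) mpoly \<Rightarrow> ('v, 'a) mpoly" where
  "substitute x c = mp_eval mconst (\<lambda>v. if v = x then mconst c else var v)"

lemma specialize_eq_mp_eval:
  fixes p :: "('r::finite + 'n::finite, 'a::comm_semiring_1) mpoly"
  shows "specialize t p = mp_eval mconst (case_sum (\<lambda>j. mconst (t j)) var) p"
proof -
  have "mconst c * monomial_value (case_sum (\<lambda>j. mconst (t j)) var) e =
      Poly_Mapping.single (Poly_Mapping.map_key Inr e) (c * (\<Prod>j\<in>UNIV. t j ^ Poly_Mapping.lookup e (Inl j)))"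
    for c :: 'a and e :: "'r + 'n \<Rightarrow>\<^sub>0 nat"
  proof -
    have "monomial_value (case_sum (\<lambda>j. mconst (t j)) var) e =
      (\<Prod>j\<in>UNIV. mconst (t j) ^ Poly_Mapping.lookup e (Inl j)) * (\<Prod>k\<in>UNIV. var k ^ Poly_Mapping.lookup e (Inr k))"
      unfolding monomial_value_finite UNIV_sum
      by (subst prod.union_disjoint) (auto simp: prod.reindex)
    also have "(\<Prod>j\<in>UNIV. mconst (t j) ^ Poly_Mapping.lookup e (Inl j)) =
        mconst (\<Prod>j\<in>UNIV. t j ^ Poly_Mapping.lookup e (Inl j))"
      by (simp add: mconst_hom.hom_prod mconst_hom.hom_power)
    also have "(\<Prod>k\<in>UNIV. var k ^ Poly_Mapping.lookup e (Inr k)) =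
        (Poly_Mapping.single (\<Sum>k\<in>UNIV. Poly_Mapping.single k (Poly_Mapping.lookup e (Inr k))) 1 :: ('n, 'a) mpoly)"
      by (simp add: var_power prod_single)
    also have "(\<Sum>k\<in>UNIV. Poly_Mapping.single k (Poly_Mapping.lookup e (Inr k))) = Poly_Mapping.map_key Inr e"
      by (rule poly_mapping_eqI) (simp add: lookup_sum lookup_single when_def map_key.rep_eq)
    finally show ?thesis by (simp add: mult_single)
  qed
  then show ?thesis by (simp add: specialize_def mp_eval_def)
qed

section \<open>Exponent vectors as digits in base D\<close>

lemma digits_unique:
  fixes d d' :: "nat \<Rightarrow> nat"
  assumes "\<And>i. i < n \<Longrightarrow> d i < D \<and> d' i < D" "(\<Sum>i<n. D ^ i * d i) = (\<Sum>i<n. D ^ i * d' i)" "i < n"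
  shows "d i = d' i"
  using assms
proof (induction n arbitrary: d d' i)
  case (Suc n)
  have split: "(\<Sum>i<Suc n. D ^ i * f i) = f 0 + D * (\<Sum>i<n. D ^ i * f (Suc i))" for f :: "nat \<Rightarrow> nat"
    by (simp add: sum.lessThan_Suc_shift sum_distrib_left mult_ac del: sum.lessThan_Suc)
  have eq: "d 0 + D * (\<Sum>i<n. D ^ i * d (Suc i)) = d' 0 + D * (\<Sum>i<n. D ^ i * d' (Suc i))"
    using Suc.prems(2) unfolding split .
  have D: "d 0 < D" "d' 0 < D" using Suc.prems(1)[of 0] by auto
  have 0: "d 0 = d' 0" using arg_cong[OF eq, of "\<lambda>x. x mod D"] D by simp
  then have "(\<Sum>i<n. D ^ i * d (Suc i)) = (\<Sum>i<n. D ^ i * d' (Suc i))" using eq D by simp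
  then have "d (Suc j) = d' (Suc j)" if "j < n" for j
    using Suc.IH[of "\<lambda>i. d (Suc i)" "\<lambda>i. d' (Suc i)" j] Suc.prems(1) that by auto
  then show ?case using 0 Suc.prems(3) by (cases i) auto
qed simp

definition var_index :: "'v::finite \<Rightarrow> nat" where
  "var_index = (SOME f. bij_betw f UNIV {..<card (UNIV :: 'v set)})"

lemma bij_var_index: "bij_betw (var_index :: 'v::finite \<Rightarrow> nat) UNIV {..<card (UNIV :: 'v set)}"
proof -
  have "\<exists>f. bij_betw f (UNIV :: 'v set) {..<card (UNIV :: 'v set)}"
    using ex_bij_betw_finite_nat[of "UNIV :: 'v set"] by (simp add: atLeast0LessThan)
  then show ?thesis unfolding var_index_def by (rule someI_ex)
qed

lemma var_index_less: "var_index (v :: 'v::finite) < card (UNIV :: 'v set)"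
  using bij_var_index bij_betwE by blast

lemma kronecker_exponent_unique:
  fixes e e' :: "'v::finite \<Rightarrow> nat"
  assumes "\<And>v. e v < D \<and> e' v < D"
    "(\<Sum>v\<in>UNIV. D ^ var_index v * e v) = (\<Sum>v\<in>UNIV. D ^ var_index v * e' v)"
  shows "e v = e' v"
proof -
  define w :: "nat \<Rightarrow> 'v" where "w = inv_into UNIV var_index"
  have inj: "inj (var_index :: 'v \<Rightarrow> nat)" using bij_var_index by (auto simp: bij_betw_def)
  have w: "w (var_index v) = v" for v unfolding w_def using inj by simp
  have eq: "(\<Sum>v\<in>UNIV. D ^ var_index v * f v) = (\<Sum>i<card (UNIV :: 'v set). D ^ i * f (w i))" for f :: "'v \<Rightarrow> nat"
  proof -
    have "(\<Sum>v\<in>UNIV. D ^ var_index v * f v) = (\<Sum>v::'v\<in>UNIV. (\<lambda>i. D ^ i * f (w i)) (var_index v))"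
      using w by simp
    also have "\<dots> = (\<Sum>i<card (UNIV :: 'v set). D ^ i * f (w i))"
      by (rule sum.reindex_bij_betw[OF bij_var_index])
    finally show ?thesis .
  qed
  have "(\<Sum>i<card (UNIV :: 'v set). D ^ i * e (w i)) = (\<Sum>i<card (UNIV :: 'v set). D ^ i * e' (w i))"
    using assms(2) unfolding eq .
  then have "e (w (var_index v)) = e' (w (var_index v))"
    by (rule digits_unique[rotated]) (use assms(1) var_index_less in auto)
  then show ?thesis by (simp add: w)
qed

definition weight :: "('v \<Rightarrow> nat) \<Rightarrow> ('v::finite \<Rightarrow>\<^sub>0 nat) \<Rightarrow> nat" where
  "weight a e = (\<Sum>v\<in>UNIV. a v * Poly_Mapping.lookup e v)"

lemma weight_add: "weight a (e + f) = weight a e + weight a f"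
  by (simp add: weight_def lookup_add distrib_left sum.distrib)

text \<open>Two weights, a for the inner and b for the outer variable, because two choices are used:
  one reads off \<open>degree_in V\<close> as the outer degree, the other keeps a single variable as
  the inner one.\<close>

definition kron :: "('v \<Rightarrow> nat) \<Rightarrow> ('v \<Rightarrow> nat) \<Rightarrow> ('v::finite, 'a::comm_ring_1) mpoly \<Rightarrow> 'a poly poly" where
  "kron a b = mp_eval (\<lambda>c. [:[:c:]:]) (\<lambda>v. monom (monom 1 (a v)) (b v))"

interpretation const2_hom: comm_semiring_hom "\<lambda>c :: 'a :: comm_semiring_1. [:[:c:]:]"
  by standard (auto simp flip: one_pCons)

lemma monomial_value_kron:
  "monomial_value (\<lambda>v. monom (monom 1 (a v)) (b v)) e = monom (monom (1 :: 'a :: comm_semiring_1) (weight a e)) (weight b e)"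
proof -
  have "(\<Prod>v\<in>S. monom (monom (1::'a) (a v)) (b v) ^ Poly_Mapping.lookup e v) =
      monom (monom 1 (\<Sum>v\<in>S. a v * Poly_Mapping.lookup e v)) (\<Sum>v\<in>S. b v * Poly_Mapping.lookup e v)" if "finite S" for S
    using that
    by (induction S rule: finite_induct) (auto simp: mult_monom monom_power mult.commute)
  from this[of UNIV] show ?thesis by (simp add: monomial_value_finite weight_def)
qed

lemma kron_eq_sum: "kron a b p = (\<Sum>e\<in>Poly_Mapping.keys p. monom (monom (Poly_Mapping.lookup p e) (weight a e)) (weight b e))"
  unfolding kron_def mp_eval_def monomial_value_kron
  by (intro sum.cong refl) (simp add: smult_monom)

lemma coeff_kron:
  "coeff (coeff (kron a b p) j) i =
     (\<Sum>e\<in>Poly_Mapping.keys p. if weight a e = i \<and> weight b e = j then Poly_Mapping.lookup p e else 0)"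
  unfolding kron_eq_sum by (simp add: coeff_sum) (intro sum.cong refl, auto)

lemma coeff_kron_inj:
  assumes "inj_on (\<lambda>e. (weight a e, weight b e)) (Poly_Mapping.keys p)" "e \<in> Poly_Mapping.keys p"
  shows "coeff (coeff (kron a b p) (weight b e)) (weight a e) = Poly_Mapping.lookup p e"
proof -
  have "coeff (coeff (kron a b p) (weight b e)) (weight a e) =
      (\<Sum>e'\<in>Poly_Mapping.keys p. if e' = e then Poly_Mapping.lookup p e' else 0)"
    unfolding coeff_kron using assms by (intro sum.cong refl) (auto dest: inj_onD)
  then show ?thesis using assms(2) by simp
qed

lemma coeff_kron_cases:
  assumes "inj_on (\<lambda>e. (weight a e, weight b e)) (Poly_Mapping.keys p)"
  shows "coeff (coeff (kron a b p) j) i = 0 \<or>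
     (\<exists>e\<in>Poly_Mapping.keys p. weight a e = i \<and> weight b e = j \<and> coeff (coeff (kron a b p) j) i = Poly_Mapping.lookup p e)"
proof (cases "\<exists>e\<in>Poly_Mapping.keys p. weight a e = i \<and> weight b e = j")
  case True
  then show ?thesis using coeff_kron_inj[OF assms] by blast
next
  case False
  then have "coeff (coeff (kron a b p) j) i = 0" unfolding coeff_kron by (intro sum.neutral) auto
  then show ?thesis by blast
qed

lemma degree_in_eq_weight:
  "degree_in V p = Max (insert 0 (weight (\<lambda>v. if v \<in> V then 1 else 0) ` Poly_Mapping.keys p))"
  for p :: "('v::finite, 'a::zero) mpoly"
proof -
  have "(\<Sum>v\<in>Poly_Mapping.keys e \<inter> V. Poly_Mapping.lookup e v) = weight (\<lambda>v. if v \<in> V then 1 else 0) e" for e :: "'v \<Rightarrow>\<^sub>0 nat"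
  proof -
    have "weight (\<lambda>v. if v \<in> V then 1 else 0) e = (\<Sum>v\<in>UNIV. if v \<in> V then Poly_Mapping.lookup e v else 0)"
      unfolding weight_def by (intro sum.cong refl) auto
    also have "\<dots> = (\<Sum>v\<in>Poly_Mapping.keys e. if v \<in> V then Poly_Mapping.lookup e v else 0)"
      by (rule sum.mono_neutral_right) (auto simp: in_keys_iff)
    also have "\<dots> = (\<Sum>v\<in>Poly_Mapping.keys e \<inter> V. Poly_Mapping.lookup e v)"
      by (simp add: sum.inter_restrict)
    finally show ?thesis by simp
  qed
  then show ?thesis by (simp add: degree_in_def)
qed

lemma weight_le_degree_in:
  "e \<in> Poly_Mapping.keys p \<Longrightarrow> weight (\<lambda>v. if v \<in> V then 1 else 0) e \<le> degree_in V p"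
  unfolding degree_in_eq_weight by (rule Max_ge) auto

lemma degree_in_le:
  assumes "\<And>e. e \<in> Poly_Mapping.keys p \<Longrightarrow> weight (\<lambda>v. if v \<in> V then 1 else 0) e \<le> n"
  shows "degree_in V p \<le> n"
  unfolding degree_in_eq_weight using assms by (subst Max_le_iff) auto

lemma lookup_le_weight:
  assumes "a v \<ge> 1" shows "Poly_Mapping.lookup e v \<le> weight a e"
proof -
  have "Poly_Mapping.lookup e v \<le> a v * Poly_Mapping.lookup e v" using assms by simp
  also have "\<dots> \<le> weight a e" unfolding weight_def by (rule member_le_sum) auto
  finally show ?thesis .
qed

lemma lookup_le_total_degree:
  assumes "e \<in> Poly_Mapping.keys p" shows "Poly_Mapping.lookup e (v::'v::finite) \<le> total_degree p"
  using weight_le_degree_in[OF assms, of UNIV] lookup_le_weight[of "\<lambda>v. if v \<in> UNIV then 1 else 0" v e]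
  unfolding total_degree_def by simp

lemma inj_on_kronecker:
  assumes "\<And>e v. e \<in> S \<Longrightarrow> Poly_Mapping.lookup e v < D"
  shows "inj_on (\<lambda>e. (weight (\<lambda>v::'v::finite. D ^ var_index v) e, weight b e)) S"
proof (rule inj_onI)
  fix e e' assume e: "e \<in> S" "e' \<in> S"
    "(weight (\<lambda>v::'v::finite. D ^ var_index v) e, weight b e) = (weight (\<lambda>v. D ^ var_index v) e', weight b e')"
  show "e = e'"
  proof (rule poly_mapping_eqI)
    fix v show "Poly_Mapping.lookup e v = Poly_Mapping.lookup e' v"
      by (rule kronecker_exponent_unique[of "Poly_Mapping.lookup e" D]) (use e assms in \<open>auto simp: weight_def\<close>)
  qed
qed

text \<open>The indicator of V as outer weight turns \<open>degree_in V\<close> into the outer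
  degree; the Kronecker weight inside keeps distinct monomials apart, so nothing cancels.\<close>

lemma degree_kron:
  fixes p :: "('v::finite, 'a::comm_ring_1) mpoly" and V :: "'v set"
  assumes "p \<noteq> 0" "\<And>e v. e \<in> Poly_Mapping.keys p \<Longrightarrow> Poly_Mapping.lookup e v < D"
  defines "K \<equiv> kron (\<lambda>v. D ^ var_index v) (\<lambda>v. if v \<in> V then 1 else 0) p"
  shows "K \<noteq> 0 \<and> degree K = degree_in V p"
proof -
  let ?a = "\<lambda>v::'v. D ^ var_index v" and ?b = "\<lambda>v::'v. if v \<in> V then 1 else (0::nat)"
  have inj: "inj_on (\<lambda>e. (weight ?a e, weight ?b e)) (Poly_Mapping.keys p)"
    by (rule inj_on_kronecker) (use assms in auto)
  have nz: "coeff K (weight ?b e) \<noteq> 0" if "e \<in> Poly_Mapping.keys p" for e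
  proof
    assume "coeff K (weight ?b e) = 0"
    then have "Poly_Mapping.lookup p e = 0" using coeff_kron_inj[OF inj that] by (simp add: K_def)
    then show False using that by (simp add: in_keys_iff)
  qed
  have "Poly_Mapping.keys p \<noteq> {}" using assms(1) by simp
  then obtain e0 where "e0 \<in> Poly_Mapping.keys p" by blast
  then have K0: "K \<noteq> 0" using nz by force
  have "degree K \<le> degree_in V p"
  proof (rule degree_le, intro allI impI)
    fix j assume j: "degree_in V p < j"
    show "coeff K j = 0"
    proof (rule poly_eqI)
      fix i
      show "coeff (coeff K j) i = coeff 0 i"
        using coeff_kron_cases[OF inj, of j i] weight_le_degree_in[of _ p V] j unfolding K_def by fastforce
    qed
  qed
  moreover have "degree_in V p \<le> degree K"
    by (rule degree_in_le) (rule le_degree, rule nz)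
  ultimately show ?thesis using K0 by auto
qed

lemma exists_exponent_bound:
  fixes p :: "('v::finite, 'a::zero) mpoly"
  shows "\<exists>D. \<forall>D'\<ge>D. \<forall>e\<in>Poly_Mapping.keys p. \<forall>v. Poly_Mapping.lookup e v < D'"
proof (intro exI[of _ "Suc (total_degree p)"] allI impI ballI)
  fix D e v assume "Suc (total_degree p) \<le> D" "e \<in> Poly_Mapping.keys p"
  then show "Poly_Mapping.lookup e v < D" using lookup_le_total_degree[of e p v] by linarith
qed

lemma kron_mult: "kron a b (p * q) = kron a b p * kron a b q"
  unfolding kron_def by (rule const2_hom.mp_eval_mult)

lemma kron_add: "kron a b (p + q) = kron a b p + kron a b q"
  unfolding kron_def by (rule const2_hom.mp_eval_add)

text \<open>Transferred from \<open>'a poly poly\<close> along a Kronecker substitution whose base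
  exceeds all exponents of p, q and p q.\<close>

lemma mpoly_mult_nonzero:
  fixes p q :: "('v::finite, 'a::idom) mpoly"
  assumes "p \<noteq> 0" "q \<noteq> 0"
  shows "p * q \<noteq> 0" and "degree_in V (p * q) = degree_in V p + degree_in V q"
proof -
  obtain D1 D2 D3 where D123: "\<forall>D'\<ge>D1. \<forall>e\<in>Poly_Mapping.keys p. \<forall>v. Poly_Mapping.lookup e v < D'"
    "\<forall>D'\<ge>D2. \<forall>e\<in>Poly_Mapping.keys q. \<forall>v. Poly_Mapping.lookup e v < D'"
    "\<forall>D'\<ge>D3. \<forall>e\<in>Poly_Mapping.keys (p * q). \<forall>v. Poly_Mapping.lookup e v < D'"
    using exists_exponent_bound[of p] exists_exponent_bound[of q] exists_exponent_bound[of "p * q"] by blast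
  define D where "D = max D1 (max D2 D3)"
  define k where "k = (kron (\<lambda>v. D ^ var_index v) (\<lambda>v. if v \<in> V then 1 else 0) :: ('v, 'a) mpoly \<Rightarrow> _)"
  have p: "k p \<noteq> 0 \<and> degree (k p) = degree_in V p" unfolding k_def
    using D123(1) by (intro degree_kron assms) (auto simp: D_def)
  have q: "k q \<noteq> 0 \<and> degree (k q) = degree_in V q" unfolding k_def
    using D123(2) by (intro degree_kron assms) (auto simp: D_def)
  have pq: "k (p * q) = k p * k q" unfolding k_def by (rule kron_mult)
  show nz: "p * q \<noteq> 0"
  proof
    assume "p * q = 0"
    then have "k p * k q = 0" using pq by (simp add: k_def kron_def)
    then show False using p q by simp
  qed
  have "degree (k (p * q)) = degree_in V (p * q)" unfolding k_def
    using D123(3) degree_kron[OF nz, of D V] by (auto simp: D_def)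
  then show "degree_in V (p * q) = degree_in V p + degree_in V q"
    using p q pq by (simp add: degree_mult_eq)
qed

section \<open>Degrees of factors and divisors of products of primes\<close>

lemma coeff_mult_top:
  fixes p q :: "'a::idom poly"
  assumes "degree p \<le> a" "degree q \<le> b"
  shows "coeff (p * q) (a + b) = coeff p a * coeff q b"
proof (cases "degree p = a \<and> degree q = b")
  case True
  then show ?thesis using coeff_mult_degree_sum[of p q] by auto
next
  case False
  then have "degree p + degree q < a + b" using assms by linarith
  then have "degree (p * q) < a + b" using degree_mult_le[of p q] by linarith
  moreover have "coeff p a = 0 \<or> coeff q b = 0" using False assms
    by (metis coeff_eq_0 le_neq_implies_less)
  ultimately show ?thesis by (auto simp: coeff_eq_0)
qed

lemma exists_coefficient_degree:
  fixes R :: "'a::zero poly poly"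
  assumes "R \<noteq> 0"
  obtains a i where "\<And>i. degree (coeff R i) \<le> a" "coeff (coeff R i) a \<noteq> 0"
proof -
  define S where "S = (\<lambda>i. degree (coeff R i)) ` {..degree R}"
  have S: "finite S" "S \<noteq> {}" by (auto simp: S_def)
  have le: "degree (coeff R i) \<le> Max S" for i
  proof (cases "i \<le> degree R")
    case True then show ?thesis using S by (auto simp: S_def intro!: Max_ge)
  qed (simp add: coeff_eq_0)
  have "\<exists>i. degree (coeff R i) = m" if "m \<in> S" for m using that by (auto simp: S_def)
  then obtain i where i: "degree (coeff R i) = Max S" using Max_in[OF S] by blast
  show ?thesis
  proof (cases "coeff R i = 0")
    case True
    then have "Max S = 0" using i by simp
    then have "degree (lead_coeff R) = 0" using le[of "degree R"] by simp
    then have "coeff (lead_coeff R) (Max S) \<noteq> 0"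
      using assms \<open>Max S = 0\<close> by (metis leading_coeff_0_iff)
    then show ?thesis using that le by blast
  next
    case False
    then have "coeff (coeff R i) (Max S) \<noteq> 0" using i by (metis leading_coeff_0_iff)
    then show ?thesis using that le by blast
  qed
qed

text \<open>Let a and b be the inner degrees of R and Q. The part of R Q of inner degree a + b is
  the product of the top parts of R and Q, both nonzero; so inner degrees add.\<close>

lemma degree_coeff_factor_le:
  fixes R Q :: "'a::idom poly poly"
  assumes nz: "R \<noteq> 0" "Q \<noteq> 0" and d: "\<And>i. degree (coeff (R * Q) i) \<le> d"
  shows "degree (coeff R i) \<le> d"
proof -
  obtain a i where a: "\<And>i. degree (coeff R i) \<le> a" "coeff (coeff R i) a \<noteq> 0"
    using exists_coefficient_degree[OF nz(1)] by blast
  obtain b j where b: "\<And>i. degree (coeff Q i) \<le> b" "coeff (coeff Q j) b \<noteq> 0"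
    using exists_coefficient_degree[OF nz(2)] by blast
  define Ra where "Ra = map_poly (\<lambda>p. coeff p a) R"
  define Qb where "Qb = map_poly (\<lambda>p. coeff p b) Q"
  have "coeff Ra i \<noteq> 0" "coeff Qb j \<noteq> 0" using a b by (auto simp: Ra_def Qb_def coeff_map_poly)
  then have "Ra * Qb \<noteq> 0" by auto
  then obtain k where k: "coeff (Ra * Qb) k \<noteq> 0" by (metis coeff_0 poly_eqI)
  have "coeff (coeff (R * Q) k) (a + b) = (\<Sum>l\<le>k. coeff (coeff R l * coeff Q (k - l)) (a + b))"
    by (simp add: coeff_mult[of R] coeff_sum)
  also have "\<dots> = coeff (Ra * Qb) k"
    unfolding coeff_mult[of Ra] by (simp add: coeff_mult_top[OF a(1) b(1)] Ra_def Qb_def coeff_map_poly)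
  finally have "a + b \<le> degree (coeff (R * Q) k)" using k by (intro le_degree) simp
  then show ?thesis using d[of k] a(1)[of i] a(1) by (meson add_leD1 order_trans)
qed

text \<open>Unique factorisation, with the primes given as images of M. Later f is specialization at
  t, and N also selects a product of the unspecialized factors.\<close>

lemma prime_product_split:
  fixes f :: "'b \<Rightarrow> 'a::{algebraic_semidom, comm_ring_1}"
  assumes "\<And>r. r \<in># M \<Longrightarrow> prime_elem (f r)" "a * b = u * prod_mset (image_mset f M)" "is_unit u"
  shows "\<exists>N u1 u2. N \<subseteq># M \<and> is_unit u1 \<and> is_unit u2 \<and>
    a = u1 * prod_mset (image_mset f N) \<and> b = u2 * prod_mset (image_mset f (M - N))"
  using assms
proof (induction M arbitrary: a b)
  case empty
  then have "is_unit (a * b)" by simp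
  then show ?case by (intro exI[of _ "{#}"] exI[of _ a] exI[of _ b]) (auto simp: is_unit_mult_iff)
next
  case (add r M)
  have pr: "prime_elem (f r)" using add.prems(1) by simp
  then have fr: "f r \<noteq> 0" by auto
  have eq: "a * b = f r * (u * prod_mset (image_mset f M))" using add.prems(2) by (simp add: mult_ac)
  have M: "\<And>r. r \<in># M \<Longrightarrow> prime_elem (f r)" using add.prems(1) by simp
  have "f r dvd a \<or> f r dvd b" using pr eq by (metis dvd_triv_left prime_elem_dvd_mult_iff)
  then show ?case
  proof
    assume "f r dvd a"
    then obtain a' where a': "a = f r * a'" by (auto elim: dvdE)
    then have "f r * (a' * b) = f r * (u * prod_mset (image_mset f M))" using eq by (simp add: mult.assoc)
    then have "a' * b = u * prod_mset (image_mset f M)" using fr by simp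
    from add.IH[OF M this add.prems(3)] obtain N u1 u2 where N: "N \<subseteq># M" "is_unit u1" "is_unit u2"
      "a' = u1 * prod_mset (image_mset f N)" "b = u2 * prod_mset (image_mset f (M - N))" by blast
    then show ?case
      by (intro exI[of _ "add_mset r N"] exI[of _ u1] exI[of _ u2]) (auto simp: a' mult_ac)
  next
    assume "f r dvd b"
    then obtain b' where b': "b = f r * b'" by (auto elim: dvdE)
    then have "f r * (a * b') = f r * (u * prod_mset (image_mset f M))" using eq by (simp add: mult_ac)
    then have "a * b' = u * prod_mset (image_mset f M)" using fr by simp
    from add.IH[OF M this add.prems(3)] obtain N u1 u2 where N: "N \<subseteq># M" "is_unit u1" "is_unit u2"
      "a = u1 * prod_mset (image_mset f N)" "b' = u2 * prod_mset (image_mset f (M - N))" by blast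
    have "add_mset r M - N = add_mset r (M - N)" using N(1)
      by (metis add_mset_add_single subset_mset.add_diff_assoc2)
    moreover have "N \<subseteq># add_mset r M" using N(1) by (simp add: subset_mset.order_trans[of N M])
    ultimately show ?case using N
      by (intro exI[of _ N] exI[of _ u1] exI[of _ u2]) (auto simp: b' mult_ac)
  qed
qed

lemma card_submultisets: "finite {N. N \<subseteq># M} \<and> card {N. N \<subseteq># M} \<le> 2 ^ size M"
proof (induction M)
  case (add r M)
  have sub: "{N. N \<subseteq># add_mset r M} \<subseteq> {N. N \<subseteq># M} \<union> add_mset r ` {N. N \<subseteq># M}"
  proof
    fix N assume "N \<in> {N. N \<subseteq># add_mset r M}"
    then have N: "N \<subseteq># add_mset r M" by simp
    show "N \<in> {N. N \<subseteq># M} \<union> add_mset r ` {N. N \<subseteq># M}"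
    proof (cases "r \<in># N")
      case True
      then obtain N' where "N = add_mset r N'" by (metis insert_DiffM)
      then show ?thesis using N by auto
    next
      case False
      then have "N \<subseteq># M" using N by (metis diff_single_trivial diff_union_swap2 subset_eq_diff_conv add_mset_add_single union_commute)
      then show ?thesis by simp
    qed
  qed
  have fin: "finite ({N. N \<subseteq># M} \<union> add_mset r ` {N. N \<subseteq># M})" using add.IH by simp
  have "card {N. N \<subseteq># add_mset r M} \<le> card {N. N \<subseteq># M} + card (add_mset r ` {N. N \<subseteq># M})"
    using card_mono[OF fin sub] card_Un_le order_trans by blast
  also have "\<dots> \<le> 2 ^ size M + 2 ^ size M"
    using add.IH card_image_le[of "{N. N \<subseteq># M}" "add_mset r"] by (intro add_mono) (auto intro: order_trans)
  finally show ?case using finite_subset[OF sub fin] by simp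
qed auto

lemma kron_single: "kron a b (Poly_Mapping.single e c) = monom (monom c (weight a e)) (weight b e)"
  unfolding kron_def by (simp add: mp_eval_single monomial_value_kron smult_monom)

lemma kron_1: "kron a b 1 = 1"
  unfolding kron_def by (rule const2_hom.mp_eval_1)

lemma kron_0: "kron a b 0 = 0"
  unfolding kron_def by (rule const2_hom.mp_eval_0)

lemma weight_single: "weight a (Poly_Mapping.single v n) = a v * n"
proof -
  have "weight a (Poly_Mapping.single v n) = (\<Sum>w\<in>UNIV. if w = v then a v * n else 0)"
    unfolding weight_def by (intro sum.cong refl) (auto simp: lookup_single when_def)
  then show ?thesis by simp
qed

text \<open>The Kronecker substitution that keeps the variable \<open>x\<close>: it is \<open>kron (keep_wt x) (kron_wt x D)\<close>,
  with \<open>x\<close> as the inner polynomial variable.\<close>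

definition keep_wt :: "'v \<Rightarrow> 'v \<Rightarrow> nat" where
  "keep_wt x v = (if v = x then 1 else 0)"

definition kron_wt :: "'v::finite \<Rightarrow> nat \<Rightarrow> 'v \<Rightarrow> nat" where
  "kron_wt x D v = (if v = x then 0 else D ^ var_index v)"

lemma weight_keep_wt: "weight (keep_wt x) e = Poly_Mapping.lookup e x"
proof -
  have "weight (keep_wt x) e = (\<Sum>v\<in>UNIV. if v = x then Poly_Mapping.lookup e x else 0)"
    unfolding weight_def keep_wt_def by (intro sum.cong refl) auto
  then show ?thesis by simp
qed

lemma inj_on_keep_kron:
  fixes x :: "'v::finite"
  assumes "\<And>e v. e \<in> S \<Longrightarrow> v \<noteq> x \<Longrightarrow> Poly_Mapping.lookup e v < D" "0 < D"
  shows "inj_on (\<lambda>e. (weight (keep_wt x) e, weight (kron_wt x D) e)) S"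
proof (rule inj_onI)
  fix e e' assume e: "e \<in> S" "e' \<in> S"
    "(weight (keep_wt x) e, weight (kron_wt x D) e) = (weight (keep_wt x) e', weight (kron_wt x D) e')"
  define f where "f e v = (if v = x then 0 else Poly_Mapping.lookup e v)" for e :: "'v \<Rightarrow>\<^sub>0 nat" and v
  have w: "weight (kron_wt x D) e = (\<Sum>v\<in>UNIV. D ^ var_index v * f e v)" for e
    unfolding weight_def by (intro sum.cong refl) (auto simp: f_def kron_wt_def)
  have "(\<Sum>v\<in>UNIV. D ^ var_index v * f e v) = (\<Sum>v\<in>UNIV. D ^ var_index v * f e' v)"
    using e(3) by (simp add: w[symmetric])
  from kronecker_exponent_unique[OF _ this] have "f e v = f e' v" for v
    using e(1,2) assms by (simp add: f_def)
  then have "Poly_Mapping.lookup e v = Poly_Mapping.lookup e' v" for v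
    using e(3) by (cases "v = x") (auto simp: weight_keep_wt f_def split: if_splits, metis)
  then show "e = e'" by (intro poly_mapping_eqI)
qed

text \<open>The variable x is kept as it is, so only the other exponents have to be digits in base
  D.\<close>

lemma kron_injective:
  fixes p q :: "('v::finite, 'a::comm_ring_1) mpoly"
  assumes "kron (keep_wt x) (kron_wt x D) p = kron (keep_wt x) (kron_wt x D) q" "0 < D"
    "\<And>e v. e \<in> Poly_Mapping.keys p \<Longrightarrow> v \<noteq> x \<Longrightarrow> Poly_Mapping.lookup e v < D"
    "\<And>e v. e \<in> Poly_Mapping.keys q \<Longrightarrow> v \<noteq> x \<Longrightarrow> Poly_Mapping.lookup e v < D"
  shows "p = q"
proof -
  let ?k = "kron (keep_wt x) (kron_wt x D) :: ('v, 'a) mpoly \<Rightarrow> _"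
  have "?k (q + (p - q)) = ?k q + ?k (p - q)" by (rule kron_add)
  then have k0: "?k (p - q) = 0" using assms(1) by simp
  have "e \<in> Poly_Mapping.keys p \<union> Poly_Mapping.keys q" if "e \<in> Poly_Mapping.keys (p - q)" for e
    using that by (auto simp: in_keys_iff lookup_minus)
  then have inj: "inj_on (\<lambda>e. (weight (keep_wt x) e, weight (kron_wt x D) e)) (Poly_Mapping.keys (p - q))"
    using assms(2-4) by (intro inj_on_keep_kron) blast+
  have "Poly_Mapping.keys (p - q) = {}"
  proof (rule ccontr)
    assume "Poly_Mapping.keys (p - q) \<noteq> {}"
    then obtain e where e: "e \<in> Poly_Mapping.keys (p - q)" by blast
    then show False using coeff_kron_inj[OF inj e] k0 by (simp add: in_keys_iff)
  qed
  then show ?thesis by simp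
qed

text \<open>Every outer exponent of P is read as a vector of digits, while the inner exponent
  becomes the exponent of x. This is the way back from factors of a Kronecker image to multivariate
  factors.\<close>

lemma kron_surjective:
  fixes P :: "'a::comm_ring_1 poly poly" and x :: "'v::finite"
  assumes "\<And>s. coeff P s \<noteq> 0 \<Longrightarrow> \<exists>e. weight (kron_wt x D) e = s \<and> Poly_Mapping.lookup e x = 0 \<and> (\<forall>v. Poly_Mapping.lookup e v \<le> d)"
  shows "\<exists>p. kron (keep_wt x) (kron_wt x D) p = P \<and>
    (\<forall>e\<in>Poly_Mapping.keys p. \<forall>v. v \<noteq> x \<longrightarrow> Poly_Mapping.lookup e v \<le> d)"
proof -
  let ?k = "kron (keep_wt x) (kron_wt x D) :: ('v, 'a) mpoly \<Rightarrow> _"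
  define good where "good Q \<longleftrightarrow> (\<exists>p. ?k p = Q \<and> (\<forall>e\<in>Poly_Mapping.keys p. \<forall>v. v \<noteq> x \<longrightarrow> Poly_Mapping.lookup e v \<le> d))" for Q
  have good_0: "good 0" unfolding good_def by (intro exI[of _ 0]) (simp add: kron_0)
  have good_add: "good (P + Q)" if PQ: "good P" "good Q" for P Q
  proof -
    obtain p q where p: "?k p = P" "\<forall>e\<in>Poly_Mapping.keys p. \<forall>v. v \<noteq> x \<longrightarrow> Poly_Mapping.lookup e v \<le> d"
      and q: "?k q = Q" "\<forall>e\<in>Poly_Mapping.keys q. \<forall>v. v \<noteq> x \<longrightarrow> Poly_Mapping.lookup e v \<le> d"
      using PQ unfolding good_def by blast
    show ?thesis unfolding good_def
      using p q Poly_Mapping.keys_add[of p q] by (intro exI[of _ "p + q"]) (auto simp: kron_add)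
  qed
  have good_sum: "good (\<Sum>i\<in>I. Q i)" if "\<And>i. i \<in> I \<Longrightarrow> good (Q i)" for I :: "nat set" and Q
    using that by (induction I rule: infinite_finite_induct) (auto intro: good_0 good_add)
  have good_monom: "good (monom (monom c i) s)" if "coeff P s \<noteq> 0" for c i s
  proof -
    obtain e where e: "weight (kron_wt x D) e = s" "Poly_Mapping.lookup e x = 0" "\<forall>v. Poly_Mapping.lookup e v \<le> d"
      using assms[OF \<open>coeff P s \<noteq> 0\<close>] by blast
    define e' where "e' = e + Poly_Mapping.single x i"
    have "?k (Poly_Mapping.single e' c) = monom (monom c i) s"
      by (simp add: kron_single e'_def weight_add weight_single weight_keep_wt e) (simp add: kron_wt_def keep_wt_def)
    moreover have "\<forall>f\<in>Poly_Mapping.keys (Poly_Mapping.single e' c). \<forall>v. v \<noteq> x \<longrightarrow> Poly_Mapping.lookup f v \<le> d"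
      using e(3) by (auto simp: e'_def lookup_add lookup_single when_def)
    ultimately show ?thesis unfolding good_def by blast
  qed
  have "good (monom (coeff P s) s)" for s
  proof (cases "coeff P s = 0")
    case False
    have "monom (coeff P s) s = monom (\<Sum>i\<le>degree (coeff P s). monom (coeff (coeff P s) i) i) s"
      by (simp add: poly_as_sum_of_monoms)
    also have "\<dots> = (\<Sum>i\<le>degree (coeff P s). monom (monom (coeff (coeff P s) i) i) s)"
      by (induction "{..degree (coeff P s)}" rule: infinite_finite_induct) (simp_all add: monom_sum)
    finally show ?thesis using good_sum good_monom[OF False] by simp
  qed (simp add: good_0)
  then have "good (\<Sum>s\<le>degree P. monom (coeff P s) s)" by (intro good_sum)
  then show ?thesis unfolding poly_as_sum_of_monoms good_def .
qed

section \<open>Substituting an integer for one variable\<close>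

interpretation eval_rat_hom: comm_semiring_hom "map_poly (\<lambda>q. poly q (c::'a::comm_ring_1))" for c
proof
  show "map_poly (\<lambda>q. poly q c) 0 = 0" by simp
  show "map_poly (\<lambda>q. poly q c) 1 = 1"
    by (rule poly_eqI) (auto simp: coeff_map_poly of_bool_def)
  show "map_poly (\<lambda>q. poly q c) (p + q) = map_poly (\<lambda>q. poly q c) p + map_poly (\<lambda>q. poly q c) q" for p q
    by (rule poly_eqI) (simp add: coeff_map_poly)
  show "map_poly (\<lambda>q. poly q c) (p * q) = map_poly (\<lambda>q. poly q c) p * map_poly (\<lambda>q. poly q c) q" for p q
    by (rule poly_eqI) (simp add: coeff_map_poly coeff_mult poly_sum)
qed

definition kron_eval :: "'v \<Rightarrow> nat \<Rightarrow> 'a \<Rightarrow> ('v::finite, 'a::comm_ring_1) mpoly \<Rightarrow> 'a poly" where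
  "kron_eval x D c p = map_poly (\<lambda>q. poly q c) (kron (keep_wt x) (kron_wt x D) p)"

interpretation kron_eval_hom: comm_semiring_hom "kron_eval x D c"
  by standard (simp_all add: kron_eval_def kron_0 kron_1 kron_add kron_mult eval_rat_hom.hom_add eval_rat_hom.hom_mult)

lemma kron_eval_const: "kron_eval x D c (mconst k) = [:k:]"
  by (rule poly_eqI)
    (auto simp: kron_eval_def kron_single weight_def coeff_map_poly coeff_pCons monom_0 split: nat.split)

text \<open>Substituting before or after the Kronecker map gives the same result, so factors of the
  substituted polynomial can be compared with specialized factors of the Kronecker image.\<close>

lemma kron_eval_substitute: "kron_eval x D c (substitute x c p) = kron_eval x D c p"
proof -
  have c: "kron_eval x D c (mconst k) = map_poly (\<lambda>q. poly q c) [:[:k:]:]" for k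
    unfolding kron_eval_const by (rule poly_eqI) (auto simp: coeff_map_poly coeff_pCons split: nat.split)
  have v: "kron_eval x D c (if v = x then mconst c else var v) =
      map_poly (\<lambda>q. poly q c) (monom (monom 1 (keep_wt x v)) (kron_wt x D v))" for v
    by (rule poly_eqI)
      (auto simp: kron_eval_const, auto simp: kron_eval_def var_def kron_single weight_single coeff_map_poly keep_wt_def kron_wt_def poly_monom monom_0 coeff_pCons split: nat.split)
  show ?thesis
    unfolding substitute_def kron_eval_hom.mp_eval_hom c v
    by (simp add: kron_eval_def kron_def eval_rat_hom.mp_eval_hom)
qed

lemma coeff_kron_eval:
  assumes "\<And>e v. e \<in> Poly_Mapping.keys p \<Longrightarrow> Poly_Mapping.lookup e v < D" "0 < D"
    "\<And>e. e \<in> Poly_Mapping.keys p \<Longrightarrow> Poly_Mapping.lookup e x = 0"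
    and e: "e \<in> Poly_Mapping.keys p"
  shows "coeff (kron_eval x D c p) (weight (kron_wt x D) e) = Poly_Mapping.lookup p e"
proof -
  let ?K = "kron (keep_wt x) (kron_wt x D) p"
  have inj: "inj_on (\<lambda>e. (weight (keep_wt x) e, weight (kron_wt x D) e)) (Poly_Mapping.keys p)"
    by (rule inj_on_keep_kron) (use assms in auto)
  have "coeff ?K (weight (kron_wt x D) e) = [:Poly_Mapping.lookup p e:]"
  proof (rule poly_eqI)
    fix i
    have 0: "coeff (coeff ?K (weight (kron_wt x D) e)) 0 = Poly_Mapping.lookup p e"
      using coeff_kron_inj[OF inj e] assms(3)[OF e] by (simp add: weight_keep_wt)
    show "coeff (coeff ?K (weight (kron_wt x D) e)) i = coeff [:Poly_Mapping.lookup p e:] i"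
    proof (cases i)
      case (Suc j)
      then show ?thesis
        using coeff_kron_cases[OF inj, of "weight (kron_wt x D) e" i] assms(3) by (auto simp: weight_keep_wt)
    qed (simp add: 0)
  qed
  then show ?thesis by (simp add: kron_eval_def coeff_map_poly)
qed

lemma coeff_kron_eval_neq_0:
  assumes "coeff (kron_eval x D c p) s \<noteq> 0"
  shows "\<exists>e\<in>Poly_Mapping.keys p. weight (kron_wt x D) e = s"
proof (rule ccontr)
  assume "\<not> ?thesis"
  then have "coeff (coeff (kron (keep_wt x) (kron_wt x D) p) s) i = 0" for i
    unfolding coeff_kron by (intro sum.neutral) auto
  then have "coeff (kron (keep_wt x) (kron_wt x D) p) s = 0" by (intro poly_eqI) simp
  then show False using assms by (simp add: kron_eval_def coeff_map_poly)
qed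

text \<open>All weights \<open>kron_wt\<close> outside x are positive, and different monomials do
  not cancel; so a constant image leaves only the zero exponent.\<close>

lemma unit_if_kron_eval_const:
  fixes p :: "('v::finite, 'a::field) mpoly"
  assumes "\<And>e v. e \<in> Poly_Mapping.keys p \<Longrightarrow> Poly_Mapping.lookup e v < D" "0 < D"
    "\<And>e. e \<in> Poly_Mapping.keys p \<Longrightarrow> Poly_Mapping.lookup e x = 0"
    "degree (kron_eval x D c p) = 0" "p \<noteq> 0"
  shows "p dvd 1"
proof -
  have "e = 0" if e: "e \<in> Poly_Mapping.keys p" for e
  proof (rule poly_mapping_eqI)
    fix v
    have "coeff (kron_eval x D c p) (weight (kron_wt x D) e) \<noteq> 0"
      using coeff_kron_eval[OF assms(1-3) e] e by (simp add: in_keys_iff)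
    then have "weight (kron_wt x D) e = 0" using assms(4) le_degree by force
    then show "Poly_Mapping.lookup e v = Poly_Mapping.lookup 0 v"
      using lookup_le_weight[of "kron_wt x D" v e] assms(2) assms(3)[OF e]
      by (cases "v = x") (auto simp: kron_wt_def Suc_le_eq)
  qed
  then have keys: "Poly_Mapping.keys p \<subseteq> {0}" by blast
  define k where "k = Poly_Mapping.lookup p 0"
  have p: "p = mconst k"
    by (rule poly_mapping_eqI) (use keys in \<open>auto simp: k_def lookup_single when_def in_keys_iff\<close>)
  then have "k \<noteq> 0" using assms(5) by auto
  then have "1 = p * mconst (inverse k)" unfolding p by (simp add: mult_single)
  then show ?thesis by (rule dvdI)
qed

lemma substitute_eq_sum:
  "substitute x c p = (\<Sum>e\<in>Poly_Mapping.keys p.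
     Poly_Mapping.single (Poly_Mapping.update x 0 e) (Poly_Mapping.lookup p e * c ^ Poly_Mapping.lookup e x))"
proof -
  have "mconst k * monomial_value (\<lambda>v. if v = x then mconst c else var v) e =
    Poly_Mapping.single (Poly_Mapping.update x 0 e) (k * c ^ Poly_Mapping.lookup e x)" for k e
  proof -
    define e' where "e' = Poly_Mapping.update x 0 e"
    have e: "e = e' + Poly_Mapping.single x (Poly_Mapping.lookup e x)"
      by (rule poly_mapping_eqI) (auto simp: e'_def lookup_add lookup_update lookup_single when_def)
    have "monomial_value (\<lambda>v. if v = x then mconst c else var v) e' = monomial_value var e'"
      unfolding monomial_value_def by (intro prod.cong refl) (auto simp: e'_def in_keys_iff lookup_update)
    moreover have "monomial_value (\<lambda>v. if v = x then mconst c else var v) (Poly_Mapping.single x n) = mconst (c ^ n)" for n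
      by (cases "n = 0") (auto simp: monomial_value_def mconst_hom.hom_power)
    ultimately have "monomial_value (\<lambda>v. if v = x then mconst c else var v) e =
        Poly_Mapping.single e' 1 * mconst (c ^ Poly_Mapping.lookup e x)"
      by (subst e) (simp add: monomial_value_add monomial_value_var)
    then show ?thesis by (simp add: mult_single e'_def)
  qed
  then show ?thesis unfolding substitute_def mp_eval_def by simp
qed

lemma keys_substitute:
  assumes "e \<in> Poly_Mapping.keys (substitute x c p)"
  shows "\<exists>e'\<in>Poly_Mapping.keys p. e = Poly_Mapping.update x 0 e'"
proof (rule ccontr)
  assume neg: "\<not> ?thesis"
  have "Poly_Mapping.lookup (substitute x c p) e = 0"
    unfolding substitute_eq_sum lookup_sum using neg
    by (intro sum.neutral) (auto simp: lookup_single when_def)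
  then show False using assms by (simp add: in_keys_iff)
qed

lemma weight_update_le: "weight a (Poly_Mapping.update x 0 e) \<le> weight a e"
  unfolding weight_def by (intro sum_mono mult_left_mono) (auto simp: lookup_update)

lemma degree_in_substitute_le: "degree_in V (substitute x c p) \<le> degree_in V (p :: ('v::finite, 'a::comm_semiring_1) mpoly)"
proof (rule degree_in_le)
  fix e assume "e \<in> Poly_Mapping.keys (substitute x c p)"
  from keys_substitute[OF this] obtain e' where "e' \<in> Poly_Mapping.keys p" "e = Poly_Mapping.update x 0 e'" ..
  then show "weight (\<lambda>v. if v \<in> V then 1 else 0) e \<le> degree_in V p"
    using weight_update_le weight_le_degree_in order_trans by blast
qed

section \<open>Irreducibility after substituting one variable\<close>

abbreviation rat_poly2 :: "int poly poly \<Rightarrow> rat poly poly" where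
  "rat_poly2 \<equiv> map_poly of_int_poly"

lemma rat_poly2_mult: "rat_poly2 (P * Q) = rat_poly2 P * rat_poly2 Q"
  by (rule poly_eqI) (simp add: coeff_map_poly coeff_mult of_int_poly_hom.hom_sum of_int_poly_hom.hom_mult)

lemma degree_rat_poly2: "degree (rat_poly2 P) = degree P"
  by (rule degree_map_poly) simp

lemma eval_rat_poly2: "map_poly (\<lambda>q. poly q (of_int t)) (rat_poly2 P) = of_int_poly (eval_at t P)"
  by (rule poly_eqI) (simp add: coeff_map_poly)

lemma eval_at_prod_mset: "eval_at t (prod_mset M) = prod_mset (image_mset (eval_at t) M)"
proof (induction M)
  case empty
  then show ?case by (rule poly_eqI) (auto simp: coeff_map_poly of_bool_def)
qed (simp add: eval_at_mult)

lemma of_int_poly_prod_mset: "of_int_poly (prod_mset M) = (prod_mset (image_mset of_int_poly M) :: rat poly)"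
  by (induction M) (simp_all add: of_int_poly_hom.hom_mult)

lemma is_unit_mult_degree:
  fixes u p :: "rat poly"
  assumes "is_unit u" shows "degree (u * p) = degree p" "coeff (u * p) s = 0 \<longleftrightarrow> coeff p s = 0"
proof -
  have u: "u \<noteq> 0" "degree u = 0" using assms by auto
  then obtain c where "u = [:c:]" "c \<noteq> 0" by (metis degree_eq_zeroE pCons_0_0)
  then show "degree (u * p) = degree p" "coeff (u * p) s = 0 \<longleftrightarrow> coeff p s = 0" by auto
qed

lemma prime_elem_of_irreducible_d:
  assumes "irreducible\<^sub>d f" shows "prime_elem (of_int_poly f :: rat poly)"
proof -
  have "irreducible\<^sub>d (of_int_poly f :: rat poly)" using assms by (rule irreducible\<^sub>d_int_rat)
  then have "irreducible (of_int_poly f :: rat poly)" by simp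
  then show ?thesis by (rule field_poly_irreducible_imp_prime)
qed

text \<open>Suppose the substituted polynomial is g h. Its Kronecker image is a unit times the
  product of the primes R(t), so up to units the images of g and h are the values at t of the
  products over a submultiset N of M and over its complement. By \<open>nonvanish\<close> no
  coefficient of these products is lost at t, so all their exponents come from monomials of g or h
  and have digits at most d. Hence both products lift to multivariate polynomials with product F. As
  F is irreducible one lift is a unit, and then so is g or h.\<close>

lemma irreducible_substitute:
  fixes F :: "('v::finite, rat) mpoly" and M :: "int poly poly multiset" and d :: nat
  defines "D \<equiv> 2 * d + 1"
  assumes F: "irreducible F" and d: "total_degree F \<le> d"
    and other: "e0 \<in> Poly_Mapping.keys F" "v0 \<noteq> x" "Poly_Mapping.lookup e0 v0 \<noteq> 0"
    and K: "rat_poly2 ([:q:] * prod_mset M) = kron (keep_wt x) (kron_wt x D) F"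
    and M: "\<And>R. R \<in># M \<Longrightarrow> irreducible\<^sub>d (eval_at t R)"
    and q: "poly q t \<noteq> 0"
    and nonvanish: "\<And>N s. N \<subseteq># M \<Longrightarrow> coeff (prod_mset N) s \<noteq> 0 \<Longrightarrow> poly (coeff (prod_mset N) s) t \<noteq> 0"
  shows "irreducible (substitute x (of_int t) F)"
proof -
  let ?o = "of_int_poly :: int poly \<Rightarrow> rat poly"
  define S where "S = substitute x (of_int t) F"
  define k where "k = (kron_eval x D (of_int t) :: ('v, rat) mpoly \<Rightarrow> rat poly)"
  define f where "f R = ?o (eval_at t R)" for R
  have f_eq: "f = (\<lambda>R. ?o (eval_at t R))" by (simp add: f_def fun_eq_iff)
  have D0: "0 < D" by (simp add: D_def)
  have q0: "q \<noteq> 0" using q by auto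
  have Fkey: "Poly_Mapping.lookup e v < D" if "e \<in> Poly_Mapping.keys F" for e v
    using lookup_le_total_degree[OF that, of v] d by (simp add: D_def)
  have k_mult: "k (p * r) = k p * k r" for p r unfolding k_def by (rule kron_eval_hom.hom_mult)
  have kS: "k S = ?o [:poly q t:] * prod_mset (image_mset f M)"
  proof -
    have "k S = kron_eval x D (of_int t) F" unfolding k_def S_def by (rule kron_eval_substitute)
    also have "\<dots> = ?o (eval_at t ([:q:] * prod_mset M))"
      unfolding kron_eval_def K[symmetric] by (rule eval_rat_poly2)
    also have "\<dots> = ?o [:poly q t:] * prod_mset (image_mset f M)"
      unfolding eval_at_mult eval_at_const eval_at_prod_mset of_int_poly_hom.hom_mult of_int_poly_prod_mset
      by (simp add: image_mset.compositionality comp_def f_eq)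
    finally show ?thesis .
  qed
  have qunit: "is_unit (?o [:poly q t:])" using q by (simp add: of_int_poly_const is_unit_const_poly_iff dvd_field_iff)
  have pr: "prime_elem (f R)" if "R \<in># M" for R unfolding f_def by (rule prime_elem_of_irreducible_d[OF M[OF that]])
  \<comment> \<open>The variable \<open>v0\<close> makes the outer degree of the Kronecker image
    positive. So some R occurs, and the substituted polynomial is not a unit.\<close>
  have "M \<noteq> {#}"
  proof
    assume "M = {#}"
    then have "degree (kron (keep_wt x) (kron_wt x D) F) = 0" unfolding K[symmetric] degree_rat_poly2 by simp
    moreover have "weight (kron_wt x D) e0 \<ge> 1"
      using lookup_le_weight[of "kron_wt x D" v0 e0] other D0 by (auto simp: kron_wt_def Suc_le_eq)
    ultimately have "coeff (kron (keep_wt x) (kron_wt x D) F) (weight (kron_wt x D) e0) = 0"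
      by (intro coeff_eq_0) simp
    moreover have "inj_on (\<lambda>e. (weight (keep_wt x) e, weight (kron_wt x D) e)) (Poly_Mapping.keys F)"
      by (rule inj_on_keep_kron) (use Fkey D0 in auto)
    ultimately have "Poly_Mapping.lookup F e0 = 0" using coeff_kron_inj[OF _ other(1)] by fastforce
    then show False using other(1) by (simp add: in_keys_iff)
  qed
  then obtain R0 where R0: "R0 \<in># M" by blast
  have "f R0 dvd k S" unfolding kS using R0 by (intro dvd_mult dvd_prod_mset) auto
  then have kS_nu: "\<not> is_unit (k S)" using pr[OF R0] by (meson dvd_trans prime_elem_def)
  have "f R \<noteq> 0" if "R \<in># M" for R using pr[OF that] unfolding prime_elem_def by blast
  then have kS0: "k S \<noteq> 0" unfolding kS using q by (auto simp: of_int_poly_const)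
  show ?thesis unfolding S_def[symmetric]
  proof (rule irreducibleI)
    show "S \<noteq> 0" using kS0 by (auto simp: k_def)
    show "\<not> S dvd 1"
    proof
      assume "S dvd 1"
      then obtain w where "1 = S * w" by (auto elim: dvdE)
      then have "k S * k w = 1" using k_mult[of S w] by (simp add: k_def)
      then show False using kS_nu by (metis dvd_triv_left)
    qed
    fix g h assume gh: "S = g * h"
    have gh0: "g \<noteq> 0" "h \<noteq> 0" using kS0 gh by (auto simp: k_def)
    have dS: "degree_in {x} S = 0" "total_degree S \<le> d"
    proof -
      have "degree_in {x} S \<le> 0"
      proof (rule degree_in_le)
        fix e assume "e \<in> Poly_Mapping.keys S"
        then obtain e' where "e = Poly_Mapping.update x 0 e'" using keys_substitute[of e x "of_int t" F] unfolding S_def by blast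
        then show "weight (\<lambda>v. if v \<in> {x} then 1 else 0) e \<le> 0"
          unfolding weight_def by (auto simp: lookup_update)
      qed
      then show "degree_in {x} S = 0" by simp
      show "total_degree S \<le> d" using d degree_in_substitute_le[of UNIV x "of_int t" F]
        unfolding S_def total_degree_def by simp
    qed
    have bounds: "Poly_Mapping.lookup e x = 0 \<and> Poly_Mapping.lookup e v \<le> d"
      if "p = g \<or> p = h" "e \<in> Poly_Mapping.keys p" for p e v
    proof -
      have "degree_in {x} p = 0" "total_degree p \<le> d"
        using that(1) dS mpoly_mult_nonzero(2)[OF gh0, of "{x}"] mpoly_mult_nonzero(2)[OF gh0, of UNIV]
        unfolding gh total_degree_def by auto
      then show ?thesis
        using weight_le_degree_in[OF that(2), of "{x}"] lookup_le_weight[of "\<lambda>v. if v \<in> {x} then 1 else 0" x e]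
          lookup_le_total_degree[OF that(2), of v] by auto
    qed
    have "k g * k h = ?o [:poly q t:] * prod_mset (image_mset f M)" using kS gh k_mult by simp
    then have "\<exists>N u1 u2. N \<subseteq># M \<and> is_unit u1 \<and> is_unit u2 \<and>
      k g = u1 * prod_mset (image_mset f N) \<and> k h = u2 * prod_mset (image_mset f (M - N))"
      using pr qunit by (intro prime_product_split)
    then obtain N u1 u2 where N: "N \<subseteq># M" "is_unit u1" "is_unit u2"
      "k g = u1 * prod_mset (image_mset f N)" "k h = u2 * prod_mset (image_mset f (M - N))"
      by (elim exE conjE) (rule that)
    have fprod: "prod_mset (image_mset f N) = ?o (eval_at t (prod_mset N))" for N
      unfolding eval_at_prod_mset of_int_poly_prod_mset
      by (simp add: image_mset.compositionality comp_def f_eq)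
    have supp: "\<exists>e. weight (kron_wt x D) e = s \<and> Poly_Mapping.lookup e x = 0 \<and> (\<forall>v. Poly_Mapping.lookup e v \<le> d)"
      if "p = g \<or> p = h" "k p = u * prod_mset (image_mset f N')" "is_unit u" "N' \<subseteq># M" "coeff (prod_mset N') s \<noteq> 0" for p u N' s
    proof -
      have "coeff (?o (eval_at t (prod_mset N'))) s \<noteq> 0" using nonvanish[OF that(4,5)] by (simp add: coeff_map_poly)
      then have "coeff (k p) s \<noteq> 0" unfolding that(2) fprod using is_unit_mult_degree(2)[OF that(3)] by simp
      then obtain e where "e \<in> Poly_Mapping.keys p" "weight (kron_wt x D) e = s"
        unfolding k_def using coeff_kron_eval_neq_0 by blast
      then show ?thesis using bounds[OF that(1)] by blast
    qed
    have unit: "p dvd 1" if "p = g \<or> p = h" "k p = u * prod_mset (image_mset f N')" "is_unit u" "degree (prod_mset N') = 0" for p u N'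
    proof (rule unit_if_kron_eval_const[of p D x "of_int t"])
      have "degree (k p) = degree (?o (eval_at t (prod_mset N')))"
        unfolding that(2) fprod by (rule is_unit_mult_degree(1)[OF that(3)])
      also have "\<dots> \<le> degree (prod_mset N')" by (simp add: degree_map_poly_le)
      finally show "degree (kron_eval x D (of_int t) p) = 0" using that(4) by (simp add: k_def)
      show "p \<noteq> 0" using that(1) gh0 by blast
      show "Poly_Mapping.lookup e v < D" if "e \<in> Poly_Mapping.keys p" for e v
        using bounds[OF \<open>p = g \<or> p = h\<close> that, of v] by (simp add: D_def)
      show "Poly_Mapping.lookup e x = 0" if "e \<in> Poly_Mapping.keys p" for e
        using bounds[OF \<open>p = g \<or> p = h\<close> that] by blast
    qed (rule D0)
    \<comment> \<open>The part q, free of the outer variable, is assigned to the first factor; this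
      does not change its outer support.\<close>
    define G where "G = [:q:] * prod_mset N"
    define H where "H = prod_mset (M - N)"
    have "\<exists>p. kron (keep_wt x) (kron_wt x D) p = rat_poly2 G \<and>
        (\<forall>e\<in>Poly_Mapping.keys p. \<forall>v. v \<noteq> x \<longrightarrow> Poly_Mapping.lookup e v \<le> d)"
    proof (rule kron_surjective)
      fix s assume "coeff (rat_poly2 G) s \<noteq> 0"
      then have "coeff (prod_mset N) s \<noteq> 0" by (auto simp: G_def coeff_map_poly)
      then show "\<exists>e. weight (kron_wt x D) e = s \<and> Poly_Mapping.lookup e x = 0 \<and> (\<forall>v. Poly_Mapping.lookup e v \<le> d)"
        using supp[of g u1 N s] N by blast
    qed
    then obtain pG where pG: "kron (keep_wt x) (kron_wt x D) pG = rat_poly2 G"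
      "\<forall>e\<in>Poly_Mapping.keys pG. \<forall>v. v \<noteq> x \<longrightarrow> Poly_Mapping.lookup e v \<le> d" by blast
    have "\<exists>p. kron (keep_wt x) (kron_wt x D) p = rat_poly2 H \<and>
        (\<forall>e\<in>Poly_Mapping.keys p. \<forall>v. v \<noteq> x \<longrightarrow> Poly_Mapping.lookup e v \<le> d)"
    proof (rule kron_surjective)
      fix s assume "coeff (rat_poly2 H) s \<noteq> 0"
      then have "coeff (prod_mset (M - N)) s \<noteq> 0" by (auto simp: H_def coeff_map_poly)
      then show "\<exists>e. weight (kron_wt x D) e = s \<and> Poly_Mapping.lookup e x = 0 \<and> (\<forall>v. Poly_Mapping.lookup e v \<le> d)"
        using supp[of h u2 "M - N" s] N by simp
    qed
    then obtain pH where pH: "kron (keep_wt x) (kron_wt x D) pH = rat_poly2 H"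
      "\<forall>e\<in>Poly_Mapping.keys pH. \<forall>v. v \<noteq> x \<longrightarrow> Poly_Mapping.lookup e v \<le> d" by blast
    have "M = N + (M - N)" using N(1) by simp
    then have GH: "G * H = [:q:] * prod_mset M"
      unfolding G_def H_def by (metis mult.assoc prod_mset.union)
    \<comment> \<open>Digits at most d in each factor add up to at most 2 d < D: there is no carry,
      and \<open>kron_injective\<close> applies.\<close>
    have F_eq: "F = pG * pH"
    proof (rule kron_injective[where x = x and D = D])
      show "kron (keep_wt x) (kron_wt x D) F = kron (keep_wt x) (kron_wt x D) (pG * pH)"
        unfolding kron_mult pG(1) pH(1) rat_poly2_mult[symmetric] GH K by simp
      fix e v assume e: "e \<in> Poly_Mapping.keys (pG * pH)" "v \<noteq> x"
      then obtain e1 e2 where "e1 \<in> Poly_Mapping.keys pG" "e2 \<in> Poly_Mapping.keys pH" "e = e1 + e2"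
        using keys_mult[of pG pH] by blast
      then show "Poly_Mapping.lookup e v < D" using pG(2) pH(2) e(2) by (force simp: lookup_add D_def)
    qed (use Fkey D0 in auto)
    have deg0: "degree P = 0" if "p dvd 1" "kron (keep_wt x) (kron_wt x D) p = rat_poly2 P" for p P
    proof -
      obtain w where "1 = p * w" using \<open>p dvd 1\<close> by (auto elim: dvdE)
      then have eq: "rat_poly2 P * kron (keep_wt x) (kron_wt x D) w = 1"
        using kron_mult[of "keep_wt x" "kron_wt x D" p w] kron_1[of "keep_wt x" "kron_wt x D"] that(2) by metis
      then have "rat_poly2 P \<noteq> 0" "kron (keep_wt x) (kron_wt x D) w \<noteq> 0" by auto
      then have "degree (rat_poly2 P) + degree (kron (keep_wt x) (kron_wt x D) w) = 0"
        using arg_cong[OF eq, of degree] by (simp add: degree_mult_eq)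
      then show ?thesis by (simp add: degree_rat_poly2)
    qed
    from irreducibleD[OF F F_eq] show "g dvd 1 \<or> h dvd 1"
    proof
      assume "pG dvd 1"
      then have "degree G = 0" using pG(1) deg0 by blast
      then have "degree (prod_mset N) = 0" using q0 by (simp add: G_def)
      then show ?thesis using unit[of g u1 N] N by blast
    next
      assume "pH dvd 1"
      then have "degree H = 0" using pH(1) deg0 by blast
      then show ?thesis using unit[of h u2 "M - N"] N by (simp add: H_def)
    qed
  qed
qed

section \<open>Counting the bad substitutions for one variable\<close>

lemma abs_poly_le:
  fixes p :: "int poly"
  assumes "degree p \<le> d" "\<And>i. \<bar>coeff p i\<bar> \<le> H" "0 \<le> t" "t \<le> B" "1 \<le> B"
  shows "\<bar>poly p t\<bar> \<le> (int d + 1) * (H * B ^ d)"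
proof -
  have H: "0 \<le> H" using assms(2)[of 0] by linarith
  have "\<bar>poly p t\<bar> \<le> (\<Sum>i\<le>degree p. \<bar>coeff p i * t ^ i\<bar>)" unfolding poly_altdef by (rule sum_abs)
  also have "\<dots> \<le> (\<Sum>i\<le>degree p. H * B ^ d)"
  proof (rule sum_mono)
    fix i assume "i \<in> {..degree p}"
    then have "t ^ i \<le> B ^ i" "B ^ i \<le> B ^ d" using assms by (auto intro: power_mono power_increasing)
    then have "t ^ i \<le> B ^ d" by linarith
    then show "\<bar>coeff p i * t ^ i\<bar> \<le> H * B ^ d"
      using assms H by (auto simp: abs_mult intro!: mult_mono)
  qed
  also have "\<dots> = (int (degree p) + 1) * (H * B ^ d)" by simp
  also have "\<dots> \<le> (int d + 1) * (H * B ^ d)" using assms H by (intro mult_right_mono) auto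
  finally show ?thesis .
qed

lemma size_le_degree_prod_mset:
  fixes M :: "'a::idom poly multiset"
  assumes "\<And>R. R \<in># M \<Longrightarrow> 1 \<le> degree R"
  shows "prod_mset M \<noteq> 0 \<and> size M \<le> degree (prod_mset M)"
  using assms
proof (induction M)
  case (add R M)
  then have "prod_mset M \<noteq> 0" "size M \<le> degree (prod_mset M)" "1 \<le> degree R" "R \<noteq> 0" by force+
  then show ?case by (simp add: degree_mult_eq)
qed auto

lemma degree_0_prod_mset:
  fixes M :: "'a::idom poly multiset"
  assumes "\<And>R. R \<in># M \<Longrightarrow> degree R = 0"
  shows "degree (prod_mset M) = 0"
  using assms
proof (induction M)
  case (add R M)
  then show ?case using degree_mult_le[of R "prod_mset M"] by simp
qed auto

text \<open>The unit and the primes free of the outer variable are collected in q; only the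
  remaining primes can become reducible at t in a way that matters.\<close>

lemma factorization_by_degree:
  fixes K :: "int poly poly"
  assumes "K \<noteq> 0"
  obtains q M where "K = [:q:] * prod_mset M" "\<And>R. R \<in># M \<Longrightarrow> irreducible R \<and> 1 \<le> degree R"
proof -
  obtain A where A: "\<And>R. R \<in># A \<Longrightarrow> prime_elem R" "normalize (prod_mset A) = normalize K"
    using prime_factorization_exists[OF assms] by blast
  obtain u where u: "is_unit u" "K = u * prod_mset A" using associatedE1[OF A(2)[symmetric]] by metis
  define M where "M = filter_mset (\<lambda>R. 1 \<le> degree R) A"
  define C where "C = filter_mset (\<lambda>R. \<not> 1 \<le> degree R) A"
  have "A = M + C" unfolding M_def C_def by (rule multiset_partition)
  then have K: "K = (u * prod_mset C) * prod_mset M" using u(2) by (simp add: mult_ac)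
  have "degree u = 0" using u(1) by (auto simp: is_unit_poly_iff)
  moreover have "degree (prod_mset C) = 0" by (rule degree_0_prod_mset) (auto simp: C_def)
  ultimately have "degree (u * prod_mset C) = 0" using degree_mult_le[of u "prod_mset C"] by simp
  then obtain q where "u * prod_mset C = [:q:]" by (rule degree_eq_zeroE)
  then show ?thesis using that[of q M] K A(1) by (auto simp: M_def prime_elem_imp_irreducible)
qed

text \<open>By \<open>irreducible_substitute\<close> a bad t is a root of the leading coefficient of
  K, or makes one of the at most n factors R reducible, or kills a coefficient of one of the at most
  2^n subproducts. The three summands count these cases.\<close>

lemma card_bad_substitutions_aux:
  fixes x :: "'v::finite" and F :: "('v, rat) mpoly" and H :: int and b d :: nat
  defines "n \<equiv> card (UNIV :: 'v set) * ((2 * d + 1) ^ card (UNIV :: 'v set) * d)"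
  assumes cA: "cA > 0" "\<And>(R::int poly poly) (e::int) (b::nat) X. irreducible R \<Longrightarrow> 1 \<le> degree R \<Longrightarrow> degree R \<le> n \<Longrightarrow>
    (\<forall>i. degree (coeff R i) \<le> d) \<Longrightarrow> 1 \<le> e \<Longrightarrow> 1 \<le> b \<Longrightarrow> X \<subseteq> {0..int b ^ 4} \<Longrightarrow>
    (\<forall>t\<in>X. (\<forall>s. \<bar>coeff (eval_at t R) s\<bar> \<le> e) \<and> \<not> irreducible\<^sub>d (eval_at t R)) \<Longrightarrow>
    real (card X) \<le> cA * (1 + ln (real_of_int e))\<^sup>2 * real b ^ 3"
    and F: "irreducible F" "total_degree F \<le> d" "1 \<le> degree_in (UNIV - {x}) F"
    and H: "\<And>e. \<exists>z. Poly_Mapping.lookup F e = of_int z \<and> \<bar>z\<bar> \<le> H" "1 \<le> H" and b: "1 \<le> b"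
  shows "real (card {t\<in>{0..int b ^ 4}. \<not> irreducible (substitute x (of_int t) F)}) \<le>
    real d + real n * (cA * (1 + ln (real_of_int (2 ^ n * (int n + 1) * ((int d + 1) * (H * (int b ^ 4) ^ d)))))\<^sup>2 * real b ^ 3)
      + 2 ^ n * ((real n + 1) * real d)"
proof -
  define D where "D = 2 * d + 1"
  define kF where "kF = kron (keep_wt x) (kron_wt x D) F"
  \<comment> \<open>Rounding is exact here: the nonzero coefficients of \<open>kF\<close> are
    coefficients of F, hence integers.\<close>
  define K :: "int poly poly" where "K = map_poly (map_poly floor) kF"
  have inj: "inj_on (\<lambda>e. (weight (keep_wt x) e, weight (kron_wt x D) e)) (Poly_Mapping.keys F)"
  proof (rule inj_on_keep_kron)
    fix e v assume "e \<in> Poly_Mapping.keys F"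
    from lookup_le_total_degree[OF this, of v] show "Poly_Mapping.lookup e v < D" using F(2) by (simp add: D_def)
  qed (simp add: D_def)
  note cases = coeff_kron_cases[OF inj, folded kF_def]
  have K_coeff: "coeff (coeff K j) i = \<lfloor>coeff (coeff kF j) i\<rfloor>" for i j
    by (simp add: K_def coeff_map_poly)
  have int: "\<exists>z. coeff (coeff kF j) i = of_int z \<and> \<bar>z\<bar> \<le> H" for i j
    using cases[of j i] H(1) H(2) by (metis abs_0 of_int_0 order_trans zero_le_one)
  have KF: "rat_poly2 K = kF"
  proof (intro poly_eqI)
    fix j i show "coeff (coeff (rat_poly2 K) j) i = coeff (coeff kF j) i"
      using int[of j i] by (auto simp: coeff_map_poly K_coeff)
  qed
  have K_bound: "\<bar>coeff (coeff K j) i\<bar> \<le> H" for i j using int[of j i] by (auto simp: K_coeff)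
  have K_deg: "degree (coeff K j) \<le> d" for j
  proof (rule degree_le, intro allI impI)
    fix i assume i: "d < i"
    have "coeff (coeff kF j) i = 0"
      using cases[of j i] i F(2) lookup_le_total_degree[of _ F x] by (force simp: weight_keep_wt)
    then show "coeff (coeff K j) i = 0" by (simp add: K_coeff)
  qed
  have K_degree: "degree K \<le> n"
  proof (rule degree_le, intro allI impI)
    fix j assume j: "n < j"
    have "weight (kron_wt x D) e \<le> n" if e: "e \<in> Poly_Mapping.keys F" for e
    proof -
      have "weight (kron_wt x D) e \<le> (\<Sum>v\<in>(UNIV::'v set). D ^ card (UNIV :: 'v set) * d)"
        unfolding weight_def
      proof (rule sum_mono)
        fix v :: 'v
        have "kron_wt x D v \<le> D ^ card (UNIV :: 'v set)"
          unfolding kron_wt_def using var_index_less[of v] by (auto simp: D_def intro!: power_increasing)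
        then show "kron_wt x D v * Poly_Mapping.lookup e v \<le> D ^ card (UNIV :: 'v set) * d"
          using lookup_le_total_degree[OF e, of v] F(2) by (intro mult_mono) auto
      qed
      then show ?thesis by (simp add: n_def D_def)
    qed
    then have "coeff (coeff kF j) i = 0" for i using cases[of j i] j by force
    then show "coeff K j = 0" by (intro poly_eqI) (simp add: K_coeff)
  qed
  obtain e0 v0 where e0: "e0 \<in> Poly_Mapping.keys F" "v0 \<noteq> x" "Poly_Mapping.lookup e0 v0 \<noteq> 0"
  proof -
    have "\<exists>e\<in>Poly_Mapping.keys F. \<exists>v. v \<noteq> x \<and> Poly_Mapping.lookup e v \<noteq> 0"
    proof (rule ccontr)
      assume neg: "\<not> ?thesis"
      have "degree_in (UNIV - {x}) F \<le> 0"
        by (rule degree_in_le) (use neg in \<open>auto simp: weight_def\<close>)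
      then show False using F(3) by simp
    qed
    then show ?thesis using that by blast
  qed
  have K0: "K \<noteq> 0"
  proof
    assume "K = 0"
    then have "coeff (coeff kF (weight (kron_wt x D) e0)) (weight (keep_wt x) e0) = 0" using KF by simp
    then show False using coeff_kron_inj[OF inj e0(1)] e0(1) by (simp add: kF_def in_keys_iff)
  qed
  obtain q M where qM: "K = [:q:] * prod_mset M" "\<And>R. R \<in># M \<Longrightarrow> irreducible R \<and> 1 \<le> degree R"
    using factorization_by_degree[OF K0] by blast
  have q0: "q \<noteq> 0" using K0 qM(1) by auto
  have sM: "prod_mset M \<noteq> 0" "size M \<le> degree (prod_mset M)" using size_le_degree_prod_mset[of M] qM(2) by auto
  have size_M: "size M \<le> n" using sM qM(1) K_degree q0 by simp
  have factor: "degree R \<le> n \<and> degree (coeff R i) \<le> d \<and> R \<noteq> 0" if dvd: "R dvd K" for R i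
  proof -
    obtain Q where Q: "K = R * Q" using dvd by (rule dvdE)
    then have nz: "R \<noteq> 0" "Q \<noteq> 0" using K0 by auto
    show ?thesis using dvd_imp_degree_le[OF dvd K0] K_degree degree_coeff_factor_le[OF nz, of d i] K_deg Q nz by auto
  qed
  have sub_dvd: "prod_mset N dvd K" if "N \<subseteq># M" for N
  proof -
    have "prod_mset N dvd prod_mset M" using that by (rule prod_mset_subset_imp_dvd)
    then show ?thesis unfolding qM(1) by (rule dvd_mult)
  qed
  define lc where "lc = lead_coeff K"
  have lc0: "lc \<noteq> 0" using K0 by (simp add: lc_def)
  \<comment> \<open>K(t) has coefficients of size at most (d + 1) H b^(4 d); the factor in front
    comes from \<open>factor_coeff_bound\<close>, as R(t) divides K(t).\<close>
  define e where "e = 2 ^ n * (int n + 1) * ((int d + 1) * (H * (int b ^ 4) ^ d))"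
  have e1: "1 \<le> e" unfolding e_def using H(2) b by (intro one_le_mult one_le_power) auto
  \<comment> \<open>Nonvanishing of lc at t ensures that K(t) is not 0, so that the bound for
    divisors applies.\<close>
  define X where "X R = {t\<in>{0..int b ^ 4}. poly lc t \<noteq> 0 \<and> \<not> irreducible\<^sub>d (eval_at t R)}" for R
  define E where "E = (\<Union>N\<in>{N. N \<subseteq># M}. \<Union>s\<in>{..n}. {t. coeff (prod_mset N) s \<noteq> 0 \<and> poly (coeff (prod_mset N) s) t = 0})"
  define bad where "bad = {t\<in>{0..int b ^ 4}. \<not> irreducible (substitute x (of_int t) F)}"
  have card_X: "real (card (X R)) \<le> cA * (1 + ln (real_of_int e))\<^sup>2 * real b ^ 3" if R: "R \<in># M" for R
  proof (rule cA(2))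
    have RK: "R dvd K" using sub_dvd[of "{#R#}"] R by simp
    show "irreducible R" "1 \<le> degree R" using qM(2)[OF R] by auto
    show "degree R \<le> n" "\<forall>i. degree (coeff R i) \<le> d" using factor[OF RK] by auto
    show "1 \<le> e" "1 \<le> b" by (fact e1 b)+
    show "X R \<subseteq> {0..int b ^ 4}" by (auto simp: X_def)
    show "\<forall>t\<in>X R. (\<forall>s. \<bar>coeff (eval_at t R) s\<bar> \<le> e) \<and> \<not> irreducible\<^sub>d (eval_at t R)"
    proof (intro ballI conjI allI)
      fix t s assume t: "t \<in> X R"
      have tb: "0 \<le> t" "t \<le> int b ^ 4" "poly lc t \<noteq> 0" using t by (auto simp: X_def)
      have "1 \<le> int b ^ 4" using b by (intro one_le_power) auto
      then have Kt: "\<bar>coeff (eval_at t K) s\<bar> \<le> (int d + 1) * (H * (int b ^ 4) ^ d)" for s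
        using abs_poly_le[OF K_deg K_bound tb(1,2)] by (simp add: coeff_map_poly)
      have "coeff (eval_at t K) (degree K) \<noteq> 0" using tb(3) by (simp add: coeff_map_poly lc_def)
      then have Kt0: "eval_at t K \<noteq> 0" by (metis coeff_0)
      have dvd: "eval_at t R dvd eval_at t K"
        using RK by (metis dvd_def eval_at_mult)
      have "degree (eval_at t K) \<le> n" using K_degree degree_map_poly_le order_trans by blast
      from factor_coeff_bound[OF Kt0 dvd this Kt] show "\<bar>coeff (eval_at t R) s\<bar> \<le> e" by (simp add: e_def)
    qed (auto simp: X_def)
  qed
  have finX: "finite (X R)" for R by (rule finite_subset[of _ "{0..int b ^ 4}"]) (auto simp: X_def)
  have card_E: "finite E \<and> card E \<le> 2 ^ n * ((n + 1) * d)"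
  proof -
    have fin: "finite {N. N \<subseteq># M}" "card {N. N \<subseteq># M} \<le> 2 ^ size M" using card_submultisets[of M] by auto
    have Z: "finite {t. coeff (prod_mset N) s \<noteq> 0 \<and> poly (coeff (prod_mset N) s) t = 0} \<and>
       card {t. coeff (prod_mset N) s \<noteq> 0 \<and> poly (coeff (prod_mset N) s) t = 0} \<le> d" if "N \<subseteq># M" for N s
      using card_roots_le[of "coeff (prod_mset N) s"] factor[OF sub_dvd[OF that], of s]
      by (cases "coeff (prod_mset N) s = 0") auto
    have Zs: "card (\<Union>s\<in>{..n}. {t. coeff (prod_mset N) s \<noteq> 0 \<and> poly (coeff (prod_mset N) s) t = 0}) \<le> (n + 1) * d"
      if "N \<subseteq># M" for N
    proof -
      have "card (\<Union>s\<in>{..n}. {t. coeff (prod_mset N) s \<noteq> 0 \<and> poly (coeff (prod_mset N) s) t = 0}) \<le>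
        (\<Sum>s\<in>{..n}. card {t. coeff (prod_mset N) s \<noteq> 0 \<and> poly (coeff (prod_mset N) s) t = 0})"
        by (rule card_UN_le) simp
      also have "\<dots> \<le> (\<Sum>s\<in>{..n}. d)" using Z[OF that] by (intro sum_mono) blast
      finally show ?thesis by simp
    qed
    have "card E \<le> (\<Sum>N\<in>{N. N \<subseteq># M}. card (\<Union>s\<in>{..n}. {t. coeff (prod_mset N) s \<noteq> 0 \<and> poly (coeff (prod_mset N) s) t = 0}))"
      unfolding E_def by (rule card_UN_le[OF fin(1)])
    also have "\<dots> \<le> (\<Sum>N\<in>{N. N \<subseteq># M}. (n + 1) * d)" using Zs by (intro sum_mono) blast
    also have "\<dots> = card {N. N \<subseteq># M} * ((n + 1) * d)" by simp
    also have "\<dots> \<le> 2 ^ n * ((n + 1) * d)"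
    proof (rule mult_right_mono)
      have "(2::nat) ^ size M \<le> 2 ^ n" using size_M by (intro power_increasing) auto
      then show "card {N. N \<subseteq># M} \<le> 2 ^ n" using fin(2) by linarith
    qed simp
    finally show ?thesis using fin(1) Z unfolding E_def by blast
  qed
  have bad: "bad \<subseteq> {t. poly lc t = 0} \<union> (\<Union>R\<in>set_mset M. X R) \<union> E"
  proof
    fix t assume t: "t \<in> bad"
    show "t \<in> {t. poly lc t = 0} \<union> (\<Union>R\<in>set_mset M. X R) \<union> E"
    proof (rule ccontr)
      assume neg: "t \<notin> {t. poly lc t = 0} \<union> (\<Union>R\<in>set_mset M. X R) \<union> E"
      have tb: "t \<in> {0..int b ^ 4}" using t by (auto simp: bad_def)
      have lct: "poly lc t \<noteq> 0" using neg by auto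
      have "irreducible (substitute x (of_int t) F)"
      proof (rule irreducible_substitute[OF F(1,2) e0, where q = q and M = M])
        show "rat_poly2 ([:q:] * prod_mset M) = kron (keep_wt x) (kron_wt x (2 * d + 1)) F"
          using KF unfolding qM(1)[symmetric] kF_def D_def .
        show "irreducible\<^sub>d (eval_at t R)" if "R \<in># M" for R
          using neg that tb lct by (auto simp: X_def)
        have "lc = q * lead_coeff (prod_mset M)" unfolding lc_def qM(1) by (simp add: lead_coeff_mult)
        then show "poly q t \<noteq> 0" using lct by auto
        fix N s assume N: "N \<subseteq># M" "coeff (prod_mset N) s \<noteq> 0"
        then have "s \<le> n" using le_degree[OF N(2)] factor[OF sub_dvd[OF N(1)], of 0] by linarith
        then show "poly (coeff (prod_mset N) s) t \<noteq> 0" using neg N by (auto simp: E_def)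
      qed
      then show False using t by (simp add: bad_def)
    qed
  qed
  have roots: "finite {t. poly lc t = 0}" "card {t. poly lc t = 0} \<le> d"
    using card_roots_le[OF lc0] K_deg[of "degree K"] by (auto simp: lc_def)
  have "card bad \<le> card ({t. poly lc t = 0} \<union> (\<Union>R\<in>set_mset M. X R) \<union> E)"
    using roots finX card_E by (intro card_mono bad) auto
  also have "\<dots> \<le> card {t. poly lc t = 0} + card (\<Union>R\<in>set_mset M. X R) + card E"
    by (meson card_Un_le add_le_mono order_refl order_trans)
  finally have 1: "real (card bad) \<le> real (card {t. poly lc t = 0}) + real (card (\<Union>R\<in>set_mset M. X R)) + real (card E)"
    by linarith
  have 2: "real (card (\<Union>R\<in>set_mset M. X R)) \<le> real n * (cA * (1 + ln (real_of_int e))\<^sup>2 * real b ^ 3)"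
  proof -
    have "card (\<Union>R\<in>set_mset M. X R) \<le> (\<Sum>R\<in>set_mset M. card (X R))" by (rule card_UN_le) simp
    then have "real (card (\<Union>R\<in>set_mset M. X R)) \<le> (\<Sum>R\<in>set_mset M. real (card (X R)))"
      unfolding of_nat_sum[symmetric] of_nat_le_iff .
    also have "\<dots> \<le> (\<Sum>R\<in>set_mset M. cA * (1 + ln (real_of_int e))\<^sup>2 * real b ^ 3)"
      using card_X by (intro sum_mono) auto
    also have "\<dots> = real (card (set_mset M)) * (cA * (1 + ln (real_of_int e))\<^sup>2 * real b ^ 3)" by simp
    also have "\<dots> \<le> real n * (cA * (1 + ln (real_of_int e))\<^sup>2 * real b ^ 3)"
    proof (rule mult_right_mono)
      have "card (set_mset M) \<le> size M" by (induction M) (auto simp: card_insert_if)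
      then show "real (card (set_mset M)) \<le> real n" using size_M by simp
    qed (use cA(1) in auto)
    finally show ?thesis .
  qed
  have 3: "real (card {t. poly lc t = 0}) \<le> real d" using roots by simp
  have 4: "real (card E) \<le> 2 ^ n * ((real n + 1) * real d)"
  proof -
    have "real (card E) \<le> real (2 ^ n * ((n + 1) * d))" using card_E unfolding of_nat_le_iff by blast
    then show ?thesis by (simp add: algebra_simps)
  qed
  show ?thesis using 1 2 3 4 unfolding bad_def e_def by linarith
qed

text \<open>With L = 1 + ln H + ln b, the quantity 1 + ln e for the coefficient bound e is at most a
  constant times L, and the terms free of b are absorbed because L^2 b^3 >= 1.\<close>

lemma card_bad_substitutions:
  "\<exists>c>0. \<forall>(x::'v::finite) (F::('v, rat) mpoly) (H::int) (b::nat). irreducible F \<longrightarrow> total_degree F \<le> d \<longrightarrow>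
    1 \<le> degree_in (UNIV - {x}) F \<longrightarrow> (\<forall>e. \<exists>z. Poly_Mapping.lookup F e = of_int z \<and> \<bar>z\<bar> \<le> H) \<longrightarrow> 1 \<le> H \<longrightarrow> 1 \<le> b \<longrightarrow>
    real (card {t\<in>{0..int b ^ 4}. \<not> irreducible (substitute x (of_int t) F)}) \<le> c * (1 + ln (real_of_int H) + ln (real b))\<^sup>2 * real b ^ 3"
proof -
  define n where "n = card (UNIV :: 'v set) * ((2 * d + 1) ^ card (UNIV :: 'v set) * d)"
  obtain cA where cA: "cA > 0" "\<forall>(R::int poly poly) (e::int) (b::nat) X. irreducible R \<longrightarrow> 1 \<le> degree R \<longrightarrow> degree R \<le> n \<longrightarrow>
    (\<forall>i. degree (coeff R i) \<le> d) \<longrightarrow> 1 \<le> e \<longrightarrow> 1 \<le> b \<longrightarrow> X \<subseteq> {0..int b ^ 4} \<longrightarrow>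
    (\<forall>t\<in>X. (\<forall>s. \<bar>coeff (eval_at t R) s\<bar> \<le> e) \<and> \<not> irreducible\<^sub>d (eval_at t R)) \<longrightarrow>
    real (card X) \<le> cA * (1 + ln (real_of_int e))\<^sup>2 * real b ^ 3"
    using card_reducible_specializations[of n d] by blast
  define A where "A = 2 ^ n * (real n + 1) * (real d + 1)"
  have A1: "A \<ge> 1" unfolding A_def by (intro one_le_mult one_le_power) auto
  define k where "k = 1 + ln A + 4 * real d"
  have k1: "k \<ge> 1" using A1 by (simp add: k_def)
  define c where "c = real d + real n * (cA * k\<^sup>2) + 2 ^ n * ((real n + 1) * real d) + 1"
  have c0: "c > 0" unfolding c_def using cA(1) by (intro add_nonneg_pos add_nonneg_nonneg mult_nonneg_nonneg) auto
  have "real (card {t\<in>{0..int b ^ 4}. \<not> irreducible (substitute x (of_int t) F)}) \<le> c * (1 + ln (real_of_int H) + ln (real b))\<^sup>2 * real b ^ 3"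
    if F: "irreducible F" "total_degree F \<le> d" "1 \<le> degree_in (UNIV - {x}) F"
      and H: "\<forall>e. \<exists>z. Poly_Mapping.lookup F e = of_int z \<and> \<bar>z\<bar> \<le> H" "1 \<le> H" and b: "1 \<le> b"
    for x :: 'v and F :: "('v, rat) mpoly" and H :: int and b :: nat
  proof -
    define e where "e = real_of_int (2 ^ n * (int n + 1) * ((int d + 1) * (H * (int b ^ 4) ^ d)))"
    define L where "L = 1 + ln (real_of_int H) + ln (real b)"
    have lH: "0 \<le> ln (real_of_int H)" and lb: "0 \<le> ln (real b)" using H b by auto
    have L1: "1 \<le> L" using lH lb by (simp add: L_def)
    have "e = A * (real_of_int H * real b ^ (4 * d))"
      unfolding power_mult by (simp add: e_def A_def mult_ac)
    then have "ln e = ln A + (ln (real_of_int H) + real (4 * d) * ln (real b))"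
      using A1 H(2) b by (simp add: ln_mult ln_realpow)
    then have "1 + ln e \<le> k * L"
    proof -
      assume le: "ln e = ln A + (ln (real_of_int H) + real (4 * d) * ln (real b))"
      have lA: "0 \<le> ln A" using A1 by simp
      have "k * L = L + ln A * L + 4 * real d * L" by (simp add: k_def algebra_simps)
      moreover have "ln A * 1 \<le> ln A * L" using lA L1 by (intro mult_left_mono) auto
      moreover have "4 * real d * ln (real b) \<le> 4 * real d * L" using lH by (intro mult_left_mono) (auto simp: L_def)
      ultimately show ?thesis using le lb by (simp add: L_def)
    qed
    moreover have "0 \<le> 1 + ln e"
    proof -
      have "1 \<le> 2 ^ n * (int n + 1) * ((int d + 1) * (H * (int b ^ 4) ^ d))"
        using H(2) b by (intro one_le_mult one_le_power) auto
      then have "1 \<le> e" unfolding e_def of_int_1_le_iff .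
      then show ?thesis by simp
    qed
    ultimately have sq: "(1 + ln e)\<^sup>2 \<le> k\<^sup>2 * L\<^sup>2" using power_mono[of "1 + ln e" "k * L" 2] by (simp add: power_mult_distrib)
    have Lb: "1 \<le> L\<^sup>2 * real b ^ 3" using L1 b by (intro one_le_mult one_le_power) auto
    have "real (card {t\<in>{0..int b ^ 4}. \<not> irreducible (substitute x (of_int t) F)}) \<le>
      real d + real n * (cA * (1 + ln e)\<^sup>2 * real b ^ 3) + 2 ^ n * ((real n + 1) * real d)"
      unfolding e_def n_def
      by (rule card_bad_substitutions_aux[OF cA(1) _ F _ H(2) b]) (use cA(2) H(1) in \<open>auto simp: n_def\<close>)
    also have "\<dots> \<le> real d * (L\<^sup>2 * real b ^ 3) + real n * (cA * (k\<^sup>2 * L\<^sup>2) * real b ^ 3)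
        + 2 ^ n * ((real n + 1) * real d) * (L\<^sup>2 * real b ^ 3)"
    proof (intro add_mono mult_left_mono mult_right_mono sq)
      show "real d \<le> real d * (L\<^sup>2 * real b ^ 3)" using mult_left_mono[OF Lb, of "real d"] by simp
      show "2 ^ n * ((real n + 1) * real d) \<le> 2 ^ n * ((real n + 1) * real d) * (L\<^sup>2 * real b ^ 3)"
        using mult_left_mono[OF Lb, of "2 ^ n * ((real n + 1) * real d)"] by simp
    qed (use cA(1) in auto)
    also have "\<dots> = (c - 1) * (L\<^sup>2 * real b ^ 3)" by (simp add: c_def algebra_simps)
    also have "\<dots> \<le> c * (L\<^sup>2 * real b ^ 3)" by (intro mult_right_mono) auto
    finally show ?thesis by (simp add: L_def mult.assoc)
  qed
  then show ?thesis using c0 by blast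
qed

section \<open>Specializing all parameters\<close>

definition substitute_set :: "'v set \<Rightarrow> ('v \<Rightarrow> 'a) \<Rightarrow> ('v, 'a::comm_semiring_1) mpoly \<Rightarrow> ('v, 'a) mpoly" where
  "substitute_set S c = mp_eval mconst (\<lambda>v. if v \<in> S then mconst (c v) else var v)"

interpretation substitute_hom: comm_semiring_hom "substitute x c"
  by standard (auto simp: substitute_def mconst_hom.mp_eval_add mconst_hom.mp_eval_mult)

lemma substitute_mconst: "substitute x c (mconst k) = mconst k"
  by (simp add: substitute_def mconst_hom.mp_eval_const)

lemma mp_eval_mconst_var: "mp_eval mconst X (var v) = X v"
  by (simp add: var_def mp_eval_single monomial_value_def)

lemma substitute_var: "substitute x c (var v) = (if v = x then mconst c else var v)"
  unfolding substitute_def by (rule mp_eval_mconst_var)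

lemma substitute_set_insert:
  assumes "x \<notin> S"
  shows "substitute x k (substitute_set S c p) = substitute_set (insert x S) (c(x := k)) p"
  unfolding substitute_set_def substitute_hom.mp_eval_hom
  by (rule mp_eval_cong) (use assms in \<open>auto simp: substitute_mconst substitute_var\<close>)

lemma substitute_set_empty: "substitute_set {} c p = p"
  unfolding substitute_set_def by (simp add: mp_eval_var)

text \<open>For e free of x, this is the coefficient of e when p is read as a polynomial in the
  variables other than x.\<close>

definition coeff_poly :: "'v \<Rightarrow> ('v, 'a::comm_ring_1) mpoly \<Rightarrow> ('v \<Rightarrow>\<^sub>0 nat) \<Rightarrow> 'a poly" where
  "coeff_poly x p e = (\<Sum>e'\<in>{e'\<in>Poly_Mapping.keys p. Poly_Mapping.update x 0 e' = e}.
     monom (Poly_Mapping.lookup p e') (Poly_Mapping.lookup e' x))"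

lemma lookup_substitute: "Poly_Mapping.lookup (substitute x c p) e = poly (coeff_poly x p e) c"
proof -
  have "Poly_Mapping.lookup (substitute x c p) e = (\<Sum>e'\<in>Poly_Mapping.keys p.
      if Poly_Mapping.update x 0 e' = e then Poly_Mapping.lookup p e' * c ^ Poly_Mapping.lookup e' x else 0)"
    unfolding substitute_eq_sum lookup_sum by (intro sum.cong refl) (auto simp: lookup_single when_def)
  also have "\<dots> = poly (coeff_poly x p e) c"
    unfolding coeff_poly_def poly_sum poly_monom by (subst sum.inter_filter) auto
  finally show ?thesis .
qed

lemma update_eq_imp_eq:
  assumes "Poly_Mapping.update x 0 e = Poly_Mapping.update x 0 e'" "Poly_Mapping.lookup e x = Poly_Mapping.lookup e' x"
  shows "e = e'"
proof (rule poly_mapping_eqI)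
  fix v
  show "Poly_Mapping.lookup e v = Poly_Mapping.lookup e' v"
    using assms(2) arg_cong[OF assms(1), of "\<lambda>f. Poly_Mapping.lookup f v"] by (cases "v = x") (auto simp: lookup_update)
qed

lemma coeff_coeff_poly:
  "coeff (coeff_poly x p e) i = 0 \<or>
     (\<exists>e'\<in>Poly_Mapping.keys p. Poly_Mapping.lookup e' x = i \<and> coeff (coeff_poly x p e) i = Poly_Mapping.lookup p e')"
proof (cases "\<exists>e'\<in>Poly_Mapping.keys p. Poly_Mapping.update x 0 e' = e \<and> Poly_Mapping.lookup e' x = i")
  case True
  then obtain e' where e': "e' \<in> Poly_Mapping.keys p" "Poly_Mapping.update x 0 e' = e" "Poly_Mapping.lookup e' x = i" by blast
  have "coeff (coeff_poly x p e) i = (\<Sum>f\<in>{f\<in>Poly_Mapping.keys p. Poly_Mapping.update x 0 f = e}. if f = e' then Poly_Mapping.lookup p f else 0)"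
    unfolding coeff_poly_def coeff_sum
  proof (intro sum.cong refl)
    fix f assume "f \<in> {f\<in>Poly_Mapping.keys p. Poly_Mapping.update x 0 f = e}"
    then have "f = e'" if "Poly_Mapping.lookup f x = i" using update_eq_imp_eq[of x f e'] e' that by simp
    then show "coeff (monom (Poly_Mapping.lookup p f) (Poly_Mapping.lookup f x)) i = (if f = e' then Poly_Mapping.lookup p f else 0)"
      by (cases "f = e'") (auto simp: e'(3))
  qed
  also have "\<dots> = Poly_Mapping.lookup p e'" using e' by simp
  finally show ?thesis using e' by blast
next
  case False
  then have "coeff (coeff_poly x p e) i = 0"
    unfolding coeff_poly_def coeff_sum by (intro sum.neutral) auto
  then show ?thesis by blast
qed

lemma coeff_poly_neq_0:
  assumes "e \<in> Poly_Mapping.keys p" shows "coeff_poly x p (Poly_Mapping.update x 0 e) \<noteq> 0"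
proof -
  have "coeff (coeff_poly x p (Poly_Mapping.update x 0 e)) (Poly_Mapping.lookup e x) =
     (\<Sum>f\<in>{f\<in>Poly_Mapping.keys p. Poly_Mapping.update x 0 f = Poly_Mapping.update x 0 e}. if f = e then Poly_Mapping.lookup p f else 0)"
    unfolding coeff_poly_def coeff_sum by (intro sum.cong refl) (auto dest: update_eq_imp_eq)
  also have "\<dots> = Poly_Mapping.lookup p e" using assms by simp
  finally have "coeff (coeff_poly x p (Poly_Mapping.update x 0 e)) (Poly_Mapping.lookup e x) \<noteq> 0"
    using assms by (simp add: in_keys_iff)
  then show ?thesis by (metis coeff_0)
qed

lemma degree_coeff_poly_le: "degree (coeff_poly x p e) \<le> total_degree (p :: ('v::finite, 'a::comm_ring_1) mpoly)"
proof (rule degree_le, intro allI impI)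
  fix i assume i: "total_degree p < i"
  show "coeff (coeff_poly x p e) i = 0"
    using coeff_coeff_poly[of x p e i] lookup_le_total_degree[of _ p x] i by (auto simp: not_le[symmetric])
qed

text \<open>The excluded t are roots of a nonzero coefficient polynomial. Following one monomial in
  this way preserves a positive degree in Y as well as the nonvanishing of P.\<close>

lemma card_vanishing_substitutions:
  fixes p :: "('v::finite, rat) mpoly" and x :: 'v
  assumes "e \<in> Poly_Mapping.keys p"
  defines "Z \<equiv> {t::int. Poly_Mapping.update x 0 e \<notin> Poly_Mapping.keys (substitute x (of_int t) p)}"
  shows "finite Z \<and> card Z \<le> total_degree p"
proof -
  define Q where "Q = coeff_poly x p (Poly_Mapping.update x 0 e)"
  have Q: "Q \<noteq> 0" unfolding Q_def by (rule coeff_poly_neq_0[OF assms(1)])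
  have sub: "of_int ` Z \<subseteq> {c. poly Q c = 0}"
    by (auto simp: Z_def Q_def in_keys_iff lookup_substitute)
  have inj: "inj_on (of_int :: int \<Rightarrow> rat) Z" by (simp add: inj_on_def)
  have fin: "finite (of_int ` Z :: rat set)" using sub poly_roots_finite[OF Q] finite_subset by blast
  have "card Z = card (of_int ` Z :: rat set)" using card_image[OF inj] by simp
  also have "\<dots> \<le> card {c. poly Q c = 0}" using sub poly_roots_finite[OF Q] by (rule card_mono[rotated])
  also have "\<dots> \<le> degree Q" by (rule poly_roots_degree[OF Q])
  also have "\<dots> \<le> total_degree p" unfolding Q_def by (rule degree_coeff_poly_le)
  finally show ?thesis using fin inj finite_imageD by blast
qed

lemma substitute_coeff_bound:
  fixes p :: "('v::finite, rat) mpoly"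
  assumes "total_degree p \<le> d" "\<And>e. \<exists>z. Poly_Mapping.lookup p e = of_int z \<and> \<bar>z\<bar> \<le> H" "0 \<le> t" "t \<le> B" "1 \<le> B"
  shows "\<exists>z. Poly_Mapping.lookup (substitute x (of_int t) p) e = of_int z \<and> \<bar>z\<bar> \<le> (int d + 1) * (H * B ^ d)"
proof -
  define Q :: "int poly" where "Q = map_poly floor (coeff_poly x p e)"
  have H0: "0 \<le> H" using assms(2) by (meson abs_ge_zero order_trans)
  have int: "\<exists>z. coeff (coeff_poly x p e) i = of_int z \<and> \<bar>z\<bar> \<le> H" for i
  proof (cases "coeff (coeff_poly x p e) i = 0")
    case True
    then show ?thesis using H0 by (intro exI[of _ 0]) simp
  next
    case False
    then show ?thesis using coeff_coeff_poly[of x p e i] assms(2) by metis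
  qed
  have Q: "coeff (coeff_poly x p e) i = of_int (coeff Q i)" "\<bar>coeff Q i\<bar> \<le> H" for i
    using int[of i] by (auto simp: Q_def coeff_map_poly)
  have "of_int_poly Q = coeff_poly x p e" by (rule poly_eqI) (simp add: Q coeff_map_poly)
  then have "Poly_Mapping.lookup (substitute x (of_int t) p) e = of_int (poly Q t)"
    unfolding lookup_substitute by (metis of_int_hom.poly_map_poly)
  moreover have "degree Q \<le> d"
    using degree_map_poly_le[of floor "coeff_poly x p e"] degree_coeff_poly_le[of x p e] assms(1) unfolding Q_def by linarith
  then have "\<bar>poly Q t\<bar> \<le> (int d + 1) * (H * B ^ d)"
    using abs_poly_le[OF _ Q(2) assms(3-5)] by blast
  ultimately show ?thesis by blast
qed

lemma degree_in_mono:
  fixes p :: "('v::finite, 'a::zero) mpoly"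
  assumes "V \<subseteq> W" shows "degree_in V p \<le> degree_in W p"
proof (rule degree_in_le)
  fix e assume e: "e \<in> Poly_Mapping.keys p"
  have "weight (\<lambda>v. if v \<in> V then 1 else 0) e \<le> weight (\<lambda>v. if v \<in> W then 1 else 0) e"
    unfolding weight_def using assms by (intro sum_mono) auto
  then show "weight (\<lambda>v. if v \<in> V then 1 else 0) e \<le> degree_in W p"
    using weight_le_degree_in[OF e, of W] by linarith
qed

lemma exists_key_degree_in:
  fixes p :: "('v::finite, 'a::zero) mpoly"
  assumes "1 \<le> degree_in V p"
  shows "\<exists>e\<in>Poly_Mapping.keys p. 1 \<le> weight (\<lambda>v. if v \<in> V then 1 else 0) e"
proof (rule ccontr)
  assume "\<not> ?thesis"
  then have "degree_in V p \<le> 0" by (intro degree_in_le) (simp add: not_le)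
  then show False using assms by simp
qed

text \<open>The interval has B + 1 elements, so exceptional sets of total size at most B leave one
  of them.\<close>

lemma exists_not_in_small_union:
  fixes Z :: "nat \<Rightarrow> int set" and Y :: "nat \<Rightarrow> int set"
  assumes "finite I" "\<And>i. i \<in> I \<Longrightarrow> finite (Z i) \<and> real (card (Z i)) \<le> z" "\<And>i. i \<in> I \<Longrightarrow> finite (Y i) \<and> real (card (Y i)) \<le> y"
    "finite X" "real (card X) \<le> w" "real (card I) * z + real (card I) * y + w \<le> real B"
  shows "\<exists>t\<in>{0..int B}. t \<notin> X \<and> (\<forall>i\<in>I. t \<notin> Z i \<and> t \<notin> Y i)"
proof (rule ccontr)
  assume neg: "\<not> ?thesis"
  have sub: "{0..int B} \<subseteq> (\<Union>i\<in>I. Z i) \<union> (\<Union>i\<in>I. Y i) \<union> X" using neg by blast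
  have "card {0..int B} \<le> card ((\<Union>i\<in>I. Z i) \<union> (\<Union>i\<in>I. Y i) \<union> X)"
    using assms by (intro card_mono sub) auto
  also have "\<dots> \<le> card (\<Union>i\<in>I. Z i) + card (\<Union>i\<in>I. Y i) + card X"
    by (meson card_Un_le add_le_mono order_refl order_trans)
  finally have 1: "real (card {0..int B}) \<le> real (card (\<Union>i\<in>I. Z i)) + real (card (\<Union>i\<in>I. Y i)) + real (card X)" by linarith
  have union: "real (card (\<Union>i\<in>I. A i)) \<le> real (card I) * a" if "\<And>i. i \<in> I \<Longrightarrow> real (card (A i)) \<le> a" for A :: "nat \<Rightarrow> int set" and a
  proof -
    have "card (\<Union>i\<in>I. A i) \<le> (\<Sum>i\<in>I. card (A i))" by (rule card_UN_le[OF assms(1)])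
    then have "real (card (\<Union>i\<in>I. A i)) \<le> (\<Sum>i\<in>I. real (card (A i)))"
      unfolding of_nat_sum[symmetric] of_nat_le_iff .
    also have "\<dots> \<le> (\<Sum>i\<in>I. a)" using that by (intro sum_mono) auto
    finally show ?thesis by simp
  qed
  have "real (card (\<Union>i\<in>I. Z i)) \<le> real (card I) * z" "real (card (\<Union>i\<in>I. Y i)) \<le> real (card I) * y"
    using assms(2,3) by (intro union; blast)+
  moreover have "real (card {0..int B}) = real B + 1" by simp
  ultimately show False using 1 assms(5,6) by linarith
qed

lemma irreducible_mconst_mult:
  fixes p :: "('v::finite, 'a::field) mpoly"
  assumes "irreducible p" "c \<noteq> 0" shows "irreducible (mconst c * p)"
proof -
  define u v where "u = (mconst c :: ('v, 'a) mpoly)" and "v = (mconst (inverse c) :: ('v, 'a) mpoly)"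
  have uv: "v * u = 1" using assms(2) by (simp add: u_def v_def mult_single)
  have p: "p = v * (u * p)" using uv by (simp add: mult.assoc[symmetric])
  show ?thesis unfolding u_def[symmetric]
  proof (rule irreducibleI)
    show "u * p \<noteq> 0" using p assms(1) by auto
    show "\<not> u * p dvd 1"
      using irreducible_not_unit[OF assms(1)] dvd_mult_right by blast
    fix a b assume "u * p = a * b"
    then have "p = (v * a) * b" using p by (simp add: mult.assoc)
    then have "v * a dvd 1 \<or> b dvd 1" using irreducibleD[OF assms(1)] by blast
    then show "a dvd 1 \<or> b dvd 1" using dvd_mult_right by blast
  qed
qed

lemma lookup_mconst_mult: "Poly_Mapping.lookup (mconst c * p) e = c * Poly_Mapping.lookup p e"
proof -
  have "mconst c * p = (\<Sum>f\<in>Poly_Mapping.keys p. Poly_Mapping.single f (c * Poly_Mapping.lookup p f))"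
    by (subst mpoly_sum_monomials[of p, symmetric]) (simp add: sum_distrib_left mult_single)
  then show ?thesis by (simp add: lookup_sum lookup_single when_def in_keys_iff)
qed

lemma specialize_mconst_mult: "specialize t (mconst c * p) = mconst c * specialize t p"
  for p :: "('r::finite + 'n::finite, 'a::comm_semiring_1) mpoly"
  by (simp add: specialize_eq_mp_eval mconst_hom.mp_eval_mult mconst_hom.mp_eval_const)

text \<open>\<open>substitute_set\<close> stays in the ring in T and Y, whereas
  \<open>specialize\<close> lands in the ring in Y alone. The inclusion \<iota> of the smaller ring
  carries factorisations over, and the retraction \<rho>, which sends T to 0, brings units
  back.\<close>

lemma irreducible_specialize:
  fixes F :: "('r::finite + 'n::finite, rat) mpoly"
  assumes "irreducible (substitute_set (range Inl) c F)" "\<And>j. c (Inl j) = t j"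
  shows "irreducible (specialize t F)"
proof -
  define \<iota> :: "('n, rat) mpoly \<Rightarrow> ('r + 'n, rat) mpoly" where "\<iota> = mp_eval mconst (\<lambda>k. var (Inr k))"
  define \<rho> :: "('r + 'n, rat) mpoly \<Rightarrow> ('n, rat) mpoly" where "\<rho> = mp_eval mconst (case_sum (\<lambda>_. 0) var)"
  interpret \<iota>: comm_semiring_hom \<iota>
    by standard (auto simp: \<iota>_def mconst_hom.mp_eval_add mconst_hom.mp_eval_mult)
  interpret \<rho>: comm_semiring_hom \<rho>
    by standard (auto simp: \<rho>_def mconst_hom.mp_eval_add mconst_hom.mp_eval_mult)
  have c: "\<iota> (mconst k) = mconst k" "\<rho> (mconst k) = mconst k" for k
    by (auto simp: \<iota>_def \<rho>_def mconst_hom.mp_eval_const)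
  have v: "\<iota> (var k) = var (Inr k)" for k unfolding \<iota>_def by (rule mp_eval_mconst_var)
  have \<rho>\<iota>: "\<rho> (\<iota> p) = p" for p
  proof -
    have "\<rho> (\<iota> p) = mp_eval mconst var p"
      unfolding \<iota>_def \<rho>.mp_eval_hom by (rule mp_eval_cong) (auto simp: c, simp add: \<rho>_def mp_eval_mconst_var)
    then show ?thesis by (simp add: mp_eval_var)
  qed
  have \<iota>F: "\<iota> (specialize t F) = substitute_set (range Inl) c F"
    unfolding specialize_eq_mp_eval substitute_set_def \<iota>.mp_eval_hom
    by (rule mp_eval_cong) (use assms(2) c v in \<open>auto split: sum.split\<close>)
  have unit: "p dvd 1" if dvd: "\<iota> p dvd 1" for p
  proof -
    obtain w where "1 = \<iota> p * w" using dvd by (rule dvdE)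
    then have "1 = \<rho> (\<iota> p) * \<rho> w" using \<rho>.hom_mult \<rho>.hom_one by metis
    then show ?thesis unfolding \<rho>\<iota> by (rule dvdI)
  qed
  show ?thesis
  proof (rule irreducibleI)
    show "specialize t F \<noteq> 0"
    proof
      assume "specialize t F = 0"
      then have "substitute_set (range Inl) c F = 0" using \<iota>F \<iota>.hom_zero by metis
      then show False using assms(1) by simp
    qed
    show "\<not> specialize t F dvd 1"
    proof
      assume "specialize t F dvd 1"
      then obtain w where "1 = specialize t F * w" by (rule dvdE)
      then have "1 = substitute_set (range Inl) c F * \<iota> w" using \<iota>F \<iota>.hom_mult \<iota>.hom_one by metis
      then have "substitute_set (range Inl) c F dvd 1" by (rule dvdI)
      then show False using assms(1) irreducible_not_unit by blast
    qed
    fix a b assume "specialize t F = a * b"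
    then have "substitute_set (range Inl) c F = \<iota> a * \<iota> b" using \<iota>F \<iota>.hom_mult by metis
    then show "a dvd 1 \<or> b dvd 1" using irreducibleD[OF assms(1)] unit by blast
  qed
qed

lemma substitute_set_UNIV: "substitute_set UNIV c p = mconst (eval_mpoly c p)"
  unfolding eval_mpoly_eq substitute_set_def mconst_hom.mp_eval_hom by simp

text \<open>The coefficient bound of \<open>substitute_coeff_bound\<close> with B = b^4, iterated
  once per substituted variable.\<close>

fun height_step :: "nat \<Rightarrow> nat \<Rightarrow> int \<Rightarrow> nat \<Rightarrow> int" where
  "height_step d b H 0 = H"
| "height_step d b H (Suc k) = (int d + 1) * (height_step d b H k * (int b ^ 4) ^ d)"

lemma height_step_ge_1: "1 \<le> H \<Longrightarrow> 1 \<le> b \<Longrightarrow> 1 \<le> height_step d b H k"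
  by (induction k) (auto intro!: one_le_mult one_le_power)

lemma ln_height_step:
  assumes "1 \<le> H" "1 \<le> b"
  shows "ln (real_of_int (height_step d b H k)) = ln (real_of_int H) + real k * (ln (real d + 1) + 4 * real d * ln (real b))"
proof (induction k)
  case (Suc k)
  define h where "h = real_of_int (height_step d b H k)"
  have h: "h > 0" using height_step_ge_1[OF assms, of d k] by (simp add: h_def)
  have "ln (real_of_int (height_step d b H (Suc k))) = ln ((real d + 1) * (h * (real b ^ 4) ^ d))"
    by (simp add: h_def)
  also have "\<dots> = ln (real d + 1) + (ln h + ln (real b ^ (4 * d)))"
    using h assms(2) by (simp add: ln_mult power_mult)
  also have "ln (real b ^ (4 * d)) = 4 * real d * ln (real b)" using assms(2) by (simp add: ln_realpow)
  finally show ?case using Suc by (simp add: h_def algebra_simps)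
qed simp

text \<open>Induction on the set A of parameters already replaced. For the next parameter three
  kinds of values are excluded: those that make some polynomial reducible (Z), those that destroy a
  chosen monomial of positive Y-degree (Y), and those that destroy a chosen monomial of what is left
  of P (X). The surviving Y-degree is what permits the next application of the count C.\<close>

lemma specialize_variables:
  fixes F :: "nat \<Rightarrow> ('r::finite + 'n::finite, rat) mpoly" and P :: "('r, rat) mpoly" and A :: "'r set"
  assumes C: "\<And>(x::'r + 'n) (F::('r + 'n, rat) mpoly) (H::int) (b::nat). irreducible F \<Longrightarrow> total_degree F \<le> d \<Longrightarrow>
    1 \<le> degree_in (UNIV - {x}) F \<Longrightarrow> (\<forall>e. \<exists>z. Poly_Mapping.lookup F e = of_int z \<and> \<bar>z\<bar> \<le> H) \<Longrightarrow> 1 \<le> H \<Longrightarrow> 1 \<le> b \<Longrightarrow>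
    real (card {t\<in>{0..int b ^ 4}. \<not> irreducible (substitute x (of_int t) F)}) \<le> C * (1 + ln (real_of_int H) + ln (real b))\<^sup>2 * real b ^ 3"
    and F: "\<And>i. i \<in> {1..m} \<Longrightarrow> irreducible (F i) \<and> total_degree (F i) \<le> d \<and> 1 \<le> degree_in (range Inr) (F i) \<and>
      (\<forall>e. \<exists>z. Poly_Mapping.lookup (F i) e = of_int z \<and> \<bar>z\<bar> \<le> H)"
    and P: "P \<noteq> 0" "total_degree P \<le> s"
    and H: "1 \<le> H" and b: "1 \<le> b"
    and size: "\<And>k. k < card (UNIV :: 'r set) \<Longrightarrow> real m * (C * (1 + ln (real_of_int (height_step d b H k)) + ln (real b))\<^sup>2 * real b ^ 3)
       + real m * real d + real s \<le> real b ^ 4"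
    and A: "finite A"
  shows "\<exists>t :: 'r \<Rightarrow> int. (\<forall>j. 0 \<le> t j \<and> t j \<le> int b ^ 4) \<and>
    (\<forall>i\<in>{1..m}. irreducible (substitute_set (Inl ` A) (\<lambda>v. of_int (case_sum t (\<lambda>_. 0) v)) (F i)) \<and>
       total_degree (substitute_set (Inl ` A) (\<lambda>v. of_int (case_sum t (\<lambda>_. 0) v)) (F i)) \<le> d \<and>
       1 \<le> degree_in (range Inr) (substitute_set (Inl ` A) (\<lambda>v. of_int (case_sum t (\<lambda>_. 0) v)) (F i)) \<and>
       (\<forall>e. \<exists>z. Poly_Mapping.lookup (substitute_set (Inl ` A) (\<lambda>v. of_int (case_sum t (\<lambda>_. 0) v)) (F i)) e = of_int z
          \<and> \<bar>z\<bar> \<le> height_step d b H (card A))) \<and>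
    substitute_set A (\<lambda>j. of_int (t j)) P \<noteq> 0 \<and> total_degree (substitute_set A (\<lambda>j. of_int (t j)) P) \<le> s"
  using A
proof (induction A rule: finite_induct)
  case empty
  show ?case using F P by (intro exI[of _ "\<lambda>_. 0"]) (auto simp: substitute_set_empty)
next
  case (insert j A)
  obtain t where t: "\<And>j. 0 \<le> t j \<and> t j \<le> int b ^ 4"
    and tF: "\<And>i. i \<in> {1..m} \<Longrightarrow> irreducible (substitute_set (Inl ` A) (\<lambda>v. of_int (case_sum t (\<lambda>_. 0) v)) (F i)) \<and>
       total_degree (substitute_set (Inl ` A) (\<lambda>v. of_int (case_sum t (\<lambda>_. 0) v)) (F i)) \<le> d \<and>
       1 \<le> degree_in (range Inr) (substitute_set (Inl ` A) (\<lambda>v. of_int (case_sum t (\<lambda>_. 0) v)) (F i)) \<and>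
       (\<forall>e. \<exists>z. Poly_Mapping.lookup (substitute_set (Inl ` A) (\<lambda>v. of_int (case_sum t (\<lambda>_. 0) v)) (F i)) e = of_int z
          \<and> \<bar>z\<bar> \<le> height_step d b H (card A))"
    and tP: "substitute_set A (\<lambda>j. of_int (t j)) P \<noteq> 0" "total_degree (substitute_set A (\<lambda>j. of_int (t j)) P) \<le> s"
    using insert.IH by blast
  define G where "G i = substitute_set (Inl ` A) (\<lambda>v. of_int (case_sum t (\<lambda>_. 0) v)) (F i)" for i
  define Q where "Q = substitute_set A (\<lambda>j. of_int (t j)) P"
  define h where "h = height_step d b H (card A)"
  define x where "x = (Inl j :: 'r + 'n)"
  note tF = tF[folded G_def h_def] and tP = tP[folded Q_def]
  have h1: "1 \<le> h" unfolding h_def by (rule height_step_ge_1[OF H b])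
  have "\<exists>e\<in>Poly_Mapping.keys (G i). 1 \<le> weight (\<lambda>v. if v \<in> range Inr then 1 else 0) e" if "i \<in> {1..m}" for i
    using tF[OF that] by (intro exists_key_degree_in) blast
  then obtain e where e: "\<And>i. i \<in> {1..m} \<Longrightarrow> e i \<in> Poly_Mapping.keys (G i) \<and> 1 \<le> weight (\<lambda>v. if v \<in> range Inr then 1 else 0) (e i)"
    by metis
  have "Poly_Mapping.keys Q \<noteq> {}" using tP(1) by simp
  then obtain f where f: "f \<in> Poly_Mapping.keys Q" by blast
  define Z where "Z i = {\<tau>\<in>{0..int b ^ 4}. \<not> irreducible (substitute x (of_int \<tau>) (G i))}" for i
  define Y where "Y i = {\<tau>. Poly_Mapping.update x 0 (e i) \<notin> Poly_Mapping.keys (substitute x (of_int \<tau>) (G i))}" for i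
  define X where "X = {\<tau>. Poly_Mapping.update j 0 f \<notin> Poly_Mapping.keys (substitute j (of_int \<tau>) Q)}"
  have "\<exists>\<tau>\<in>{0..int (b ^ 4)}. \<tau> \<notin> X \<and> (\<forall>i\<in>{1..m}. \<tau> \<notin> Z i \<and> \<tau> \<notin> Y i)"
  proof (rule exists_not_in_small_union)
    fix i assume i: "i \<in> {1..m}"
    have "range Inr \<subseteq> UNIV - {x}" by (auto simp: x_def)
    from degree_in_mono[OF this, of "G i"] have "1 \<le> degree_in (UNIV - {x}) (G i)"
      using tF[OF i] by linarith
    then have "real (card (Z i)) \<le> C * (1 + ln (real_of_int h) + ln (real b))\<^sup>2 * real b ^ 3"
      unfolding Z_def using tF[OF i] h1 b by (intro C) auto
    moreover have "finite (Z i)" by (rule finite_subset[of _ "{0..int b ^ 4}"]) (auto simp: Z_def)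
    ultimately show "finite (Z i) \<and> real (card (Z i)) \<le> C * (1 + ln (real_of_int h) + ln (real b))\<^sup>2 * real b ^ 3" by blast
    have "finite (Y i) \<and> card (Y i) \<le> total_degree (G i)" unfolding Y_def
      using e[OF i] by (intro card_vanishing_substitutions) blast
    then show "finite (Y i) \<and> real (card (Y i)) \<le> real d" using tF[OF i] by auto
  next
    have "finite X \<and> card X \<le> total_degree Q" unfolding X_def by (rule card_vanishing_substitutions[OF f])
    then show "finite X" "real (card X) \<le> real s" using tP by auto
    have "card A < card (UNIV :: 'r set)"
      using insert.hyps by (intro psubset_card_mono) auto
    from size[OF this] show "real (card {1..m}) * (C * (1 + ln (real_of_int h) + ln (real b))\<^sup>2 * real b ^ 3) + real (card {1..m}) * real d + real s \<le> real (b ^ 4)"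
      by (simp add: h_def)
  qed simp
  then obtain \<tau> where \<tau>: "0 \<le> \<tau>" "\<tau> \<le> int b ^ 4" "\<tau> \<notin> X" "\<And>i. i \<in> {1..m} \<Longrightarrow> \<tau> \<notin> Z i" "\<And>i. i \<in> {1..m} \<Longrightarrow> \<tau> \<notin> Y i"
    by auto
  define t' where "t' = t(j := \<tau>)"
  have xA: "x \<notin> Inl ` A" using insert.hyps by (auto simp: x_def)
  have newF: "substitute_set (Inl ` insert j A) (\<lambda>v. of_int (case_sum t' (\<lambda>_. 0) v)) (F i) = substitute x (of_int \<tau>) (G i)" for i
  proof -
    have "(\<lambda>v. of_int (case_sum t' (\<lambda>_. 0) v)) = (\<lambda>v. rat_of_int (case_sum t (\<lambda>_. 0) v))(x := of_int \<tau>)"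
      by (auto simp: fun_eq_iff t'_def x_def split: sum.split)
    then show ?thesis unfolding G_def substitute_set_insert[OF xA] by (simp add: x_def)
  qed
  have newP: "substitute_set (insert j A) (\<lambda>j. of_int (t' j)) P = substitute j (of_int \<tau>) Q"
  proof -
    have "(\<lambda>j. of_int (t' j)) = (\<lambda>j. rat_of_int (t j))(j := of_int \<tau>)" by (auto simp: t'_def)
    then show ?thesis unfolding Q_def substitute_set_insert[OF insert.hyps(2)] by simp
  qed
  have cA: "card (insert j A) = Suc (card A)" using insert.hyps by simp
  show ?case
  proof (intro exI[of _ t'] conjI ballI)
    show "\<forall>j. 0 \<le> t' j \<and> t' j \<le> int b ^ 4" using t \<tau> by (simp add: t'_def)
    show "substitute_set (insert j A) (\<lambda>j. of_int (t' j)) P \<noteq> 0"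
      unfolding newP using \<tau>(3) by (auto simp: X_def)
    show "total_degree (substitute_set (insert j A) (\<lambda>j. of_int (t' j)) P) \<le> s"
      unfolding newP using tP(2) degree_in_substitute_le[of UNIV j "of_int \<tau>" Q] by (simp add: total_degree_def)
    fix i assume i: "i \<in> {1..m}"
    show "irreducible (substitute_set (Inl ` insert j A) (\<lambda>v. of_int (case_sum t' (\<lambda>_. 0) v)) (F i))"
      unfolding newF using \<tau>(1,2) \<tau>(4)[OF i] by (simp add: Z_def)
    show "total_degree (substitute_set (Inl ` insert j A) (\<lambda>v. of_int (case_sum t' (\<lambda>_. 0) v)) (F i)) \<le> d"
      unfolding newF using tF[OF i] degree_in_substitute_le[of UNIV x "of_int \<tau>" "G i"] by (simp add: total_degree_def)
    show "1 \<le> degree_in (range Inr) (substitute_set (Inl ` insert j A) (\<lambda>v. of_int (case_sum t' (\<lambda>_. 0) v)) (F i))"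
    proof -
      have key: "Poly_Mapping.update x 0 (e i) \<in> Poly_Mapping.keys (substitute x (of_int \<tau>) (G i))"
        using \<tau>(5)[OF i] by (simp add: Y_def)
      have "weight (\<lambda>v. if v \<in> range Inr then 1 else 0) (Poly_Mapping.update x 0 (e i)) = weight (\<lambda>v. if v \<in> range Inr then 1 else 0) (e i)"
        unfolding weight_def by (intro sum.cong refl) (auto simp: lookup_update x_def)
      then show ?thesis unfolding newF
        using e[OF i] weight_le_degree_in[OF key, of "range Inr"] by linarith
    qed
    show "\<forall>e. \<exists>z. Poly_Mapping.lookup (substitute_set (Inl ` insert j A) (\<lambda>v. of_int (case_sum t' (\<lambda>_. 0) v)) (F i)) e = of_int z
          \<and> \<bar>z\<bar> \<le> height_step d b H (card (insert j A))"
      unfolding newF cA height_step.simps h_def[symmetric]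
      using tF[OF i] \<tau>(1,2) b by (intro allI substitute_coeff_bound) auto
  qed
qed

text \<open>From b >= u^3 follows u <= w with w = b^(1/3). So (u + ln b)^2 is at most w^2 (1 + ln
  b)^2, and the third factor w of b pays for the logarithms; the cube of u leaves this room. Each of
  the two summands gets half of b^4.\<close>

lemma polylog_size:
  fixes c :: real
  assumes "0 \<le> c"
  shows "\<exists>\<kappa>\<ge>1. \<forall>u b. 1 \<le> u \<longrightarrow> \<kappa> * u ^ 3 \<le> b \<longrightarrow> c * (u + ln b)\<^sup>2 * b ^ 3 + c * u \<le> b ^ 4"
proof -
  have "\<forall>\<^sub>F b in at_top. 2 * c * (1 + ln b)\<^sup>2 \<le> b powr (1/3)" by real_asymp
  then obtain b1 where b1: "\<And>b. b \<ge> b1 \<Longrightarrow> 2 * c * (1 + ln b)\<^sup>2 \<le> b powr (1/3)"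
    unfolding eventually_at_top_linorder by blast
  \<comment> \<open>\<open>b1\<close> brings b into the range of the asymptotic estimate, 1 gives b
    >= u^3, and \<open>2 * c\<close> takes care of the linear term.\<close>
  define \<kappa> where "\<kappa> = max b1 (max 1 (2 * c))"
  have \<kappa>: "\<kappa> \<ge> 1" "\<kappa> \<ge> b1" "\<kappa> \<ge> 2 * c" by (auto simp: \<kappa>_def)
  have "c * (u + ln b)\<^sup>2 * b ^ 3 + c * u \<le> b ^ 4" if u: "1 \<le> u" and b: "\<kappa> * u ^ 3 \<le> b" for u b
  proof -
    have u3: "1 \<le> u ^ 3" using u by simp
    have "\<kappa> * 1 \<le> \<kappa> * u ^ 3" using u3 \<kappa> by (intro mult_left_mono) auto
    then have b\<kappa>: "\<kappa> \<le> b" using b by linarith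
    then have b_1: "1 \<le> b" using \<kappa> by linarith
    have "1 * u ^ 3 \<le> \<kappa> * u ^ 3" using u3 \<kappa> u by (intro mult_right_mono) auto
    then have ub: "u ^ 3 \<le> b" using b by linarith
    define w where "w = b powr (1/3)"
    have w0: "0 \<le> w" by (simp add: w_def)
    have "w ^ 3 = (b powr (1/3)) powr real 3" using b_1 by (subst powr_realpow) (auto simp: w_def)
    also have "\<dots> = b" using b_1 by (simp add: powr_powr)
    finally have w3: "w ^ 3 = b" .
    have uw: "u \<le> w"
    proof (rule ccontr)
      assume "\<not> u \<le> w"
      then have "w ^ 3 < u ^ 3" using w0 by (intro power_strict_mono) auto
      then show False using ub w3 by simp
    qed
    have lb: "0 \<le> ln b" using b_1 by simp
    have "u + ln b \<le> u * (1 + ln b)" using u lb mult_right_mono[of 1 u "ln b"] by (simp add: algebra_simps)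
    then have "(u + ln b)\<^sup>2 \<le> (u * (1 + ln b))\<^sup>2" using u lb by (intro power_mono) auto
    also have "\<dots> = u\<^sup>2 * (1 + ln b)\<^sup>2" by (rule power_mult_distrib)
    also have "\<dots> \<le> w\<^sup>2 * (1 + ln b)\<^sup>2" using uw u by (intro mult_right_mono power_mono) auto
    finally have "2 * c * (u + ln b)\<^sup>2 \<le> 2 * c * (w\<^sup>2 * (1 + ln b)\<^sup>2)" using assms by (intro mult_left_mono) auto
    also have "\<dots> = w\<^sup>2 * (2 * c * (1 + ln b)\<^sup>2)" by (simp add: algebra_simps)
    also have "\<dots> \<le> w\<^sup>2 * w" using b1[of b] b\<kappa> \<kappa> by (intro mult_left_mono) (auto simp: w_def)
    also have "\<dots> = b" using w3 by (simp add: power_numeral_reduce)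
    finally have "2 * c * (u + ln b)\<^sup>2 * b ^ 3 \<le> b * b ^ 3" using b_1 by (intro mult_right_mono) auto
    moreover have "b * b ^ 3 = b ^ 4" by (simp add: power_numeral_reduce)
    moreover have "2 * c * (u + ln b)\<^sup>2 * b ^ 3 = 2 * (c * (u + ln b)\<^sup>2 * b ^ 3)" by (simp only: mult.assoc)
    ultimately have 1: "2 * (c * (u + ln b)\<^sup>2 * b ^ 3) \<le> b ^ 4" by linarith
    have "u * 1 \<le> u * u\<^sup>2" using u by (intro mult_left_mono) auto
    then have "u \<le> b" using ub by (simp add: power_numeral_reduce)
    moreover have "2 * c \<le> b" using b\<kappa> \<kappa> by linarith
    ultimately have "(2 * c) * u \<le> b * b" using assms u by (intro mult_mono) auto
    also have "\<dots> \<le> b ^ 4" using b_1 power_increasing[of 2 4 b] by (simp add: power2_eq_square)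
    finally show ?thesis using 1 by linarith
  qed
  then show ?thesis using \<kappa>(1) by blast
qed

text \<open>The multiplier is the one that makes p primitive and integral. It is a unit of the
  polynomial ring, so passing to the multiple does not affect irreducibility.\<close>

lemma coeff_height_multiple:
  fixes p :: "('v, rat) mpoly"
  assumes "p \<noteq> 0"
  shows "1 \<le> coeff_height p \<and> (\<exists>c. c \<noteq> 0 \<and> (\<forall>e. \<exists>z. Poly_Mapping.lookup (mconst c * p) e = of_int z \<and> \<bar>z\<bar> \<le> coeff_height p))"
proof -
  obtain q where q: "primitive_multiple p q" using primitive_multiple_exists[OF assms] by blast
  then obtain c where c: "c \<noteq> 0" "\<And>k. of_int (Poly_Mapping.lookup q k) = c * Poly_Mapping.lookup p k"
    by (auto simp: primitive_multiple_def)
  define S where "S = (\<lambda>k. \<bar>Poly_Mapping.lookup q k\<bar>) ` Poly_Mapping.keys q"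
  have h: "coeff_height p = Max S" unfolding S_def by (rule coeff_height_eq[OF q])
  have key: "k \<in> Poly_Mapping.keys q \<longleftrightarrow> k \<in> Poly_Mapping.keys p" for k
  proof -
    have "Poly_Mapping.lookup q k = 0 \<longleftrightarrow> (of_int (Poly_Mapping.lookup q k) :: rat) = 0" by simp
    also have "\<dots> \<longleftrightarrow> Poly_Mapping.lookup p k = 0" unfolding c(2) using c(1) by simp
    finally show ?thesis by (simp add: in_keys_iff)
  qed
  have fin: "finite S" by (simp add: S_def)
  have "Poly_Mapping.keys p \<noteq> {}" using assms by simp
  then obtain k where "k \<in> Poly_Mapping.keys p" by blast
  then have k: "k \<in> Poly_Mapping.keys q" using key by blast
  then have "\<bar>Poly_Mapping.lookup q k\<bar> \<le> Max S" using fin by (intro Max_ge) (auto simp: S_def)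
  moreover have "1 \<le> \<bar>Poly_Mapping.lookup q k\<bar>" using k by (simp add: in_keys_iff)
  ultimately have h1: "1 \<le> coeff_height p" unfolding h by linarith
  have "\<bar>Poly_Mapping.lookup q e\<bar> \<le> coeff_height p" for e
  proof (cases "e \<in> Poly_Mapping.keys q")
    case True
    then show ?thesis unfolding h using fin by (intro Max_ge) (auto simp: S_def)
  next
    case False
    then show ?thesis using h1 by (simp add: in_keys_iff)
  qed
  then have "\<exists>z. Poly_Mapping.lookup (mconst c * p) e = of_int z \<and> \<bar>z\<bar> \<le> coeff_height p" for e
    by (intro exI[of _ "Poly_Mapping.lookup q e"]) (simp add: lookup_mconst_mult c(2))
  then show ?thesis using h1 c(1) by blast
qed

section \<open>The bounding polynomial and its degree\<close>

definition degree_bounded :: "'v set \<Rightarrow> nat \<Rightarrow> ('v, 'a::zero) mpoly \<Rightarrow> bool" where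
  "degree_bounded S n p \<longleftrightarrow> (\<forall>e\<in>Poly_Mapping.keys p. Poly_Mapping.keys e \<subseteq> S \<and> (\<Sum>v\<in>S. Poly_Mapping.lookup e v) \<le> n)"

lemma degree_bounded_mult:
  assumes "degree_bounded S n p" "degree_bounded S k q"
  shows "degree_bounded S (n + k) (p * q)"
  unfolding degree_bounded_def
proof
  fix e assume "e \<in> Poly_Mapping.keys (p * q)"
  then obtain a b where ab: "a \<in> Poly_Mapping.keys p" "b \<in> Poly_Mapping.keys q" "e = a + b"
    using keys_mult[of p q] by blast
  have "Poly_Mapping.keys a \<subseteq> S \<and> (\<Sum>v\<in>S. Poly_Mapping.lookup a v) \<le> n"
    "Poly_Mapping.keys b \<subseteq> S \<and> (\<Sum>v\<in>S. Poly_Mapping.lookup b v) \<le> k"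
    using assms ab(1,2) by (auto simp: degree_bounded_def)
  moreover have "(\<Sum>v\<in>S. Poly_Mapping.lookup e v) = (\<Sum>v\<in>S. Poly_Mapping.lookup a v) + (\<Sum>v\<in>S. Poly_Mapping.lookup b v)"
    by (simp add: ab(3) lookup_add sum.distrib)
  ultimately show "Poly_Mapping.keys e \<subseteq> S \<and> (\<Sum>v\<in>S. Poly_Mapping.lookup e v) \<le> n + k"
    using Poly_Mapping.keys_add[of a b] ab(3) by auto
qed

lemma degree_bounded_add:
  assumes "degree_bounded S n p" "degree_bounded S n q"
  shows "degree_bounded S n (p + q)"
  using assms Poly_Mapping.keys_add[of p q] unfolding degree_bounded_def by blast

lemma degree_bounded_const: "degree_bounded S n (mconst c)"
  by (simp add: degree_bounded_def)

lemma degree_bounded_var: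
  fixes v :: 'v
  assumes "finite S" "v \<in> S" shows "degree_bounded S 1 (var v :: ('v, 'a::comm_semiring_1) mpoly)"
proof -
  have "(\<Sum>w\<in>S. Poly_Mapping.lookup (Poly_Mapping.single v (1::nat)) w) = (\<Sum>w\<in>S. if w = v then 1 else 0)"
    by (intro sum.cong refl) (auto simp: lookup_single when_def)
  then show ?thesis using assms by (auto simp: degree_bounded_def var_def)
qed

lemma degree_bounded_power:
  fixes p :: "('v, 'a::comm_semiring_1) mpoly"
  assumes "degree_bounded S n p" shows "degree_bounded S (k * n) (p ^ k)"
proof (induction k)
  case 0
  show ?case using degree_bounded_const[of S 0 "1 :: 'a"] by (simp add: single_one)
next
  case (Suc k)
  then show ?case using degree_bounded_mult[OF assms Suc] by simp
qed

lemma degree_bounded_sum: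
  "(\<And>i. i \<in> I \<Longrightarrow> degree_bounded S n (p i)) \<Longrightarrow> degree_bounded S n (\<Sum>i\<in>I. p i)"
  by (induction I rule: infinite_finite_induct) (auto intro: degree_bounded_add simp: degree_bounded_def[of _ _ 0])

lemma degree_bounded_imp:
  assumes "degree_bounded S n p" "finite S"
  shows "mpoly_vars p \<subseteq> S" "total_degree p \<le> n"
proof -
  show "mpoly_vars p \<subseteq> S" using assms(1) by (auto simp: mpoly_vars_def degree_bounded_def)
  have "(\<Sum>v\<in>Poly_Mapping.keys e. Poly_Mapping.lookup e v) \<le> n" if "e \<in> Poly_Mapping.keys p" for e
  proof -
    have e: "Poly_Mapping.keys e \<subseteq> S" "(\<Sum>v\<in>S. Poly_Mapping.lookup e v) \<le> n"
      using assms(1) that unfolding degree_bounded_def by blast+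
    have "(\<Sum>v\<in>Poly_Mapping.keys e. Poly_Mapping.lookup e v) \<le> (\<Sum>v\<in>S. Poly_Mapping.lookup e v)"
      by (rule sum_mono2[OF assms(2) e(1)]) (rule le0)
    then show ?thesis using e(2) by (rule order_trans)
  qed
  then show "total_degree p \<le> n" by (auto simp: total_degree_def degree_in_def)
qed

lemma comm_semiring_hom_ident: "comm_semiring_hom (\<lambda>c :: 'a :: comm_semiring_1. c)"
  by standard auto

interpretation eval_mpoly_hom: comm_semiring_hom "eval_mpoly X"
  by standard (auto simp: eval_mpoly_eq comm_semiring_hom.mp_eval_0[OF comm_semiring_hom_ident] comm_semiring_hom.mp_eval_add[OF comm_semiring_hom_ident] comm_semiring_hom.mp_eval_mult[OF comm_semiring_hom_ident]
      comm_semiring_hom.mp_eval_1[OF comm_semiring_hom_ident])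

lemma eval_mpoly_var: "eval_mpoly X (var v) = X v"
  by (simp add: eval_mpoly_eq var_def mp_eval_single monomial_value_def)

lemma eval_mpoly_const: "eval_mpoly X (mconst c) = c"
  by (simp add: eval_mpoly_eq comm_semiring_hom.mp_eval_const[OF comm_semiring_hom_ident])

text \<open>With u = 1 + (sum of the logarithmic heights) + s its value is (2 \<kappa> u^3)^4, a
  bound for b^4 when b is \<kappa> u^3 rounded up. Variable m + 1 stands for s.\<close>

definition bound_poly :: "nat \<Rightarrow> real \<Rightarrow> (nat, real) mpoly" where
  "bound_poly m \<kappa> = mconst (16 * \<kappa> ^ 4) * (1 + (\<Sum>i\<in>{1..m+1}. var i)) ^ 12"

lemma bound_poly_degree: "mpoly_vars (bound_poly m \<kappa>) \<subseteq> {1..m+1} \<and> total_degree (bound_poly m \<kappa>) \<le> 30"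
proof -
  have 1: "degree_bounded {1..m+1} 1 (1 :: (nat, real) mpoly)"
    using degree_bounded_const[of "{1..m+1}" 1 "1::real"] by (simp add: single_one)
  have 2: "degree_bounded {1..m+1} 1 (\<Sum>i\<in>{1..m+1}. var i :: (nat, real) mpoly)"
    by (intro degree_bounded_sum degree_bounded_var) auto
  have "degree_bounded {1..m+1} (0 + 12 * 1) (bound_poly m \<kappa>)"
    unfolding bound_poly_def
    by (intro degree_bounded_mult degree_bounded_power degree_bounded_add degree_bounded_const 1 2)
  from degree_bounded_imp[OF this] show ?thesis by simp
qed

lemma eval_bound_poly:
  "eval_mpoly X (bound_poly m \<kappa>) = 16 * \<kappa> ^ 4 * (1 + (\<Sum>i\<in>{1..m}. X i) + X (m + 1)) ^ 12"
  unfolding bound_poly_def eval_mpoly_hom.hom_mult eval_mpoly_hom.hom_power eval_mpoly_hom.hom_add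
    eval_mpoly_hom.hom_sum eval_mpoly_hom.hom_one eval_mpoly_var eval_mpoly_const
  by (simp add: add.assoc)

theorem corollary1p11:
  shows "\<exists>C::real. 0 < C \<and>
    (\<forall>m d. 1 \<le> m \<and> 1 \<le> d \<longrightarrow>
      (\<exists>G :: (nat, real) mpoly. mpoly_vars G \<subseteq> {1..m+1} \<and> total_degree G \<le> 30 \<and>
        (\<forall>F :: nat \<Rightarrow> ('r::finite + 'n::finite, rat) mpoly.
          (\<forall>i\<in>{1..m}. irreducible (F i) \<and> total_degree (F i) \<le> d \<and>
             1 \<le> degree_in (range Inr) (F i)) \<longrightarrow>
          (\<forall>s::nat. 1 \<le> s \<longrightarrow>
            (\<forall>P :: ('r, rat) mpoly. 1 \<le> total_degree P \<and> total_degree P \<le> s \<longrightarrow>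
              (\<exists>t :: 'r \<Rightarrow> int.
                 (\<forall>j. 0 \<le> t j) \<and>
                 (\<lambda>j. of_int (t j)) \<notin> rational_zeros P \<and>
                 of_int (height_tuple t) \<le>
                   C * eval_mpoly (\<lambda>i. if i \<le> m then ln (of_int (coeff_height (F i))) else of_nat s) G \<and>
                 (\<forall>i\<in>{1..m}. irreducible (specialize (\<lambda>j. of_int (t j)) (F i)))))))))"
proof (rule exI[of _ "1::real"], rule conjI, simp, intro allI impI)
  \<comment> \<open>The constant C is 1: the coefficients of G may depend on the numbers of
    variables, on m and on d, and they take up all constants through \<kappa>.\<close>
  fix m d :: nat
  assume md: "1 \<le> m \<and> 1 \<le> d"
  obtain C where C: "C > 0" "\<forall>(x::'r + 'n) (F::('r + 'n, rat) mpoly) (H::int) (b::nat). irreducible F \<longrightarrow> total_degree F \<le> d \<longrightarrow>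
    1 \<le> degree_in (UNIV - {x}) F \<longrightarrow> (\<forall>e. \<exists>z. Poly_Mapping.lookup F e = of_int z \<and> \<bar>z\<bar> \<le> H) \<longrightarrow> 1 \<le> H \<longrightarrow> 1 \<le> b \<longrightarrow>
    real (card {t\<in>{0..int b ^ 4}. \<not> irreducible (substitute x (of_int t) F)}) \<le> C * (1 + ln (real_of_int H) + ln (real b))\<^sup>2 * real b ^ 3"
    using card_bad_substitutions[of d, where 'v = "'r + 'n"] by blast
  define \<rho> where "\<rho> = card (UNIV :: 'r set)"
  \<comment> \<open>\<open>c2\<close> bounds, in multiples of u + ln b, the logarithm of the
    coefficient bound during the at most \<rho> substitutions; \<open>c\<close> also pays for the
    terms m d + s of the count.\<close>
  define c2 where "c2 = 1 + real \<rho> * ln (real d + 1) + 4 * real d * real \<rho>"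
  define c where "c = real m * (C * c2\<^sup>2) + real m * real d + 1"
  have l0: "0 \<le> ln (real d + 1)" by simp
  have c0: "0 \<le> c" using C(1) by (auto simp: c_def intro!: add_nonneg_nonneg mult_nonneg_nonneg)
  obtain \<kappa> where \<kappa>: "\<kappa> \<ge> 1" "\<forall>u b. 1 \<le> u \<longrightarrow> \<kappa> * u ^ 3 \<le> b \<longrightarrow> c * (u + ln b)\<^sup>2 * b ^ 3 + c * u \<le> b ^ 4"
    using polylog_size[OF c0] by blast
  show "\<exists>G :: (nat, real) mpoly. mpoly_vars G \<subseteq> {1..m+1} \<and> total_degree G \<le> 30 \<and>
        (\<forall>F :: nat \<Rightarrow> ('r::finite + 'n::finite, rat) mpoly.
          (\<forall>i\<in>{1..m}. irreducible (F i) \<and> total_degree (F i) \<le> d \<and>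
             1 \<le> degree_in (range Inr) (F i)) \<longrightarrow>
          (\<forall>s::nat. 1 \<le> s \<longrightarrow>
            (\<forall>P :: ('r, rat) mpoly. 1 \<le> total_degree P \<and> total_degree P \<le> s \<longrightarrow>
              (\<exists>t :: 'r \<Rightarrow> int.
                 (\<forall>j. 0 \<le> t j) \<and>
                 (\<lambda>j. of_int (t j)) \<notin> rational_zeros P \<and>
                 of_int (height_tuple t) \<le>
                   1 * eval_mpoly (\<lambda>i. if i \<le> m then ln (of_int (coeff_height (F i))) else of_nat s) G \<and>
                 (\<forall>i\<in>{1..m}. irreducible (specialize (\<lambda>j. of_int (t j)) (F i)))))))"
  proof (rule exI[of _ "bound_poly m \<kappa>"], rule conjI[OF conjunct1[OF bound_poly_degree] conjI[OF conjunct2[OF bound_poly_degree]]],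
      intro allI impI)
    fix F :: "nat \<Rightarrow> ('r + 'n, rat) mpoly" and s :: nat and P :: "('r, rat) mpoly"
    assume F: "\<forall>i\<in>{1..m}. irreducible (F i) \<and> total_degree (F i) \<le> d \<and> 1 \<le> degree_in (range Inr) (F i)"
      and s: "1 \<le> s" and P: "1 \<le> total_degree P \<and> total_degree P \<le> s"
    define h where "h i = coeff_height (F i)" for i
    have "F i \<noteq> 0" if "i \<in> {1..m}" for i using F that by auto
    from coeff_height_multiple[OF this] have h1: "1 \<le> h i" and
      "\<exists>c. c \<noteq> 0 \<and> (\<forall>e. \<exists>z. Poly_Mapping.lookup (mconst c * F i) e = of_int z \<and> \<bar>z\<bar> \<le> h i)" if "i \<in> {1..m}" for i
      using that by (auto simp: h_def)
    then obtain k where k: "\<And>i. i \<in> {1..m} \<Longrightarrow> k i \<noteq> 0 \<and> (\<forall>e. \<exists>z. Poly_Mapping.lookup (mconst (k i) * F i) e = of_int z \<and> \<bar>z\<bar> \<le> h i)"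
      by metis
    define F' where "F' i = mconst (k i) * F i" for i
    \<comment> \<open>One bound for all the F i. The product is taken because its logarithm is the
      sum of the logarithmic heights, a polynomial expression in them, as G requires.\<close>
    define H where "H = (\<Prod>i\<in>{1..m}. h i)"
    have hH: "h i \<le> H" if "i \<in> {1..m}" for i
    proof -
      have "1 \<le> (\<Prod>i\<in>{1..m}-{i}. h i)" using h1 by (intro prod_ge_1) auto
      then have "h i * 1 \<le> h i * (\<Prod>i\<in>{1..m}-{i}. h i)" using h1[OF that] by (intro mult_left_mono) auto
      then show ?thesis using that by (simp add: H_def prod.remove)
    qed
    have H1: "1 \<le> H" unfolding H_def using h1 by (intro prod_ge_1) auto
    define L where "L = (\<Sum>i\<in>{1..m}. ln (real_of_int (h i)))"
    have lnH: "ln (real_of_int H) = L"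
    proof -
      have "ln (\<Prod>i\<in>{1..m}. real_of_int (h i)) = L"
        unfolding L_def using h1 by (intro ln_prod) force+
      then show ?thesis by (simp add: H_def)
    qed
    have L0: "0 \<le> L" using H1 by (simp flip: lnH)
    define u where "u = 1 + L + real s"
    have u1: "1 \<le> u" using L0 by (simp add: u_def)
    have u3: "1 \<le> \<kappa> * u ^ 3" using u1 \<kappa>(1) by (intro one_le_mult one_le_power) auto
    define b where "b = nat \<lceil>\<kappa> * u ^ 3\<rceil>"
    have b: "\<kappa> * u ^ 3 \<le> real b" "real b \<le> \<kappa> * u ^ 3 + 1" unfolding b_def using u3 by linarith+
    have b1: "1 \<le> b" using b(1) u3 by linarith
    have lb: "0 \<le> ln (real b)" using b1 by simp
    have "\<exists>t :: 'r \<Rightarrow> int. (\<forall>j. 0 \<le> t j \<and> t j \<le> int b ^ 4) \<and>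
      (\<forall>i\<in>{1..m}. irreducible (substitute_set (Inl ` UNIV) (\<lambda>v. of_int (case_sum t (\<lambda>_. 0) v)) (F' i)) \<and>
       total_degree (substitute_set (Inl ` UNIV) (\<lambda>v. of_int (case_sum t (\<lambda>_. 0) v)) (F' i)) \<le> d \<and>
       1 \<le> degree_in (range Inr) (substitute_set (Inl ` UNIV) (\<lambda>v. of_int (case_sum t (\<lambda>_. 0) v)) (F' i)) \<and>
       (\<forall>e. \<exists>z. Poly_Mapping.lookup (substitute_set (Inl ` UNIV) (\<lambda>v. of_int (case_sum t (\<lambda>_. 0) v)) (F' i)) e = of_int z
          \<and> \<bar>z\<bar> \<le> height_step d b H (card (UNIV :: 'r set)))) \<and>
      substitute_set UNIV (\<lambda>j. of_int (t j)) P \<noteq> 0 \<and> total_degree (substitute_set UNIV (\<lambda>j. of_int (t j)) P) \<le> s"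
    proof (rule specialize_variables[where C = C])
      fix i assume i: "i \<in> {1..m}"
      have "Poly_Mapping.keys (F' i) = Poly_Mapping.keys (F i)"
        using k[OF i] by (auto simp: F'_def in_keys_iff lookup_mconst_mult)
      then have "degree_in V (F' i) = degree_in V (F i)" for V by (simp add: degree_in_def)
      moreover have "irreducible (F' i)" unfolding F'_def using F i k[OF i] by (intro irreducible_mconst_mult) auto
      moreover have "\<forall>e. \<exists>z. Poly_Mapping.lookup (F' i) e = of_int z \<and> \<bar>z\<bar> \<le> H"
        using k[OF i] hH[OF i] unfolding F'_def by (meson order_trans)
      ultimately show "irreducible (F' i) \<and> total_degree (F' i) \<le> d \<and> 1 \<le> degree_in (range Inr) (F' i) \<and>
        (\<forall>e. \<exists>z. Poly_Mapping.lookup (F' i) e = of_int z \<and> \<bar>z\<bar> \<le> H)"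
        using F i by (simp add: total_degree_def)
    next
      show "P \<noteq> 0" using P by (auto simp: total_degree_def degree_in_def)
      fix j assume "j < card (UNIV :: 'r set)"
      then have j: "real j \<le> real \<rho>" by (simp add: \<rho>_def)
      have "1 + ln (real_of_int (height_step d b H j)) + ln (real b) \<le> c2 * (u + ln (real b))"
      proof -
        have "real j * (ln (real d + 1) + 4 * real d * ln (real b)) \<le> real \<rho> * (ln (real d + 1) + 4 * real d * ln (real b))"
          using j lb l0 by (intro mult_right_mono) auto
        moreover have "real \<rho> * ln (real d + 1) * 1 \<le> real \<rho> * ln (real d + 1) * (u + ln (real b))"
          using u1 lb l0 by (intro mult_left_mono) auto
        moreover have "4 * real d * real \<rho> * ln (real b) \<le> 4 * real d * real \<rho> * (u + ln (real b))"
          using u1 by (intro mult_left_mono) auto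
        moreover have "c2 * (u + ln (real b)) = (u + ln (real b)) + real \<rho> * ln (real d + 1) * (u + ln (real b)) + 4 * real d * real \<rho> * (u + ln (real b))"
          by (simp add: c2_def algebra_simps)
        ultimately show ?thesis unfolding ln_height_step[OF H1 b1] lnH by (simp add: u_def algebra_simps)
      qed
      moreover have "0 \<le> 1 + ln (real_of_int (height_step d b H j)) + ln (real b)"
        using height_step_ge_1[OF H1 b1, of d j] lb by simp
      ultimately have "(1 + ln (real_of_int (height_step d b H j)) + ln (real b))\<^sup>2 \<le> (c2 * (u + ln (real b)))\<^sup>2"
        by (intro power_mono)
      then have "real m * (C * (1 + ln (real_of_int (height_step d b H j)) + ln (real b))\<^sup>2 * real b ^ 3) \<le>
          real m * (C * (c2 * (u + ln (real b)))\<^sup>2 * real b ^ 3)"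
        using C(1) by (intro mult_left_mono mult_right_mono) auto
      also have "\<dots> = (real m * (C * c2\<^sup>2)) * ((u + ln (real b))\<^sup>2 * real b ^ 3)" by (simp add: power_mult_distrib)
      also have "\<dots> \<le> c * ((u + ln (real b))\<^sup>2 * real b ^ 3)" by (intro mult_right_mono) (auto simp: c_def)
      finally have 1: "real m * (C * (1 + ln (real_of_int (height_step d b H j)) + ln (real b))\<^sup>2 * real b ^ 3) \<le>
          c * (u + ln (real b))\<^sup>2 * real b ^ 3" by (simp add: mult.assoc)
      have "(real m * real d + 1) * u \<le> c * u" using C(1) u1 by (intro mult_right_mono) (auto simp: c_def)
      moreover have "real m * real d * 1 \<le> real m * real d * u" using u1 by (intro mult_left_mono) auto
      moreover have "real s \<le> u" using L0 by (simp add: u_def)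
      ultimately have 2: "real m * real d + real s \<le> c * u" by (simp add: algebra_simps)
      have "c * (u + ln (real b))\<^sup>2 * real b ^ 3 + c * u \<le> real b ^ 4" using \<kappa>(2) u1 b(1) by blast
      then show "real m * (C * (1 + ln (real_of_int (height_step d b H j)) + ln (real b))\<^sup>2 * real b ^ 3) + real m * real d + real s \<le> real b ^ 4"
        using 1 2 by linarith
    qed (use C(2) P H1 b1 in auto)
    then obtain t where t: "\<And>j. 0 \<le> t j \<and> t j \<le> int b ^ 4"
      "\<And>i. i \<in> {1..m} \<Longrightarrow> irreducible (substitute_set (range Inl) (\<lambda>v. of_int (case_sum t (\<lambda>_. 0) v)) (F' i))"
      "substitute_set UNIV (\<lambda>j. of_int (t j)) P \<noteq> 0" by blast
    show "\<exists>t :: 'r \<Rightarrow> int.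
                 (\<forall>j. 0 \<le> t j) \<and>
                 (\<lambda>j. of_int (t j)) \<notin> rational_zeros P \<and>
                 of_int (height_tuple t) \<le>
                   1 * eval_mpoly (\<lambda>i. if i \<le> m then ln (of_int (coeff_height (F i))) else of_nat s) (bound_poly m \<kappa>) \<and>
                 (\<forall>i\<in>{1..m}. irreducible (specialize (\<lambda>j. of_int (t j)) (F i)))"
    proof (intro exI[of _ t] conjI allI ballI)
      show "0 \<le> t j" for j using t(1) by blast
      show "(\<lambda>j. of_int (t j)) \<notin> rational_zeros P"
        using t(3) unfolding substitute_set_UNIV by (auto simp: rational_zeros_def)
      have "height_tuple t \<le> int b ^ 4"
        unfolding height_tuple_def using t(1) b1 by (subst Max_le_iff) (auto intro: one_le_power)
      then have "real_of_int (height_tuple t) \<le> real b ^ 4" by (metis of_int_le_iff of_int_of_nat_eq of_int_power)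
      also have "\<dots> \<le> (2 * (\<kappa> * u ^ 3)) ^ 4" using b(2) u3 by (intro power_mono) auto
      also have "\<dots> = 16 * \<kappa> ^ 4 * u ^ 12" by (simp add: power_mult_distrib flip: power_mult)
      also have "u = 1 + (\<Sum>i\<in>{1..m}. ln (real_of_int (coeff_height (F i)))) + real s"
        by (simp add: u_def L_def h_def)
      finally show "of_int (height_tuple t) \<le>
          1 * eval_mpoly (\<lambda>i. if i \<le> m then ln (of_int (coeff_height (F i))) else of_nat s) (bound_poly m \<kappa>)"
        unfolding eval_bound_poly by simp
      fix i assume i: "i \<in> {1..m}"
      have "irreducible (specialize (\<lambda>j. of_int (t j)) (F' i))"
        by (rule irreducible_specialize[OF t(2)[OF i]]) simp
      then have "irreducible (mconst (k i) * specialize (\<lambda>j. of_int (t j)) (F i))"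
        by (simp add: F'_def specialize_mconst_mult)
      then have *: "irreducible (mconst (inverse (k i)) * (mconst (k i) * specialize (\<lambda>j. of_int (t j)) (F i)))"
        by (rule irreducible_mconst_mult) (use k[OF i] in simp)
      have "mconst (inverse (k i)) * (mconst (k i) * specialize (\<lambda>j. of_int (t j)) (F i)) = specialize (\<lambda>j. of_int (t j)) (F i)"
        unfolding mult.assoc[symmetric] mult_single using k[OF i] by (simp add: single_one)
      with * show "irreducible (specialize (\<lambda>j. of_int (t j)) (F i))" by (simp only:)
    qed
  qed
qed

end
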